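(* Let $\sigma^2>0$, $r>0$, $\alpha\in(0,2)$, and for $h>0$ let $\tilde Z_h=\sigma B_h+S_h$, where $B$ is a standard Brownian motion and $S$ is an independent symmetric $\alpha$-stable Lévy process with Lévy measure $r\alpha|z|^{-1-\alpha}\,dz$. Let $\mathcal I_h^{r,r},\mathcal I_h^{r,\alpha},\mathcal I_h^{\alpha,\alpha}$ denote the entries, with respect to the parameters $r$ and $\alpha$, of the Fisher information matrix of the single observation $\tilde Z_h$. Then, as $h\to0$, $$\frac{(h\log(1/h))^{\alpha/2}}{h}\begin{pmatrix}1&0\\0&\frac1{\log(1/h)}\end{pmatrix}\begin{pmatrix}\mathcal I_h^{r,r}&\mathcal I_h^{r,\alpha}\\ \mathcal I_h^{r,\alpha}&\mathcal I_h^{\alpha,\alpha}\end{pmatrix}\begin{pmatrix}1&0\\0&\frac1{\log(1/h)}\end{pmatrix}\longrightarrow\frac{2r}{\sigma^\alpha(2-\alpha)^{\alpha/2}}\begin{pmatrix}\frac1{r^2}&\frac1{2r}\\ \frac1{2r}&\frac14\end{pmatrix}.$$ In particular, the limiting matrix is singular.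
   Context: If $p_h(x)=p_h(x;\sigma^2,r,\alpha)$ is the Lebesgue density of $\tilde Z_h$, the Fisher information entries are $\mathcal I_h^{a,b}=\int \frac{\partial_a p_h(x)\,\partial_b p_h(x)}{p_h(x)}\,dx$ for $a,b\in\{r,\alpha\}$. The process $S$ is symmetric without drift, i.e. $\mathbb E e^{i\lambda S_h}=\exp\left(h\int(\cos(\lambda z)-1)\,r\alpha|z|^{-1-\alpha}dz\right)$. *)

theory Defs
  imports "HOL-Probability.Probability"
begin

definition levy_process :: "'w measure \<Rightarrow> (real \<Rightarrow> 'w \<Rightarrow> real) \<Rightarrow> bool" where
  "levy_process M X \<longleftrightarrow>
     prob_space M \<and>
     (\<forall>t\<ge>0. X t \<in> borel_measurable M) \<and>
     (AE \<omega> in M. X 0 \<omega> = 0) \<and>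
     (\<forall>(n::nat) (t::nat \<Rightarrow> real). 0 \<le> t 0 \<longrightarrow> (\<forall>i<n. t i \<le> t (Suc i)) \<longrightarrow>
        prob_space.indep_vars M (\<lambda>_. borel) (\<lambda>i \<omega>. X (t (Suc i)) \<omega> - X (t i) \<omega>) {..<n}) \<and>
     (\<forall>s\<ge>0. \<forall>t\<ge>0. distr M borel (\<lambda>\<omega>. X (s + t) \<omega> - X s \<omega>) = distr M borel (X t)) \<and>
     (AE \<omega> in M. \<forall>t\<ge>0. ((\<lambda>s. X s \<omega>) \<longlongrightarrow> X t \<omega>) (at_right t) \<and>
        (t > 0 \<longrightarrow> (\<exists>l. ((\<lambda>s. X s \<omega>) \<longlongrightarrow> l) (at_left t))))"

definition standard_brownian_motion :: "'w measure \<Rightarrow> (real \<Rightarrow> 'w \<Rightarrow> real) \<Rightarrow> bool" where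
  "standard_brownian_motion M B \<longleftrightarrow>
     levy_process M B \<and>
     (AE \<omega> in M. continuous_on {0..} (\<lambda>t. B t \<omega>)) \<and>
     (\<forall>t>0. distributed M lborel (B t) (\<lambda>x. ennreal (normal_density 0 (sqrt t) x)))"

text \<open>The Levy measure \<open>r \<alpha> |z|\<^sup>-\<^sup>1\<^sup>-\<^sup>\<alpha> dz\<close> enters through the Levy--Khintchine formula. By symmetry of
  the measure, and as there is neither drift nor Gaussian part, the exponent reduces to the
  integral of \<open>cos (u z) - 1\<close>, which converges absolutely for \<open>0 < \<alpha> < 2\<close>.\<close>

definition symmetric_stable_process ::
    "'w measure \<Rightarrow> real \<Rightarrow> real \<Rightarrow> (real \<Rightarrow> 'w \<Rightarrow> real) \<Rightarrow> bool" where
  "symmetric_stable_process M r \<alpha> S \<longleftrightarrow>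
     levy_process M S \<and>
     (\<forall>h\<ge>0. \<forall>u. char (distr M borel (S h)) u =
        exp (complex_of_real
          (h * (\<integral>z. (cos (u * z) - 1) * (r * \<alpha> * \<bar>z\<bar> powr (- 1 - \<alpha>)) \<partial>lborel))))"

definition independent_processes ::
    "'w measure \<Rightarrow> (real \<Rightarrow> 'w \<Rightarrow> real) \<Rightarrow> (real \<Rightarrow> 'w \<Rightarrow> real) \<Rightarrow> bool" where
  "independent_processes M X Y \<longleftrightarrow>
     prob_space.indep_var M
       (\<Pi>\<^sub>M t\<in>{0..}. borel) (\<lambda>\<omega>. \<lambda>t\<in>{0..}. X t \<omega>)
       (\<Pi>\<^sub>M t\<in>{0..}. borel) (\<lambda>\<omega>. \<lambda>t\<in>{0..}. Y t \<omega>)"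

text \<open>A Lebesgue density is only determined almost everywhere, whereas the Fisher information
  differentiates it pointwise in the parameters. The continuous version, if it exists, is
  unique.\<close>

definition lebesgue_density :: "'w measure \<Rightarrow> ('w \<Rightarrow> real) \<Rightarrow> real \<Rightarrow> real" where
  "lebesgue_density M X =
     (THE f. continuous_on UNIV f \<and> (\<forall>x. 0 \<le> f x) \<and>
        distributed M lborel X (\<lambda>x. ennreal (f x)))"

text \<open>Component 1 belongs to the parameter \<open>r\<close>, component 2 to \<open>\<alpha>\<close>.\<close>

definition density_gradient ::
    "(real \<Rightarrow> real \<Rightarrow> real \<Rightarrow> real) \<Rightarrow> real \<Rightarrow> real \<Rightarrow> real \<Rightarrow> real ^ 2" where
  "density_gradient p r \<alpha> x =
     vector [deriv (\<lambda>r'. p r' \<alpha> x) r, deriv (\<lambda>\<alpha>'. p r \<alpha>' x) \<alpha>]"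

definition fisher_information ::
    "(real \<Rightarrow> real \<Rightarrow> real \<Rightarrow> real) \<Rightarrow> real \<Rightarrow> real \<Rightarrow> real ^ 2 ^ 2" where
  "fisher_information p r \<alpha> =
     (\<chi> a b. \<integral>x. density_gradient p r \<alpha> x $ a * density_gradient p r \<alpha> x $ b / p r \<alpha> x \<partial>lborel)"

end

theory Submission
  imports Defs "HOL-Complex_Analysis.Complex_Analysis" "HOL-Real_Asymp.Real_Asymp"
begin

text \<open>Put \<open>L = ln (1/h)\<close> and \<open>x = sqrt h * y\<close>. The law of the rescaled observation is a
  centred Gaussian law perturbed by a symmetric stable law whose Levy measure carries the small factor
  \<open>s = r h^(1-\<alpha>/2)\<close>. Its density and its derivatives in the parameters are Fourier integrals of
  \<open>exp (-\<sigma>^2 v^2/2 - \<mu> v^\<alpha>)\<close> against \<open>1\<close>, \<open>v^\<alpha>\<close> and \<open>v^\<alpha> ln v\<close>. Rotating the half line of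
  integration into the upper half plane turns the oscillation into exponential decay and gives, uniformly
  in small \<open>\<mu>\<close>, the tail \<open>\<alpha> |y|^(-1-\<alpha>)\<close> of the derivative in \<open>s\<close>; by the mean value theorem the
  density is the Gaussian one plus \<open>s \<alpha> |y|^(-1-\<alpha>) (1 + o(1))\<close>. On the scale \<open>y = sqrt L * w\<close> the
  Gaussian part dominates for \<open>|w| < \<sigma> sqrt (2-\<alpha>)\<close>, where the information is negligible, and vanishes
  for \<open>|w| > \<sigma> sqrt (2-\<alpha>)\<close>, where the jump part alone survives, so dominated convergence yields the limit
  of all three entries. The score in \<open>\<alpha>\<close> is \<open>r L / 2\<close> times the score in \<open>r\<close> up to lower order, because
  \<open>\<alpha>\<close> enters \<open>s\<close> through \<open>h^(-\<alpha>/2)\<close>; hence the limit is singular.\<close>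

section \<open>Rotating a ray of integration\<close>

text \<open>The normalisation can be read off heuristically. Where the jump part survives, the
  density is near s \<alpha> |y|^(-1-\<alpha>) and its derivative in r is that quantity over r. The
  information in r is then near 1/r^2 times the integral of s \<alpha> |y|^(-1-\<alpha>) over |y| >
  sqrt L * w0, that is (2 s / r^2) (sqrt L * w0)^(-\<alpha>), with w0 = \<sigma> sqrt (2-\<alpha>).
  Inserting s gives (2/r) w0^(-\<alpha>) h / (h L)^(\<alpha>/2).

  The obstacle is a tail estimate with vanishing relative error that is uniform in \<mu> down to
  \<mu> = 0. The rotation has to be done in two stages. The Gaussian factor grows beyond the angle
  pi/4, so the damped integral is turned only up to a ray of slope 1/2. There the damping is
  replaced by 1, and what remains, which is not absolutely integrable on the real axis, is turned on
  to the imaginary axis, where it is a Gamma integral.\<close>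

lemma set_integral_halfline_closed:
  fixes f :: "real \<Rightarrow> 'a::{banach, second_countable_topology}"
  assumes "set_integrable lborel {0<..} f"
  shows "set_integrable lborel {0..} f"
    and "(LINT t:{0..}|lborel. f t) = (LINT t:{0<..}|lborel. f t)"
proof -
  have eq: "(\<lambda>t. indicator {0..} t *\<^sub>R f t)
      = (\<lambda>t. indicator {0<..} t *\<^sub>R f t + indicator {0::real} t *\<^sub>R f 0)"
    by (auto simp: fun_eq_iff indicator_def)
  have i: "integrable lborel (\<lambda>t. indicator {0<..} t *\<^sub>R f t)"
    using assms by (simp add: set_integrable_def)
  have z: "integrable lborel (\<lambda>t. indicator {0::real} t *\<^sub>R f 0)"
    by (intro integrable_scaleR_left integrable_real_indicator) auto
  show "set_integrable lborel {0..} f"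
    unfolding set_integrable_def eq using i z by simp
  have "(LINT t|lborel. indicator {0::real} t *\<^sub>R f 0) = 0"
    by (subst integral_scaleR_left) auto
  then show "(LINT t:{0..}|lborel. f t) = (LINT t:{0<..}|lborel. f t)"
    unfolding set_lebesgue_integral_def eq using i z by simp
qed

lemma contour_integral_ray:
  fixes f :: "complex \<Rightarrow> complex"
  assumes "R > 0" and cont: "continuous_on ((\<lambda>t. of_real t * w) ` {0..R}) f"
  shows "contour_integral (linepath 0 (of_real R * w)) f = w * (LINT t:{0..R}|lborel. f (of_real t * w))"
proof -
  have c: "continuous_on {0..R} (\<lambda>t. f (of_real t * w))"
    by (rule continuous_on_compose2[OF cont]) (auto intro!: continuous_intros)
  then have si: "set_integrable lborel {0..R} (\<lambda>t. f (of_real t * w))"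
    by (rule borel_integrable_atLeastAtMost')
  define I where "I = (LINT t:{0..R}|lborel. f (of_real t * w))"
  have "((\<lambda>t. f (of_real t * w)) has_integral I) {0..R}"
    using set_borel_integral_eq_integral[OF si] by (simp add: I_def has_integral_integral)
  then have "((\<lambda>x. f (of_real (R *\<^sub>R x + 0) * w)) has_integral (I /\<^sub>R R ^ DIM(real)))
         (cbox ((0 - 0) /\<^sub>R R) ((R - 0) /\<^sub>R R))"
    using \<open>R > 0\<close> by (intro has_integral_affinity') auto
  then have "((\<lambda>x. f (of_real (R * x) * w)) has_integral (I /\<^sub>R R)) {0..1}"
    using \<open>R > 0\<close> by simp
  then have "((\<lambda>x. f (of_real (R * x) * w) * (of_real R * w)) has_integral (I /\<^sub>R R) * (of_real R * w)) {0..1}"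
    by (rule has_integral_mult_left)
  moreover have "(I /\<^sub>R R) * (of_real R * w) = w * I"
    using \<open>R > 0\<close> by (simp add: scaleR_conv_of_real field_simps)
  ultimately have "((\<lambda>x. f (of_real (R * x) * w) * (of_real R * w)) has_integral w * I) {0..1}"
    by simp
  then have "((\<lambda>x. f (linepath 0 (of_real R * w) x) * (of_real R * w - 0)) has_integral w * I) {0..1}"
    by (simp add: linepath_def scaleR_conv_of_real mult_ac)
  then have "(f has_contour_integral w * I) (linepath 0 (of_real R * w))"
    by (subst has_contour_integral_linepath)
  then show ?thesis by (simp add: I_def contour_integral_unique)
qed

text \<open>Cauchy's theorem on the triangle with vertices 0, R w1, R w2, which stays inside the
  convex cone \<open>C\<close>; the third side contributes at most its length, proportional to R,
  times \<open>b R\<close>. Holomorphy is demanded away from 0 only, because fractional powers are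
  merely continuous there.\<close>

lemma ray_rotation:
  fixes f :: "complex \<Rightarrow> complex" and C :: "complex set"
  assumes C: "convex C" "0 \<in> C" "\<And>z t. z \<in> C \<Longrightarrow> t \<ge> 0 \<Longrightarrow> of_real t * z \<in> C"
    and w: "w1 \<in> C" "w2 \<in> C"
    and cont: "continuous_on C f"
    and diff: "\<And>z. z \<in> C \<Longrightarrow> z \<noteq> 0 \<Longrightarrow> f field_differentiable at z"
    and int: "set_integrable lborel {0<..} (\<lambda>t. f (of_real t * w1))"
             "set_integrable lborel {0<..} (\<lambda>t. f (of_real t * w2))"
    and bound: "\<And>R z. R > 0 \<Longrightarrow> z \<in> closed_segment (of_real R * w1) (of_real R * w2) \<Longrightarrow> norm (f z) \<le> b R"
    and lim: "((\<lambda>R. R * b R) \<longlongrightarrow> 0) at_top"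
  shows "w1 * (LINT t:{0<..}|lborel. f (of_real t * w1)) = w2 * (LINT t:{0<..}|lborel. f (of_real t * w2))"
proof -
  let ?I = "\<lambda>w R. LINT t:{0..R}|lborel. f (of_real t * w)"
  have ray: "w \<in> C \<Longrightarrow> R > 0 \<Longrightarrow> contour_integral (linepath 0 (of_real R * w)) f = w * ?I w R" for w R
    by (rule contour_integral_ray) (auto intro!: continuous_on_subset[OF cont] C(3))
  have seg: "a \<in> C \<Longrightarrow> b \<in> C \<Longrightarrow> closed_segment a b \<subseteq> C" for a b
    using C(1) by (simp add: closed_segment_subset)
  have key: "norm (w1 * ?I w1 R - w2 * ?I w2 R) \<le> (R * b R) * norm (w2 - w1)" if "R > 0" for R
  proof -
    let ?a = "of_real R * w1" and ?b = "of_real R * w2"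
    have ab: "?a \<in> C" "?b \<in> C" using C(3) w that by auto
    have hull: "convex hull {0, ?a, ?b} \<subseteq> C"
      using C ab by (intro hull_minimal) auto
    have "(f has_contour_integral 0) (linepath 0 ?a +++ linepath ?a ?b +++ linepath ?b 0)"
    proof (rule Cauchy_theorem_triangle_cofinite[where S="{0}"])
      show "continuous_on (convex hull {0, ?a, ?b}) f"
        using cont hull by (rule continuous_on_subset)
      fix x assume "x \<in> interior (convex hull {0, ?a, ?b}) - {0}"
      then show "f field_differentiable at x"
        using hull interior_subset by (intro diff) auto
    qed auto
    moreover have ci: "f contour_integrable_on linepath x y" if "x \<in> C" "y \<in> C" for x y
      using that by (intro contour_integrable_continuous_linepath continuous_on_subset[OF cont] seg)
    ultimately have "contour_integral (linepath 0 ?a) f + contour_integral (linepath ?a ?b) f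
        + contour_integral (linepath ?b 0) f = 0"
      using ab C(2) by (auto dest!: contour_integral_unique simp: ci add.assoc)
    moreover have "contour_integral (linepath ?b 0) f = - contour_integral (linepath 0 ?b) f"
      using ab C(2) seg[OF C(2) ab(2)]
      by (metis contour_integral_reverse_linepath cont continuous_on_subset add.inverse_inverse)
    ultimately have "w1 * ?I w1 R - w2 * ?I w2 R = - contour_integral (linepath ?a ?b) f"
      using ray[OF w(1) that] ray[OF w(2) that] by algebra
    moreover have "norm (contour_integral (linepath ?a ?b) f) \<le> b R * norm (?b - ?a)"
    proof (rule contour_integral_bound_linepath)
      show "f contour_integrable_on linepath ?a ?b" using ab by (rule ci)
      have "norm (f ?a) \<le> b R" using bound[OF that, of ?a] by auto
      then show "0 \<le> b R" by (rule order_trans[OF norm_ge_zero])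
    qed (use bound[OF that] in auto)
    moreover have "norm (?b - ?a) = R * norm (w2 - w1)"
      using that by (simp add: norm_mult flip: right_diff_distrib)
    ultimately show ?thesis by (simp add: mult_ac)
  qed
  have lims: "((\<lambda>R. w1 * ?I w1 R - w2 * ?I w2 R) \<longlongrightarrow>
      w1 * (LINT t:{0..}|lborel. f (of_real t * w1)) - w2 * (LINT t:{0..}|lborel. f (of_real t * w2))) at_top"
    by (intro tendsto_intros tendsto_set_lebesgue_integral_at_top set_integral_halfline_closed(1) int) auto
  have "((\<lambda>R. w1 * ?I w1 R - w2 * ?I w2 R) \<longlongrightarrow> 0) at_top"
  proof (rule Lim_null_comparison)
    show "eventually (\<lambda>R. norm (w1 * ?I w1 R - w2 * ?I w2 R) \<le> (R * b R) * norm (w2 - w1)) at_top"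
      using eventually_gt_at_top[of 0] by eventually_elim (rule key)
    show "((\<lambda>R. (R * b R) * norm (w2 - w1)) \<longlongrightarrow> 0) at_top"
      using tendsto_mult_right[OF lim] by simp
  qed
  from tendsto_unique[OF _ lims this] show ?thesis
    using set_integral_halfline_closed(2)[OF int(1)] set_integral_halfline_closed(2)[OF int(2)] by simp
qed

text \<open>Majorants on the rotated ray are sums of such integrands with \<open>l = y / 2\<close>,
  so this turns powers of t into powers of 1/y.\<close>

lemma gamma_integral:
  fixes b l :: real
  assumes "b > 0" "l > 0"
  shows "set_integrable lborel {0<..} (\<lambda>t. t powr (b - 1) * exp (- (l * t)))"
    and "(LINT t:{0<..}|lborel. t powr (b - 1) * exp (- (l * t))) = Gamma b / l powr b"
proof -
  let ?g = "\<lambda>t. indicator {0..} t * t powr (b - 1) / exp t :: real"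
  have g: "has_bochner_integral lborel ?g (Gamma b)"
  proof (rule has_bochner_integral_nn_integral)
    show "(\<integral>\<^sup>+ x. ennreal (?g x) \<partial>lborel) = ennreal (Gamma b)"
      using Gamma_conv_nn_integral_real[OF assms(1)] by simp
  qed (use assms in \<open>auto intro!: AE_I2 Gamma_real_nonneg\<close>)
  then have "has_bochner_integral lborel (\<lambda>t. ?g (0 + l * t)) (Gamma b /\<^sub>R \<bar>l\<bar>)"
    using assms by (subst (asm) lborel_has_bochner_integral_real_affine_iff[of l _ _ 0]) auto
  then have "has_bochner_integral lborel (\<lambda>t. l powr (1 - b) * ?g (0 + l * t)) (l powr (1 - b) * (Gamma b /\<^sub>R \<bar>l\<bar>))"
    by (rule has_bochner_integral_mult_right)
  moreover have "(\<lambda>t. l powr (1 - b) * ?g (0 + l * t)) = (\<lambda>t. indicator {0<..} t *\<^sub>R (t powr (b - 1) * exp (- (l * t))))"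
  proof (rule ext)
    fix t :: real
    have "l powr (1 - b) * (l powr (b - 1)) = 1"
      using assms by (simp flip: powr_add)
    then show "l powr (1 - b) * ?g (0 + l * t) = indicator {0<..} t *\<^sub>R (t powr (b - 1) * exp (- (l * t)))"
      using assms by (auto simp: indicator_def powr_mult exp_minus field_simps zero_le_mult_iff)
  qed
  moreover have "l powr (1 - b) * (Gamma b /\<^sub>R \<bar>l\<bar>) = Gamma b / l powr b"
    using assms by (simp add: powr_diff field_simps)
  ultimately have "has_bochner_integral lborel (\<lambda>t. indicator {0<..} t *\<^sub>R (t powr (b - 1) * exp (- (l * t)))) (Gamma b / l powr b)"
    by simp
  then show "set_integrable lborel {0<..} (\<lambda>t. t powr (b - 1) * exp (- (l * t)))"
    and "(LINT t:{0<..}|lborel. t powr (b - 1) * exp (- (l * t))) = Gamma b / l powr b"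
    unfolding set_integrable_def set_lebesgue_integral_def by (simp_all add: has_bochner_integral_iff)
qed

section \<open>Gaussian and stable damping in a sector\<close>

text \<open>The slope keeps \<open>z^\<alpha>\<close> in the right half plane for every \<open>\<alpha> < 2\<close> and \<open>Re (z^2)\<close> comparable
  to \<open>|z|^2\<close>, so that both damping factors stay bounded.\<close>

definition sector :: "complex set" where
  "sector = {z. 0 \<le> Im z \<and> 2 * Im z \<le> Re z}"

abbreviation sector_ray :: complex where "sector_ray \<equiv> Complex 1 (1/2)"

lemma convex_sector: "convex sector"
proof -
  have "sector = {z. Im z \<ge> 0} \<inter> {z. inner (Complex (-1) 2) z \<le> 0}"
    by (auto simp: sector_def inner_complex_def)
  then show ?thesis
    using convex_Int[OF convex_halfspace_Im_ge[of 0] convex_halfspace_le[of "Complex (-1) 2" 0]] by simp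
qed

lemma sector_scale: "z \<in> sector \<Longrightarrow> t \<ge> 0 \<Longrightarrow> of_real t * z \<in> sector"
  by (auto simp: sector_def) (metis mult_left_mono mult.left_commute)

lemma of_real_in_sector: "t \<ge> 0 \<Longrightarrow> of_real t \<in> sector"
  by (simp add: sector_def)

lemma sector_ray_in_sector: "sector_ray \<in> sector"
  by (simp add: sector_def)

lemma sector_nonzero: "z \<in> sector \<Longrightarrow> z \<noteq> 0 \<Longrightarrow> Re z > 0"
  by (auto simp: sector_def complex_eq_iff)

text \<open>Slope at most 1/2 means 4 (Im z)^2 <= (Re z)^2, so Re (z^2) is even at least 3/5 of
  |z|^2; the factor 1/2 is a convenient weakening.\<close>

lemma sector_Re_square:
  assumes "z \<in> sector"
  shows "(norm z)^2 / 2 \<le> Re (z^2)"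
proof -
  have "(2 * Im z)^2 \<le> (Re z)^2"
    using assms by (intro power_mono) (auto simp: sector_def)
  then have "4 * (Im z)^2 \<le> (Re z)^2"
    by (simp add: power_mult_distrib)
  moreover have "(a + b) / 2 \<le> a - b" if "4 * b \<le> a" "0 \<le> b" for a b :: real
    using that by (simp add: field_simps)
  ultimately show ?thesis by (simp only: cmod_power2 Re_power2 zero_le_power2)
qed

text \<open>The argument \<theta> of z is bounded without computing an arctangent: z^2 still has
  nonnegative real part, so |2 \<theta>| <= pi/2, and \<alpha> < 2 passes this on to \<alpha>
  \<theta>, whose cosine is then nonnegative.\<close>

lemma sector_Re_powr:
  assumes "z \<in> sector" "0 < \<alpha>" "\<alpha> < 2"
  shows "0 \<le> Re (z powr of_real \<alpha>)"
proof (cases "z = 0")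
  case False
  define \<theta> where "\<theta> = Im (Ln z)"
  have "\<bar>\<theta>\<bar> < pi / 2"
    using sector_nonzero[OF assms(1) False] Re_Ln_pos_lt[OF False] by (simp add: \<theta>_def)
  then have "Ln (z^2) = 2 * Ln z"
    using False by (intro Ln_unique) (auto simp: \<theta>_def exp_double)
  moreover have "0 \<le> Re (z^2)"
    by (rule order_trans[OF _ sector_Re_square[OF assms(1)]]) simp
  ultimately have "\<bar>2 * \<theta>\<bar> \<le> pi / 2"
    using Re_Ln_pos_le[of "z^2"] False by (simp add: \<theta>_def)
  moreover have "\<bar>\<alpha> * \<theta>\<bar> \<le> \<bar>2 * \<theta>\<bar>"
    using assms by (simp add: abs_mult mult_right_mono)
  ultimately have "\<bar>\<alpha> * \<theta>\<bar> \<le> pi / 2" by simp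
  then have "0 \<le> cos (\<alpha> * \<theta>)" by (intro cos_ge_zero) auto
  moreover have "Re (z powr of_real \<alpha>) = exp (\<alpha> * Re (Ln z)) * cos (\<alpha> * \<theta>)"
    unfolding powr_def using False by (simp only: if_False Re_exp) (simp add: \<theta>_def)
  ultimately show ?thesis by simp
qed simp

text \<open>On the positive real axis this is the characteristic function of the rescaled
  observation with stable intensity \<mu>; the formula continues it to the sector.\<close>

definition damping :: "real \<Rightarrow> real \<Rightarrow> real \<Rightarrow> complex \<Rightarrow> complex" where
  "damping \<sigma> \<alpha> \<mu> z = exp (- (of_real (\<sigma>^2) * z^2 / 2) - of_real \<mu> * z powr of_real \<alpha>)"

lemma norm_damping_le:
  assumes "z \<in> sector" "0 < \<alpha>" "\<alpha> < 2" "\<mu> \<ge> 0"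
  shows "norm (damping \<sigma> \<alpha> \<mu> z) \<le> exp (- (\<sigma>^2 * (norm z)^2 / 4))"
proof -
  have "\<sigma>^2 * ((norm z)^2 / 2) \<le> \<sigma>^2 * Re (z^2)"
    by (intro mult_left_mono sector_Re_square assms) auto
  moreover have "0 \<le> \<mu> * Re (z powr of_real \<alpha>)"
    using sector_Re_powr[OF assms(1-3)] assms(4) by simp
  moreover have "norm (damping \<sigma> \<alpha> \<mu> z) = exp (- (\<sigma>^2 * Re (z^2) / 2) - \<mu> * Re (z powr of_real \<alpha>))"
    unfolding damping_def norm_exp_eq_Re by simp
  ultimately show ?thesis by simp
qed

lemma norm_damping_le_1:
  assumes "z \<in> sector" "0 < \<alpha>" "\<alpha> < 2" "\<mu> \<ge> 0"
  shows "norm (damping \<sigma> \<alpha> \<mu> z) \<le> 1"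
  by (rule order_trans[OF norm_damping_le[OF assms]]) simp

text \<open>Mean value inequality on the convex half plane Re z <= 0, where the derivative of exp
  has modulus at most 1.\<close>

lemma norm_exp_minus_1_le:
  fixes z :: complex
  assumes "Re z \<le> 0"
  shows "norm (exp z - 1) \<le> norm z"
proof -
  have "norm (exp z - exp 0) \<le> 1 * norm (z - 0)"
  proof (rule field_differentiable_bound[where f'=exp])
    show "convex {z. Re z \<le> 0}" by (rule convex_halfspace_Re_le)
  qed (use assms in \<open>auto intro!: DERIV_subset[OF DERIV_exp]\<close>)
  then show ?thesis by simp
qed

text \<open>First-order cost of dropping the damping. The exponent 2 is written as a real power so
  that \<open>gamma_integral\<close> applies to both terms; they produce the error exponents
  -3-\<alpha> and -1-2\<alpha> of the tail expansion.\<close>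

lemma norm_damping_minus_1_le:
  assumes "z \<in> sector" "0 < \<alpha>" "\<alpha> < 2" "\<mu> \<ge> 0"
  shows "norm (damping \<sigma> \<alpha> \<mu> z - 1) \<le> \<sigma>^2 / 2 * norm z powr 2 + \<mu> * norm z powr \<alpha>"
proof -
  let ?e = "- (of_real (\<sigma>^2) * z^2 / 2) - of_real \<mu> * z powr of_real \<alpha>"
  have "0 \<le> \<sigma>^2 * Re (z^2)"
    using order_trans[OF _ sector_Re_square[OF assms(1)], of 0] by simp
  moreover have "0 \<le> \<mu> * Re (z powr of_real \<alpha>)"
    using sector_Re_powr[OF assms(1-3)] assms(4) by simp
  ultimately have "norm (exp ?e - 1) \<le> norm ?e"
    by (intro norm_exp_minus_1_le) simp
  also have "\<dots> \<le> norm (of_real (\<sigma>^2) * z^2 / 2) + norm (of_real \<mu> * z powr of_real \<alpha>)"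
    by (rule order_trans[OF norm_triangle_ineq4]) simp
  also have "\<dots> = \<sigma>^2 / 2 * norm z powr 2 + \<mu> * norm z powr \<alpha>"
    using assms by (cases "z = 0") (simp_all add: norm_mult norm_divide norm_power norm_powr_real_powr')
  finally show ?thesis by (simp add: damping_def)
qed

lemma continuous_on_damping:
  assumes "0 < \<alpha>"
  shows "continuous_on sector (damping \<sigma> \<alpha> \<mu>)"
  unfolding damping_def using assms
  by (intro continuous_intros) (auto simp: sector_def)

lemma damping_differentiable:
  assumes "z \<in> sector" "z \<noteq> 0"
  shows "damping \<sigma> \<alpha> \<mu> field_differentiable at z"
proof -
  have "z \<notin> \<real>\<^sub>\<le>\<^sub>0" using sector_nonzero[OF assms] by (auto simp: complex_nonpos_Reals_iff)
  then show ?thesis unfolding damping_def field_differentiable_def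
    by (intro exI) (rule derivative_eq_intros has_field_derivative_powr | assumption | rule refl | simp)+
qed

text \<open>Completing the square gives c t^2 >= t - 1/(4c), so the Gaussian weight is dominated by
  an exponential one and \<open>gamma_integral\<close> applies.\<close>

lemma gaussian_halfline_integrable:
  fixes a c :: real
  assumes "a > -1" "c > 0"
  shows "set_integrable lborel {0<..} (\<lambda>t. t powr a * exp (- (c * t^2)))"
proof -
  have g: "set_integrable lborel {0<..} (\<lambda>t. exp (1 / (4 * c)) * (t powr a * exp (- t)))"
    using gamma_integral(1)[of "a + 1" 1] assms by simp
  have le: "- (c * t^2) \<le> 1 / (4 * c) + (- t)" for t :: real
  proof -
    have "0 \<le> (2 * c * t - 1)^2 / (4 * c)" using assms by simp
    also have "(2 * c * t - 1)^2 / (4 * c) = c * t^2 - t + 1 / (4 * c)"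
      using assms by (simp add: power2_eq_square field_simps)
    finally show ?thesis by simp
  qed
  show ?thesis
  proof (rule set_integrable_bound[OF g])
    show "set_borel_measurable lborel {0<..} (\<lambda>t. t powr a * exp (- (c * t^2)))"
      unfolding set_borel_measurable_def by measurable
    show "AE t in lborel. t \<in> {0<..} \<longrightarrow> norm (t powr a * exp (- (c * t^2))) \<le> norm (exp (1 / (4 * c)) * (t powr a * exp (- t)))"
    proof (intro AE_I2 impI)
      fix t :: real
      have "exp (- (c * t^2)) \<le> exp (1 / (4 * c)) * exp (- t)"
        using le[of t] by (simp flip: exp_add)
      then show "norm (t powr a * exp (- (c * t^2))) \<le> norm (exp (1 / (4 * c)) * (t powr a * exp (- t)))"
        by (simp add: abs_mult mult.left_commute mult_left_mono)
    qed
  qed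
qed

section \<open>Oscillatory integrals along the rays of the sector\<close>

lemma sector_sum_powr_pos: "(x::real) > 0 \<Longrightarrow> 1 \<le> x powr - \<eta> + x powr \<eta>"
proof -
  assume "x > 0"
  have "1 \<le> x powr - \<eta> \<or> 1 \<le> x powr \<eta>"
    using \<open>x > 0\<close> by (cases "x powr \<eta> \<ge> 1") (auto simp: powr_minus one_le_inverse_iff)
  then show ?thesis
  proof
    assume "1 \<le> x powr - \<eta>"
    then show ?thesis using powr_ge_zero[of x \<eta>] by linarith
  next
    assume "1 \<le> x powr \<eta>"
    then show ?thesis using powr_ge_zero[of x "-\<eta>"] by linarith
  qed
qed

lemma set_borel_measurable_ray:
  fixes f :: "complex \<Rightarrow> complex"
  assumes "continuous_on sector f" "w \<in> sector"
  shows "set_borel_measurable lborel {0<..} (\<lambda>t. f (of_real t * w))"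
proof -
  have "continuous_on {0<..} (\<lambda>t. f (of_real t * w))"
    by (rule continuous_on_compose2[OF assms(1)]) (auto intro!: continuous_intros sector_scale assms(2))
  then have "set_borel_measurable borel {0<..} (\<lambda>t. f (of_real t * w))"
    unfolding set_borel_measurable_def
    using borel_measurable_continuous_on_indicator[of "{0<..}" "\<lambda>t. f (of_real t * w)"] by simp
  then show ?thesis by (simp add: set_borel_measurable_def)
qed

lemma norm_phase_sector:
  assumes "z \<in> sector" "y \<ge> 0"
  shows "norm (exp (\<i> * z * of_real y)) \<le> 1"
  using assms by (simp add: sector_def norm_exp_eq_Re)

lemma norm_phase_sector_ray:
  "norm (exp (\<i> * (of_real t * sector_ray) * of_real y)) = exp (- (y / 2 * t))"
  unfolding norm_exp_eq_Re by (simp add: algebra_simps)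

lemma norm_sector_ray: "norm sector_ray \<le> 2"
  using cmod_le[of sector_ray] by simp

text \<open>One interface for the two amplitudes that occur, z^\<alpha> and z^\<alpha> Ln z. Two
  exponents are allowed because the logarithm costs a slightly smaller power near 0 and a slightly
  larger one at infinity.\<close>

locale sector_amplitude =
  fixes \<rho> :: "complex \<Rightarrow> complex" and K a b :: real
  assumes cont: "continuous_on sector \<rho>"
    and diff: "\<And>z. z \<in> sector \<Longrightarrow> z \<noteq> 0 \<Longrightarrow> \<rho> field_differentiable at z"
    and bound: "\<And>z. z \<in> sector \<Longrightarrow> norm (\<rho> z) \<le> K * (norm z powr a + norm z powr b)"
    and ab: "a > 0" "b > 0" "K \<ge> 0"
begin

lemma bound_ray:
  assumes "w \<in> sector" "t > 0"
  shows "norm (\<rho> (of_real t * w)) \<le> K * (norm w powr a * t powr a + norm w powr b * t powr b)"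
  using bound[OF sector_scale[OF assms(1), of t]] assms by (simp add: norm_mult powr_mult mult_ac)

context
  fixes \<sigma> \<alpha> \<mu> y :: real
  assumes par: "\<sigma> > 0" "0 < \<alpha>" "\<alpha> < 2" "\<mu> \<ge> 0" "y \<ge> 0"
begin

lemma bound_oscillation:
  assumes "z \<in> sector"
  shows "norm (exp (\<i> * z * of_real y) * \<rho> z * damping \<sigma> \<alpha> \<mu> z)
      \<le> K * (norm z powr a + norm z powr b) * exp (- (\<sigma>^2 * (norm z)^2 / 4))"
proof -
  have "norm (exp (\<i> * z * of_real y) * \<rho> z * damping \<sigma> \<alpha> \<mu> z)
      \<le> 1 * (K * (norm z powr a + norm z powr b)) * exp (- (\<sigma>^2 * (norm z)^2 / 4))"
    unfolding norm_mult using assms par ab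
    by (intro mult_mono norm_phase_sector bound norm_damping_le mult_nonneg_nonneg) auto
  then show ?thesis by simp
qed

lemma continuous_oscillation:
  "continuous_on sector (\<lambda>z. exp (\<i> * z * of_real y) * \<rho> z * damping \<sigma> \<alpha> \<mu> z)"
  by (intro continuous_intros cont continuous_on_damping par)

lemma integrable_oscillation_ray:
  assumes w: "w \<in> sector" "w \<noteq> 0"
  shows "set_integrable lborel {0<..}
    (\<lambda>t. exp (\<i> * (of_real t * w) * of_real y) * \<rho> (of_real t * w) * damping \<sigma> \<alpha> \<mu> (of_real t * w))"
proof -
  let ?c = "\<sigma>^2 * (norm w)^2 / 4"
  let ?g = "\<lambda>t. K * (norm w powr a * (t powr a * exp (- (?c * t^2))) + norm w powr b * (t powr b * exp (- (?c * t^2))))"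
  have "set_integrable lborel {0<..} ?g"
    using ab w par by (intro set_integrable_mult_right set_integral_add gaussian_halfline_integrable) auto
  then show ?thesis
  proof (rule set_integrable_bound)
    show "set_borel_measurable lborel {0<..}
       (\<lambda>t. exp (\<i> * (of_real t * w) * of_real y) * \<rho> (of_real t * w) * damping \<sigma> \<alpha> \<mu> (of_real t * w))"
      by (rule set_borel_measurable_ray[OF continuous_oscillation w(1)])
    show "AE t in lborel. t \<in> {0<..} \<longrightarrow>
       norm (exp (\<i> * (of_real t * w) * of_real y) * \<rho> (of_real t * w) * damping \<sigma> \<alpha> \<mu> (of_real t * w)) \<le> norm (?g t)"
    proof (intro AE_I2 impI)
      fix t :: real assume "t \<in> {0<..}"
      then have t: "t > 0" by simp
      have "norm (exp (\<i> * (of_real t * w) * of_real y) * \<rho> (of_real t * w) * damping \<sigma> \<alpha> \<mu> (of_real t * w)) \<le> ?g t"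
        using bound_oscillation[OF sector_scale[OF w(1), of t]] t
        by (simp add: norm_mult powr_mult power_mult_distrib algebra_simps)
      then show "norm (exp (\<i> * (of_real t * w) * of_real y) * \<rho> (of_real t * w) * damping \<sigma> \<alpha> \<mu> (of_real t * w)) \<le> norm (?g t)"
        by simp
    qed
  qed
qed

lemma oscillation_rotation:
  "(LINT v:{0<..}|lborel. exp (\<i> * of_real v * of_real y) * \<rho> (of_real v) * damping \<sigma> \<alpha> \<mu> (of_real v))
   = sector_ray * (LINT t:{0<..}|lborel. exp (\<i> * (of_real t * sector_ray) * of_real y) *
        \<rho> (of_real t * sector_ray) * damping \<sigma> \<alpha> \<mu> (of_real t * sector_ray))"
proof -
  let ?f = "\<lambda>z. exp (\<i> * z * of_real y) * \<rho> z * damping \<sigma> \<alpha> \<mu> z"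
  \<comment> \<open>The closing segment is vertical: Re z = R and 0 <= Im z <= R/2. Hence R <= |z|
    <= 2 R, and the Gaussian bound beats the powers and the length of the segment.\<close>
  let ?b = "\<lambda>R. K * ((2 * R) powr a + (2 * R) powr b) * exp (- (\<sigma>^2 * R^2 / 4))"
  have "1 * (LINT t:{0<..}|lborel. ?f (of_real t * 1)) = sector_ray * (LINT t:{0<..}|lborel. ?f (of_real t * sector_ray))"
  proof (rule ray_rotation[where C=sector and b="?b"])
    show "set_integrable lborel {0<..} (\<lambda>t. ?f (of_real t * 1))"
      by (rule integrable_oscillation_ray) (auto simp: sector_def)
    show "set_integrable lborel {0<..} (\<lambda>t. ?f (of_real t * sector_ray))"
      by (rule integrable_oscillation_ray) (auto simp: sector_def complex_eq_iff)
    show "?f field_differentiable at z" if "z \<in> sector" "z \<noteq> 0" for z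
      using that by (intro derivative_intros field_differentiable_mult diff damping_differentiable)
         (auto intro!: field_differentiable_compose[of _ _ exp, unfolded o_def] derivative_intros field_differentiable_within_exp)
    show "norm (?f z) \<le> ?b R"
      if R: "R > 0" and z: "z \<in> closed_segment (of_real R * 1) (of_real R * sector_ray)" for R z
    proof -
      have "of_real R * 1 \<in> sector" "of_real R * sector_ray \<in> sector"
        using R sector_scale[OF sector_ray_in_sector, of R] of_real_in_sector[of R] by simp_all
      then have zs: "z \<in> sector"
        using z closed_segment_subset[OF _ _ convex_sector] by blast
      obtain u where u: "0 \<le> u" "u \<le> 1" "z = (1 - u) *\<^sub>R (of_real R * 1) + u *\<^sub>R (of_real R * sector_ray)"
        using z by (auto simp: in_segment)
      have "Re z = R" "Im z = u * R / 2" unfolding u(3) by (simp_all add: algebra_simps)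
      moreover have "u * R / 2 \<le> R" "0 \<le> u * R / 2" using u R mult_right_mono[of u 1 R] by auto
      ultimately have "\<bar>Re z\<bar> = R" "\<bar>Im z\<bar> \<le> R" using R by (simp_all only: abs_of_nonneg less_imp_le)
      then have n: "R \<le> norm z" "norm z \<le> 2 * R"
        using abs_Re_le_cmod[of z] cmod_le[of z] by linarith+
      have "norm (?f z) \<le> K * (norm z powr a + norm z powr b) * exp (- (\<sigma>^2 * (norm z)^2 / 4))"
        by (rule bound_oscillation[OF zs])
      also have "\<dots> \<le> ?b R"
        using n R ab
        by (intro mult_mono mult_left_mono add_mono powr_mono2)
           (auto intro!: mult_left_mono power_mono mult_nonneg_nonneg add_nonneg_nonneg)
      finally show ?thesis .
    qed
    show "((\<lambda>R. R * ?b R) \<longlongrightarrow> 0) at_top"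
      using par(1) by real_asymp
    show "convex sector" by (rule convex_sector)
    show "0 \<in> sector" "1 \<in> sector" by (simp_all add: sector_def)
    show "sector_ray \<in> sector" by (rule sector_ray_in_sector)
    show "continuous_on sector ?f" by (rule continuous_oscillation)
    show "of_real t * z \<in> sector" if "z \<in> sector" "t \<ge> 0" for z t
      using that by (rule sector_scale)
  qed
  then show ?thesis by (simp only: mult_1 mult_1_right)
qed

text \<open>On the rotated ray the phase already decays like exp (-y t / 2), so the damping can be
  estimated by 1 and the bound does not depend on \<sigma> or \<mu>. The powers of 2 and the leading
  2 come from |\<open>sector_ray\<close>| <= 2.\<close>

lemma oscillation_bound:
  assumes "y > 0"
  shows "norm (LINT v:{0<..}|lborel. exp (\<i> * of_real v * of_real y) * \<rho> (of_real v) * damping \<sigma> \<alpha> \<mu> (of_real v))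
    \<le> 2 * (K * (2 powr a * (Gamma (a + 1) / (y / 2) powr (a + 1)) + 2 powr b * (Gamma (b + 1) / (y / 2) powr (b + 1))))"
proof -
  let ?f = "\<lambda>t. exp (\<i> * (of_real t * sector_ray) * of_real y) *
        \<rho> (of_real t * sector_ray) * damping \<sigma> \<alpha> \<mu> (of_real t * sector_ray)"
  let ?B = "K * (2 powr a * (Gamma (a + 1) / (y / 2) powr (a + 1)) + 2 powr b * (Gamma (b + 1) / (y / 2) powr (b + 1)))"
  let ?g = "\<lambda>t. K * (2 powr a * (t powr (a + 1 - 1) * exp (- (y / 2 * t))) + 2 powr b * (t powr (b + 1 - 1) * exp (- (y / 2 * t))))"
  have gi: "set_integrable lborel {0<..} ?g"
    using ab assms by (intro set_integrable_mult_right set_integral_add gamma_integral) auto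
  have le: "norm (?f t) \<le> ?g t" if "t \<in> {0<..}" for t
  proof -
    have t: "t > 0" using that by simp
    have "norm (?f t) \<le> exp (- (y / 2 * t)) * (K * (norm sector_ray powr a * t powr a + norm sector_ray powr b * t powr b)) * 1"
      unfolding norm_mult norm_phase_sector_ray using t par ab
      by (intro mult_mono bound_ray norm_damping_le_1 sector_scale sector_ray_in_sector) (auto intro!: mult_nonneg_nonneg)
    also have "\<dots> \<le> exp (- (y / 2 * t)) * (K * (2 powr a * t powr a + 2 powr b * t powr b)) * 1"
      using ab norm_sector_ray
      by (intro mult_right_mono mult_left_mono add_mono powr_mono2) auto
    also have "\<dots> = ?g t" by (simp add: algebra_simps)
    finally show ?thesis .
  qed
  have fi: "set_integrable lborel {0<..} ?f"
    by (rule integrable_oscillation_ray[OF sector_ray_in_sector]) (simp add: complex_eq_iff)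
  have "norm (LINT t:{0<..}|lborel. ?f t) \<le> (LINT t:{0<..}|lborel. ?g t)"
    by (rule order_trans[OF set_integral_norm_bound[OF fi] set_integral_mono[OF set_integrable_norm[OF fi] gi le]])
  also have "\<dots> = K * ((LINT t:{0<..}|lborel. 2 powr a * (t powr (a + 1 - 1) * exp (- (y / 2 * t))))
      + (LINT t:{0<..}|lborel. 2 powr b * (t powr (b + 1 - 1) * exp (- (y / 2 * t)))))"
    using ab assms
    by (subst set_integral_mult_right, subst set_integral_add(2))
       (rule set_integrable_mult_right gamma_integral(1) refl | simp only: | linarith)+
  also have "\<dots> = ?B"
    using ab assms gamma_integral(2)[of "a + 1" "y / 2"] gamma_integral(2)[of "b + 1" "y / 2"]
    by (simp only: set_integral_mult_right)
  finally have "norm (LINT t:{0<..}|lborel. ?f t) \<le> ?B" .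
  then have "norm sector_ray * norm (LINT t:{0<..}|lborel. ?f t) \<le> 2 * ?B"
    by (rule mult_mono[OF norm_sector_ray]) simp_all
  then show ?thesis
    by (simp only: oscillation_rotation norm_mult)
qed

end
end

section \<open>Oscillatory integrals\<close>

lemma abs_ln_le_powr:
  fixes x \<eta> :: real
  assumes "x > 0" "\<eta> > 0"
  shows "\<bar>ln x\<bar> \<le> (x powr - \<eta> + x powr \<eta>) / \<eta>"
proof (cases "x \<ge> 1")
  case True
  have "\<bar>ln x\<bar> \<le> x powr \<eta> / \<eta>" using ln_powr_bound[OF True assms(2)] True by simp
  also have "\<dots> \<le> (x powr - \<eta> + x powr \<eta>) / \<eta>" using assms by (intro divide_right_mono) auto
  finally show ?thesis .
next
  case False
  then have "1 \<le> 1 / x" using assms by simp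
  from ln_powr_bound[OF this assms(2)] have "\<bar>ln x\<bar> \<le> x powr - \<eta> / \<eta>"
    using assms False by (simp add: ln_div powr_divide powr_minus field_simps)
  also have "\<dots> \<le> (x powr - \<eta> + x powr \<eta>) / \<eta>" using assms by (intro divide_right_mono) auto
  finally show ?thesis .
qed

lemma powr_abs_ln_le:
  fixes x \<eta> \<alpha> :: real
  assumes "x > 0" "\<eta> > 0"
  shows "x powr \<alpha> * \<bar>ln x\<bar> \<le> 1 / \<eta> * (x powr (\<alpha> - \<eta>) + x powr (\<alpha> + \<eta>))"
proof -
  have "x powr \<alpha> * \<bar>ln x\<bar> \<le> x powr \<alpha> * ((x powr - \<eta> + x powr \<eta>) / \<eta>)"
    by (intro mult_left_mono abs_ln_le_powr assms) auto
  also have "\<dots> = 1 / \<eta> * (x powr (\<alpha> - \<eta>) + x powr (\<alpha> + \<eta>))"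
    using assms by (simp add: powr_add powr_diff powr_minus field_simps)
  finally show ?thesis .
qed

lemma sector_not_nonpos: "z \<in> sector \<Longrightarrow> z \<noteq> 0 \<Longrightarrow> z \<notin> \<real>\<^sub>\<le>\<^sub>0"
  using sector_nonzero[of z] by (auto simp: complex_nonpos_Reals_iff)

lemma sector_amplitude_powr:
  assumes "0 < \<alpha>"
  shows "sector_amplitude (\<lambda>z. z powr of_real \<alpha>) 1 \<alpha> \<alpha>"
proof
  show "continuous_on sector (\<lambda>z. z powr of_real \<alpha>)"
    using assms by (intro continuous_intros) (auto simp: sector_def)
  show "(\<lambda>z. z powr of_real \<alpha>) field_differentiable at z" if "z \<in> sector" "z \<noteq> 0" for z
    using has_field_derivative_powr[OF sector_not_nonpos[OF that]] by (auto simp: field_differentiable_def)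
qed (use assms in \<open>auto simp: norm_powr_real_powr'\<close>)

lemma sector_amplitude_powr_Ln:
  assumes "0 < \<eta>" "\<eta> < \<alpha>"
  shows "sector_amplitude (\<lambda>z. z powr of_real \<alpha> * Ln z) (1 / \<eta> + pi) (\<alpha> - \<eta>) (\<alpha> + \<eta>)"
proof
  let ?\<rho> = "\<lambda>z. z powr of_real \<alpha> * Ln z"
  show bound: "norm (?\<rho> z) \<le> (1 / \<eta> + pi) * (norm z powr (\<alpha> - \<eta>) + norm z powr (\<alpha> + \<eta>))" for z
  proof (cases "z = 0")
    case False
    have "norm (Ln z) \<le> \<bar>ln (norm z)\<bar> + pi"
      using cmod_le[of "Ln z"] False mpi_less_Im_Ln[OF False] Im_Ln_le_pi[OF False] by simp
    then have "norm (?\<rho> z) \<le> norm z powr \<alpha> * (\<bar>ln (norm z)\<bar> + pi)"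
      unfolding norm_mult by (intro mult_mono) (auto simp: norm_powr_real_powr')
    also have "\<dots> \<le> 1 / \<eta> * (norm z powr (\<alpha> - \<eta>) + norm z powr (\<alpha> + \<eta>)) + pi * (norm z powr \<alpha> * 1)"
      using powr_abs_ln_le[of "norm z" \<eta> \<alpha>] False assms by (simp add: algebra_simps)
    \<comment> \<open>The argument of z contributes at most pi to |Ln z|; this bounded term is
      absorbed into the two powers, one of which is at least 1.\<close>
    also have "\<dots> \<le> 1 / \<eta> * (norm z powr (\<alpha> - \<eta>) + norm z powr (\<alpha> + \<eta>)) + pi * (norm z powr \<alpha> * (norm z powr - \<eta> + norm z powr \<eta>))"
      using False by (intro add_left_mono mult_left_mono sector_sum_powr_pos) auto
    also have "\<dots> = (1 / \<eta> + pi) * (norm z powr (\<alpha> - \<eta>) + norm z powr (\<alpha> + \<eta>))"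
      using False assms by (simp add: powr_add powr_diff powr_minus field_simps)
    finally show ?thesis .
  qed simp
  show "?\<rho> field_differentiable at z" if "z \<in> sector" "z \<noteq> 0" for z
    using has_field_derivative_powr[OF sector_not_nonpos[OF that]] sector_not_nonpos[OF that]
    by (intro field_differentiable_mult) (auto simp: field_differentiable_def intro: has_field_derivative_Ln)
  then have nz: "continuous (at z within sector) ?\<rho>" if "z \<in> sector" "z \<noteq> 0" for z
    using that field_differentiable_imp_continuous_at continuous_at_imp_continuous_at_within by blast
  \<comment> \<open>At the origin \<open>powr\<close> has the default value 0, which agrees with the
    limit because \<eta> < \<alpha>.\<close>
  have "(?\<rho> \<longlongrightarrow> 0) (at 0 within sector)"
  proof (rule Lim_null_comparison)
    show "\<forall>\<^sub>F z in at 0 within sector. norm (?\<rho> z) \<le> (1 / \<eta> + pi) * (norm z powr (\<alpha> - \<eta>) + norm z powr (\<alpha> + \<eta>))"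
      by (rule always_eventually) (simp only: bound simp_thms)
    have "((\<lambda>z::complex. (1 / \<eta> + pi) * (norm z powr (\<alpha> - \<eta>) + norm z powr (\<alpha> + \<eta>))) \<longlongrightarrow>
        (1 / \<eta> + pi) * (0 powr (\<alpha> - \<eta>) + 0 powr (\<alpha> + \<eta>))) (at 0 within sector)"
      using assms by (intro tendsto_intros tendsto_powr2) (auto intro!: tendsto_eq_intros)
    then show "((\<lambda>z::complex. (1 / \<eta> + pi) * (norm z powr (\<alpha> - \<eta>) + norm z powr (\<alpha> + \<eta>))) \<longlongrightarrow> 0) (at 0 within sector)"
      by simp
  qed
  then have "continuous (at 0 within sector) ?\<rho>" by (simp add: continuous_within)
  with nz show "continuous_on sector ?\<rho>" by (metis continuous_on_eq_continuous_within)
qed (use assms in auto)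

text \<open>Half-line form of an inverse Fourier integral with even transform: for
  \<open>g = 1\<close> it is pi times a density, and the parameter derivatives of that density are
  of the same form with \<open>g\<close> a power, possibly times a logarithm.\<close>

definition osc_integral :: "(real \<Rightarrow> real) \<Rightarrow> real \<Rightarrow> real \<Rightarrow> real \<Rightarrow> real \<Rightarrow> real" where
  "osc_integral g \<sigma> \<alpha> \<mu> y =
     (LINT v:{0<..}|lborel. cos (v * y) * g v * exp (- (\<sigma>^2 * v^2 / 2) - \<mu> * v powr \<alpha>))"

lemma (in sector_amplitude) osc_integral_eq_Re:
  assumes "\<And>v. v > 0 \<Longrightarrow> \<rho> (of_real v) = of_real (g v)"
    and par: "\<sigma> > 0" "0 < \<alpha>" "\<alpha> < 2" "\<mu> \<ge> 0" "y \<ge> 0"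
  shows "osc_integral g \<sigma> \<alpha> \<mu> y =
    Re (LINT v:{0<..}|lborel. exp (\<i> * of_real v * of_real y) * \<rho> (of_real v) * damping \<sigma> \<alpha> \<mu> (of_real v))"
proof -
  let ?f = "\<lambda>v. exp (\<i> * of_real v * of_real y) * \<rho> (of_real v) * damping \<sigma> \<alpha> \<mu> (of_real v)"
  have eq: "indicator {0<..} v *\<^sub>R (cos (v * y) * g v * exp (- (\<sigma>^2 * v^2 / 2) - \<mu> * v powr \<alpha>))
      = Re (indicator {0<..} v *\<^sub>R ?f v)" for v
  proof (cases "v > 0")
    case True
    have d: "damping \<sigma> \<alpha> \<mu> (of_real v) = of_real (exp (- (\<sigma>^2 * v^2 / 2) - \<mu> * v powr \<alpha>))"
      using True by (simp add: damping_def powr_of_real exp_of_real[symmetric])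
    have "?f v = exp (\<i> * of_real v * of_real y) * of_real (g v * exp (- (\<sigma>^2 * v^2 / 2) - \<mu> * v powr \<alpha>))"
      unfolding d assms(1)[OF True] by simp
    moreover have "Re (exp (\<i> * of_real v * of_real y)) = cos (v * y)"
      by (simp add: Re_exp)
    ultimately have "Re (?f v) = cos (v * y) * (g v * exp (- (\<sigma>^2 * v^2 / 2) - \<mu> * v powr \<alpha>))"
      by (simp only: Re_complex_of_real Im_complex_of_real times_complex.sel mult_zero_right diff_0_right)
    then show ?thesis using True by (simp only: indicator_def) simp
  qed simp
  have "set_integrable lborel {0<..} ?f"
    using integrable_oscillation_ray[OF par, of 1] by (simp add: sector_def mult.assoc)
  then show ?thesis
    unfolding osc_integral_def set_lebesgue_integral_def set_integrable_def eq
    by (rule integral_Re)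
qed

lemma powr_of_real_times:
  fixes z s :: complex
  assumes "t > 0" "z \<noteq> 0"
  shows "(of_real t * z) powr s = of_real t powr s * z powr s"
proof -
  have "Ln (of_real t * z) = of_real (ln t) + Ln z"
    using Ln_times_of_real[of t z] assms by (simp add: Ln_of_real)
  then show ?thesis using assms by (simp add: powr_def Ln_of_real exp_add ring_distribs)
qed

text \<open>Without the Gaussian factor the closed first quadrant is available, because the phase
  decays for Im z > 0, and on the imaginary axis a Gamma integral appears. The starting ray is
  \<open>sector_ray\<close>, since absolute integrability fails on the real axis.\<close>

lemma undamped_oscillation_ray:
  assumes "y > 0" "\<alpha> > 0"
  shows "set_integrable lborel {0<..}
      (\<lambda>t. exp (\<i> * (of_real t * sector_ray) * of_real y) * (of_real t * sector_ray) powr of_real \<alpha>)"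
    and "sector_ray * (LINT t:{0<..}|lborel. exp (\<i> * (of_real t * sector_ray) * of_real y) *
      (of_real t * sector_ray) powr of_real \<alpha>) = \<i> * \<i> powr of_real \<alpha> * of_real (Gamma (1 + \<alpha>) / y powr (1 + \<alpha>))"
proof -
  let ?f = "\<lambda>z. exp (\<i> * z * of_real y) * z powr of_real \<alpha>"
  let ?C = "{z. Re z \<ge> 0} \<inter> {z. Im z \<ge> 0}"
  \<comment> \<open>On the closing segment Re z = R - u R and Im z = R/2 + u R/2 with u in [0,1], so
    Im z >= R/2 and |z| <= 2 R.\<close>
  let ?b = "\<lambda>R. exp (- (y / 2 * R)) * (2 * R) powr \<alpha>"
  have gi: "set_integrable lborel {0<..} (\<lambda>t. t powr \<alpha> * exp (- (l * t)))" if "l > 0" for l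
    using gamma_integral(1)[of "1 + \<alpha>" l] assms that by simp
  have cont: "continuous_on ?C ?f"
    using assms by (intro continuous_intros) auto
  show fi: "set_integrable lborel {0<..} (\<lambda>t. ?f (of_real t * sector_ray))"
  proof (rule set_integrable_bound)
    show "set_integrable lborel {0<..} (\<lambda>t. norm sector_ray powr \<alpha> * (t powr \<alpha> * exp (- (y / 2 * t))))"
      using gi[of "y / 2"] assms by (intro set_integrable_mult_right) auto
    show "set_borel_measurable lborel {0<..} (\<lambda>t. ?f (of_real t * sector_ray))"
      by (rule set_borel_measurable_ray[OF _ sector_ray_in_sector], rule continuous_on_subset[OF cont])
         (auto simp: sector_def)
    show "AE t in lborel. t \<in> {0<..} \<longrightarrow> norm (?f (of_real t * sector_ray))
        \<le> norm (norm sector_ray powr \<alpha> * (t powr \<alpha> * exp (- (y / 2 * t))))"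
      by (rule AE_I2) (simp add: norm_mult norm_phase_sector_ray norm_powr_real_powr' powr_mult mult_ac)
  qed
  have ray: "?f (of_real t * \<i>) = \<i> powr of_real \<alpha> * of_real (t powr \<alpha> * exp (- (y * t)))" if "t > 0" for t
  proof -
    have "exp (\<i> * (of_real t * \<i>) * of_real y) = of_real (exp (- (y * t)))"
      by (simp add: exp_of_real[symmetric] algebra_simps)
    then show ?thesis
      using that by (simp add: powr_of_real_times powr_of_real)
  qed
  have fi2: "set_integrable lborel {0<..} (\<lambda>t. ?f (of_real t * \<i>))"
  proof -
    have "set_integrable lborel {0<..} (\<lambda>t. \<i> powr of_real \<alpha> * complex_of_real (t powr \<alpha> * exp (- (y * t))))"
    proof (rule set_integrable_mult_right)
      have "complex_integrable lborel (\<lambda>t. complex_of_real (indicator {0<..} t *\<^sub>R (t powr \<alpha> * exp (- (y * t)))))"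
        using gi[OF assms(1)] by (simp only: complex_of_real_integrable_eq set_integrable_def)
      then show "set_integrable lborel {0<..} (\<lambda>t. complex_of_real (t powr \<alpha> * exp (- (y * t))))"
        by (simp only: set_integrable_def scaleR_conv_of_real of_real_mult) simp
    qed
    then show ?thesis
      by (subst set_integrable_cong[OF refl refl ray]) auto
  qed
  have "sector_ray * (LINT t:{0<..}|lborel. ?f (of_real t * sector_ray)) = \<i> * (LINT t:{0<..}|lborel. ?f (of_real t * \<i>))"
  proof (rule ray_rotation[where C="?C" and b="?b"])
    show "convex ?C" by (intro convex_Int convex_halfspace_Re_ge convex_halfspace_Im_ge)
    show "norm (?f z) \<le> ?b R"
      if R: "R > 0" and z: "z \<in> closed_segment (of_real R * sector_ray) (of_real R * \<i>)" for R z
    proof -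
      obtain u where u: "0 \<le> u" "u \<le> 1" "z = (1 - u) *\<^sub>R (of_real R * sector_ray) + u *\<^sub>R (of_real R * \<i>)"
        using z by (auto simp: in_segment)
      have e: "Re z = R - u * R" "Im z = R / 2 + u * R / 2" unfolding u(3) by (simp_all add: algebra_simps)
      have "0 \<le> u * R" "u * R \<le> R" using u R mult_right_mono[of u 1 R] by auto
      then have n: "Im z \<ge> R / 2" "norm z \<le> 2 * R"
        using e cmod_le[of z] by linarith+
      have "norm (?f z) = exp (- (y * Im z)) * norm z powr \<alpha>"
        by (simp add: norm_mult norm_powr_real_powr' mult.commute)
      also have "\<dots> \<le> ?b R"
        using n assms R by (intro mult_mono powr_mono2) auto
      finally show ?thesis .
    qed
    show "((\<lambda>R. R * ?b R) \<longlongrightarrow> 0) at_top" using assms by real_asymp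
    show "?f field_differentiable at z" if "z \<in> ?C" "z \<noteq> 0" for z
    proof -
      have "z \<notin> \<real>\<^sub>\<le>\<^sub>0" using that by (auto simp: complex_nonpos_Reals_iff complex_eq_iff)
      then show ?thesis unfolding field_differentiable_def
        by (intro exI) (rule derivative_eq_intros has_field_derivative_powr | assumption | rule refl | simp)+
    qed
  qed (use fi fi2 cont in auto)
  also have "(LINT t:{0<..}|lborel. ?f (of_real t * \<i>))
      = (LINT t:{0<..}|lborel. \<i> powr of_real \<alpha> * complex_of_real (t powr \<alpha> * exp (- (y * t))))"
    by (rule set_lebesgue_integral_cong) (auto simp: ray)
  also have "\<dots> = \<i> powr of_real \<alpha> * of_real (Gamma (1 + \<alpha>) / y powr (1 + \<alpha>))"
    using gamma_integral(2)[of "1 + \<alpha>" y] assms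
    by (simp only: set_integral_mult_right set_integral_complex_of_real) simp
  finally show "sector_ray * (LINT t:{0<..}|lborel. ?f (of_real t * sector_ray)) = \<i> * \<i> powr of_real \<alpha> * of_real (Gamma (1 + \<alpha>) / y powr (1 + \<alpha>))"
    by simp
qed

text \<open>On the rotated ray the damping is replaced by 1. The undamped integral gives the main
  term, whose sine is -Re (i * i^\<alpha>). The error comes from
  \<open>norm_damping_minus_1_le\<close>, where \<mu> <= 1 makes it uniform in \<mu>.\<close>

lemma osc_integral_powr_asymp:
  assumes "\<sigma> > 0" "0 < \<alpha>" "\<alpha> < 2"
  shows "\<exists>C\<ge>0. \<forall>\<mu>\<in>{0..1}. \<forall>y\<ge>1.
    \<bar>osc_integral (\<lambda>v. v powr \<alpha>) \<sigma> \<alpha> \<mu> y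
      + sin (pi * \<alpha> / 2) * Gamma (1 + \<alpha>) * y powr (- 1 - \<alpha>)\<bar> \<le> C * y powr (- 1 - 2 * \<alpha>)"
proof -
  \<comment> \<open>Gamma integrals of the two error terms at rate y/2, with
    |\<open>sector_ray\<close>| <= 2 used for each power of z and once more for the factor in front
    of the rotated integral.\<close>
  define C where "C = 2 * (2 powr \<alpha> * (\<sigma>^2 / 2 * 2 powr 2 * Gamma (3 + \<alpha>) * 2 powr (3 + \<alpha>)
     + 2 powr \<alpha> * Gamma (1 + 2 * \<alpha>) * 2 powr (1 + 2 * \<alpha>)))"
  have C0: "C \<ge> 0" unfolding C_def using assms
    by (intro mult_nonneg_nonneg add_nonneg_nonneg) (auto intro!: Gamma_real_nonneg)
  show ?thesis
  proof (intro exI[of _ C] conjI C0 ballI allI impI)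
    fix \<mu> y :: real assume mu: "\<mu> \<in> {0..1}" and y: "1 \<le> y"
    interpret sector_amplitude "\<lambda>z. z powr of_real \<alpha>" 1 \<alpha> \<alpha>
      by (rule sector_amplitude_powr[OF assms(2)])
    have par: "\<sigma> > 0" "0 < \<alpha>" "\<alpha> < 2" "\<mu> \<ge> 0" "y \<ge> 0" using assms mu y by auto
    let ?u = "\<lambda>t. exp (\<i> * (of_real t * sector_ray) * of_real y) * (of_real t * sector_ray) powr of_real \<alpha>"
    let ?f = "\<lambda>t. ?u t * damping \<sigma> \<alpha> \<mu> (of_real t * sector_ray)"
    let ?e = "\<lambda>t. exp (- (y / 2 * t))"
    let ?g = "\<lambda>t. 2 powr \<alpha> * (\<sigma>^2 / 2 * 2 powr 2 * (t powr (3 + \<alpha> - 1) * ?e t)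
        + 2 powr \<alpha> * (t powr (1 + 2 * \<alpha> - 1) * ?e t))"
    have fi: "set_integrable lborel {0<..} ?f"
      by (rule integrable_oscillation_ray[OF par sector_ray_in_sector]) (simp add: complex_eq_iff)
    have ui: "set_integrable lborel {0<..} ?u"
      using assms y by (intro undamped_oscillation_ray(1)) auto
    have di: "set_integrable lborel {0<..} (\<lambda>t. ?f t - ?u t)"
      by (rule set_integral_diff(1)[OF fi ui])
    have ei: "set_integrable lborel {0<..} (\<lambda>t. t powr (b - 1) * ?e t)" if "b > 0" for b
      using that y by (intro gamma_integral(1)) auto
    have gi1: "set_integrable lborel {0<..} (\<lambda>t. \<sigma>^2 / 2 * 2 powr 2 * (t powr (3 + \<alpha> - 1) * ?e t))"
      by (rule set_integrable_mult_right, rule ei) (use assms in simp)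
    have gi2: "set_integrable lborel {0<..} (\<lambda>t. 2 powr \<alpha> * (t powr (1 + 2 * \<alpha> - 1) * ?e t))"
      by (rule set_integrable_mult_right, rule ei) (use assms in simp)
    have gi: "set_integrable lborel {0<..} ?g"
      by (rule set_integrable_mult_right, rule set_integral_add(1)[OF gi1 gi2])
    have le: "norm (?f t - ?u t) \<le> ?g t" if "t \<in> {0<..}" for t
    proof -
      have t: "t > 0" using that by simp
      let ?z = "of_real t * sector_ray"
      have zs: "?z \<in> sector" using t by (intro sector_scale sector_ray_in_sector) auto
      have nz: "norm ?z \<le> 2 * t" using t norm_sector_ray by (simp add: norm_mult mult.commute)
      have "norm (damping \<sigma> \<alpha> \<mu> ?z - 1) \<le> \<sigma>^2 / 2 * norm ?z powr 2 + \<mu> * norm ?z powr \<alpha>"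
        by (rule norm_damping_minus_1_le[OF zs par(2-4)])
      also have "\<dots> \<le> \<sigma>^2 / 2 * (2 * t) powr 2 + 1 * (2 * t) powr \<alpha>"
        using mu nz assms by (intro add_mono mult_mono powr_mono2) auto
      finally have d: "norm (damping \<sigma> \<alpha> \<mu> ?z - 1) \<le> \<sigma>^2 / 2 * (2 * t) powr 2 + (2 * t) powr \<alpha>" by simp
      have "norm (?u t) = ?e t * norm ?z powr \<alpha>"
        by (simp only: norm_mult norm_phase_sector_ray) (simp add: norm_powr_real_powr' norm_mult)
      also have "\<dots> \<le> ?e t * (2 * t) powr \<alpha>"
        using nz assms by (intro mult_left_mono powr_mono2) auto
      finally have u: "norm (?u t) \<le> ?e t * (2 * t) powr \<alpha>" .
      have "norm (?f t - ?u t) = norm (?u t) * norm (damping \<sigma> \<alpha> \<mu> ?z - 1)"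
        by (simp only: norm_mult[symmetric] right_diff_distrib mult_1_right)
      also have "\<dots> \<le> (?e t * (2 * t) powr \<alpha>) * (\<sigma>^2 / 2 * (2 * t) powr 2 + (2 * t) powr \<alpha>)"
        by (intro mult_mono u d) auto
      also have "\<dots> = ?g t"
      proof -
        have "t powr (3 + \<alpha> - 1) = t powr \<alpha> * t powr 2" "t powr (1 + 2 * \<alpha> - 1) = t powr \<alpha> * t powr \<alpha>"
          using t by (simp_all add: powr_add[symmetric] add.commute del: powr_numeral)
        moreover have "(2 * t) powr \<alpha> = 2 powr \<alpha> * t powr \<alpha>" "(2 * t) powr 2 = 2 powr 2 * t powr 2"
          using t by (simp_all only: powr_mult)
        ultimately show ?thesis by (simp only: ring_distribs mult_ac)
      qed
      finally show ?thesis .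
    qed
    have "norm ((LINT t:{0<..}|lborel. ?f t) - (LINT t:{0<..}|lborel. ?u t)) = norm (LINT t:{0<..}|lborel. ?f t - ?u t)"
      by (simp only: set_integral_diff(2)[OF fi ui])
    also have "\<dots> \<le> (LINT t:{0<..}|lborel. ?g t)"
      by (rule order_trans[OF set_integral_norm_bound[OF di] set_integral_mono[OF set_integrable_norm[OF di] gi le]])
    also have "\<dots> = 2 powr \<alpha> * (\<sigma>^2 / 2 * 2 powr 2 * (Gamma (3 + \<alpha>) / (y / 2) powr (3 + \<alpha>))
        + 2 powr \<alpha> * (Gamma (1 + 2 * \<alpha>) / (y / 2) powr (1 + 2 * \<alpha>)))"
      using assms y gamma_integral(2)[of "3 + \<alpha>" "y / 2"] gamma_integral(2)[of "1 + 2 * \<alpha>" "y / 2"]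
      by (simp only: set_integral_mult_right set_integral_add(2)[OF gi1 gi2])
    also have "\<dots> = 2 powr \<alpha> * (\<sigma>^2 / 2 * 2 powr 2 * Gamma (3 + \<alpha>) * 2 powr (3 + \<alpha>) * y powr (- 3 - \<alpha>)
        + 2 powr \<alpha> * Gamma (1 + 2 * \<alpha>) * 2 powr (1 + 2 * \<alpha>) * y powr (- 1 - 2 * \<alpha>))"
    proof -
      have e: "G / (y / 2) powr k = G * 2 powr k * y powr (- k)" for G k
        using y by (simp add: powr_divide powr_minus field_simps)
      have "- (3 + \<alpha>) = - 3 - \<alpha>" "- (1 + 2 * \<alpha>) = - 1 - 2 * \<alpha>" by simp_all
      then show ?thesis unfolding e by (simp only: mult_ac)
    qed
    \<comment> \<open>Here y >= 1 and \<alpha> < 2 give y^(-3-\<alpha>) <= y^(-1-2\<alpha>).\<close>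
    also have "\<dots> \<le> 2 powr \<alpha> * (\<sigma>^2 / 2 * 2 powr 2 * Gamma (3 + \<alpha>) * 2 powr (3 + \<alpha>) * y powr (- 1 - 2 * \<alpha>)
        + 2 powr \<alpha> * Gamma (1 + 2 * \<alpha>) * 2 powr (1 + 2 * \<alpha>) * y powr (- 1 - 2 * \<alpha>))"
      using y assms
      by (intro mult_left_mono add_mono powr_mono mult_nonneg_nonneg order_refl) (auto intro!: Gamma_real_nonneg)
    also have "2 * \<dots> = C * y powr (- 1 - 2 * \<alpha>)" unfolding C_def by (simp only: ring_distribs mult_ac)
    finally have diff: "2 * norm ((LINT t:{0<..}|lborel. ?f t) - (LINT t:{0<..}|lborel. ?u t)) \<le> C * y powr (- 1 - 2 * \<alpha>)"
      by simp
    have "osc_integral (\<lambda>v. v powr \<alpha>) \<sigma> \<alpha> \<mu> y = Re (sector_ray * (LINT t:{0<..}|lborel. ?f t))"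
      by (subst osc_integral_eq_Re[OF _ par]) (simp_all only: oscillation_rotation[OF par] powr_of_real less_imp_le)
    moreover have "Re (sector_ray * (LINT t:{0<..}|lborel. ?u t)) = - (sin (pi * \<alpha> / 2) * Gamma (1 + \<alpha>) * y powr (- 1 - \<alpha>))"
    proof -
      have "\<i> * \<i> powr of_real \<alpha> = \<i> * exp (\<i> * of_real (pi * \<alpha> / 2))"
        by (simp add: powr_def mult_ac)
      then have "Re (\<i> * \<i> powr of_real \<alpha>) = - sin (pi * \<alpha> / 2)"
        by (simp add: Im_exp)
      moreover have "Gamma (1 + \<alpha>) / y powr (1 + \<alpha>) = Gamma (1 + \<alpha>) * y powr (- 1 - \<alpha>)"
        using y powr_minus_divide[of y "1 + \<alpha>"] by simp
      ultimately show ?thesis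
        using undamped_oscillation_ray(2)[of y \<alpha>] y assms
        by (simp only: times_complex.sel Re_complex_of_real Im_complex_of_real mult_zero_right diff_0_right)
    qed
    ultimately have "\<bar>osc_integral (\<lambda>v. v powr \<alpha>) \<sigma> \<alpha> \<mu> y
        + sin (pi * \<alpha> / 2) * Gamma (1 + \<alpha>) * y powr (- 1 - \<alpha>)\<bar>
      = \<bar>Re (sector_ray * ((LINT t:{0<..}|lborel. ?f t) - (LINT t:{0<..}|lborel. ?u t)))\<bar>"
      by (simp only: right_diff_distrib minus_complex.sel diff_minus_eq_add)
    also have "\<dots> \<le> norm sector_ray * norm ((LINT t:{0<..}|lborel. ?f t) - (LINT t:{0<..}|lborel. ?u t))"
      unfolding norm_mult[symmetric] by (rule abs_Re_le_cmod)
    also have "\<dots> \<le> 2 * norm ((LINT t:{0<..}|lborel. ?f t) - (LINT t:{0<..}|lborel. ?u t))"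
      by (intro mult_right_mono norm_sector_ray) auto
    finally show "\<bar>osc_integral (\<lambda>v. v powr \<alpha>) \<sigma> \<alpha> \<mu> y
        + sin (pi * \<alpha> / 2) * Gamma (1 + \<alpha>) * y powr (- 1 - \<alpha>)\<bar> \<le> C * y powr (- 1 - 2 * \<alpha>)"
      using diff by linarith
  qed
qed

text \<open>This serves the logarithmic amplitude. Its contribution to the score of \<alpha> carries
  a factor 1/L, so a bound of almost the right order replaces an expansion. For y >= 1 the smaller
  exponent \<open>a\<close> governs.\<close>

lemma (in sector_amplitude) osc_integral_decay:
  assumes "\<And>v. v > 0 \<Longrightarrow> \<rho> (of_real v) = of_real (g v)"
    and par: "\<sigma> > 0" "0 < \<alpha>" "\<alpha> < 2" and "a \<le> b"
  shows "\<exists>C\<ge>0. \<forall>\<mu>\<ge>0. \<forall>y\<ge>1. \<bar>osc_integral g \<sigma> \<alpha> \<mu> y\<bar> \<le> C * y powr (- 1 - a)"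
proof -
  define c :: "real \<Rightarrow> real" where "c = (\<lambda>a. 2 powr a * (Gamma (a + 1) * 2 powr (a + 1)))"
  have c: "c a \<ge> 0" "c b \<ge> 0" unfolding c_def using ab by (auto intro!: mult_nonneg_nonneg Gamma_real_nonneg)
  show ?thesis
  proof (intro exI[of _ "2 * (K * (c a + c b))"] conjI allI impI)
    show "0 \<le> 2 * (K * (c a + c b))" using c ab by simp
    fix \<mu> y :: real assume "\<mu> \<ge> 0" "y \<ge> 1"
    then have y: "y > 0" "y \<ge> 0" by auto
    have e: "2 powr k * (Gamma (k + 1) / (y / 2) powr (k + 1)) = c k * y powr (- 1 - k)" for k
    proof -
      have "- 1 - k = - (k + 1)" by simp
      then show ?thesis unfolding c_def using y by (simp only: powr_divide powr_minus) (simp add: field_simps)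
    qed
    have "\<bar>osc_integral g \<sigma> \<alpha> \<mu> y\<bar> \<le> 2 * (K * (c a * y powr (- 1 - a) + c b * y powr (- 1 - b)))"
      using oscillation_bound[OF par \<open>\<mu> \<ge> 0\<close> y(2) y(1)] unfolding e
      by (subst osc_integral_eq_Re[OF assms(1) par \<open>\<mu> \<ge> 0\<close> y(2)])
         (assumption | rule order_trans[OF abs_Re_le_cmod])+
    also have "\<dots> \<le> 2 * (K * (c a * y powr (- 1 - a) + c b * y powr (- 1 - a)))"
      using c ab \<open>y \<ge> 1\<close> \<open>a \<le> b\<close> by (intro mult_left_mono add_left_mono powr_mono) auto
    finally show "\<bar>osc_integral g \<sigma> \<alpha> \<mu> y\<bar> \<le> 2 * (K * (c a + c b)) * y powr (- 1 - a)"
      by (simp only: ring_distribs mult_ac)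
  qed
qed

section \<open>The constant of the stable exponent\<close>

lemma integral_lborel_even:
  fixes f :: "real \<Rightarrow> real"
  assumes f: "set_integrable lborel {0<..} f" and even: "\<And>x. f (- x) = f x"
  shows "integrable lborel f" "(\<integral>x. f x \<partial>lborel) = 2 * (LINT x:{0<..}|lborel. f x)"
proof -
  let ?h = "\<lambda>x. indicator {0<..} x *\<^sub>R f x"
  have h: "has_bochner_integral lborel ?h (LINT x:{0<..}|lborel. f x)"
    using f unfolding set_integrable_def set_lebesgue_integral_def by (rule has_bochner_integral_integrable)
  then have "has_bochner_integral lborel (\<lambda>x. ?h (0 + (-1) * x)) ((LINT x:{0<..}|lborel. f x) /\<^sub>R \<bar>-1\<bar>)"
    by (subst (asm) lborel_has_bochner_integral_real_affine_iff[of "-1" _ _ 0]) auto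
  from has_bochner_integral_add[OF h this]
  have s: "has_bochner_integral lborel (\<lambda>x. ?h x + ?h (- x)) (2 * (LINT x:{0<..}|lborel. f x))"
    by simp
  \<comment> \<open>The two open half lines miss the origin; a null term restores the value of
    \<open>f\<close> there.\<close>
  have z: "has_bochner_integral lborel (\<lambda>x. indicator {0::real} x *\<^sub>R f 0) 0"
    using has_bochner_integral_scaleR_left[OF has_bochner_integral_real_indicator[of "{0::real}" lborel], of "f 0"] by simp
  have eq: "?h x + ?h (- x) + indicator {0} x *\<^sub>R f 0 = f x" for x
    using even[of x] by (auto simp: indicator_def)
  from has_bochner_integral_add[OF s z]
  have "has_bochner_integral lborel f (2 * (LINT x:{0<..}|lborel. f x))"
    unfolding eq by simp
  then show "integrable lborel f" "(\<integral>x. f x \<partial>lborel) = 2 * (LINT x:{0<..}|lborel. f x)"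
    by (auto simp: has_bochner_integral_iff)
qed

lemma nn_gamma_halfline:
  fixes b l :: real
  assumes "b > 0" "l > 0"
  shows "(\<integral>\<^sup>+t. ennreal (indicator {0<..} t * (t powr (b - 1) * exp (- (l * t)))) \<partial>lborel) = ennreal (Gamma b / l powr b)"
  using gamma_integral[OF assms]
  unfolding set_integrable_def set_lebesgue_integral_def
  by (subst nn_integral_eq_integral) auto

lemma nn_halfline_open_closed:
  "(\<integral>\<^sup>+t. f t * indicator {0..} t \<partial>lborel) = (\<integral>\<^sup>+t. f t * indicator {0<..} (t::real) \<partial>lborel)"
  by (rule nn_integral_cong_AE) (use AE_lborel_singleton[of "0::real"] in \<open>eventually_elim, auto simp: indicator_def\<close>)

lemma nn_laplace_one_minus_cos:
  fixes t :: real
  assumes "t > 0"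
  shows "(\<integral>\<^sup>+z. ennreal (indicator {0<..} z * ((1 - cos z) * exp (- (z * t)))) \<partial>lborel) = ennreal (1 / (t * (1 + t^2)))"
proof -
  \<comment> \<open>Antiderivative of (1 - cos z) exp (-z t), the cosine part found by integrating
    by parts twice. It vanishes at infinity, so only its value at 0 counts.\<close>
  let ?F = "\<lambda>z. - exp (- (z * t)) / t - exp (- (z * t)) * (sin z - t * cos z) / (1 + t^2)"
  have p: "1 + t^2 > 0" by (smt (verit) zero_le_power2)
  have "(\<integral>\<^sup>+z. ennreal ((1 - cos z) * exp (- (z * t))) * indicator {0..} z \<partial>lborel) = ennreal (0 - ?F 0)"
  proof (rule nn_integral_FTC_atLeast)
    show "DERIV ?F z :> (1 - cos z) * exp (- (z * t))" for z
      using assms p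
      by (auto intro!: derivative_eq_intros simp: divide_simps) (simp add: algebra_simps power2_eq_square)
    have 1: "((\<lambda>z. exp (- (z * t))) \<longlongrightarrow> 0) at_top" using assms by real_asymp
    have 2: "((\<lambda>z. exp (- (z * t)) * (sin z - t * cos z)) \<longlongrightarrow> 0) at_top"
    proof (rule Lim_null_comparison[where g="\<lambda>z. exp (- (z * t)) * (1 + t)"])
      show "\<forall>\<^sub>F z in at_top. norm (exp (- (z * t)) * (sin z - t * cos z)) \<le> exp (- (z * t)) * (1 + t)"
      proof (rule always_eventually, rule allI)
        fix z :: real
        have "\<bar>sin z - t * cos z\<bar> \<le> \<bar>sin z\<bar> + t * \<bar>cos z\<bar>"
          using abs_triangle_ineq4[of "sin z" "t * cos z"] assms by (simp add: abs_mult)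
        also have "\<dots> \<le> 1 + t * 1" using assms by (intro add_mono mult_left_mono) auto
        finally show "norm (exp (- (z * t)) * (sin z - t * cos z)) \<le> exp (- (z * t)) * (1 + t)"
          by (simp add: abs_mult)
      qed
      show "((\<lambda>z. exp (- (z * t)) * (1 + t)) \<longlongrightarrow> 0) at_top" using tendsto_mult_left_zero[OF 1] by simp
    qed
    show "(?F \<longlongrightarrow> 0) at_top"
      using tendsto_diff[OF tendsto_divide_zero[OF tendsto_minus[OF 1, simplified]] tendsto_divide_zero[OF 2], of t "1 + t^2"] by simp
  qed auto
  also have "0 - ?F 0 = 1 / (t * (1 + t^2))"
    using assms p by (simp add: field_simps power2_eq_square)
  finally show ?thesis
    unfolding nn_halfline_open_closed by (simp add: mult.commute ennreal_mult'' ennreal_indicator[symmetric] del: ennreal_indicator)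
qed

text \<open>Substitution u = t^2 in \<open>gamma_integral\<close>; the Jacobian 2 t turns u^(b-1)
  into 2 t^(2b-1).\<close>

lemma gamma_halfline_square:
  fixes b l :: real
  assumes "b > 0" "l > 0"
  shows "has_bochner_integral lborel (\<lambda>t. indicator {0<..} t * (t powr (2 * b - 1) * exp (- (l * t^2)))) (Gamma b / (2 * l powr b))"
proof -
  let ?f = "\<lambda>u. 1 / 2 * (u powr (b - 1) * exp (- (l * u)))"
  have si: "set_integrable lborel {0<..} ?f"
    using gamma_integral(1)[OF assms] by (rule set_integrable_mult_right)
  have ai: "?f absolutely_integrable_on {0<..}"
    using si unfolding set_integrable_def by (simp add: integrable_completion)
  moreover have "integral {0<..} ?f = Gamma b / (2 * l powr b)"
    using set_borel_integral_eq_integral(2)[OF si] gamma_integral(2)[OF assms]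
    by (simp only: set_integral_mult_right)
  moreover have im: "(\<lambda>t. t^2) ` {0<..} = {0::real<..}"
  proof safe
    fix x :: real assume "x > 0"
    then show "x \<in> (\<lambda>t. t^2) ` {0<..}" by (intro image_eqI[of _ _ "sqrt x"]) auto
  qed auto
  moreover have "(\<lambda>x. \<bar>2 * x\<bar> * ?f (x^2)) absolutely_integrable_on {0<..} \<and>
      integral {0<..} (\<lambda>x. \<bar>2 * x\<bar> * ?f (x^2)) = Gamma b / (2 * l powr b)
     \<longleftrightarrow> ?f absolutely_integrable_on (\<lambda>t. t^2) ` {0<..} \<and> integral ((\<lambda>t. t^2) ` {0<..}) ?f = Gamma b / (2 * l powr b)"
  proof (rule has_absolute_integral_change_of_variables_1')
    show "((\<lambda>t. t^2) has_field_derivative 2 * x) (at x within {0<..})" for x :: real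
      by (auto intro!: derivative_eq_intros)
    show "inj_on (\<lambda>t. t^2) {0::real<..}" by (auto intro!: inj_onI simp: power2_eq_iff)
  qed auto
  ultimately have "(\<lambda>x. \<bar>2 * x\<bar> * ?f (x^2)) absolutely_integrable_on {0<..}"
    and I: "integral {0<..} (\<lambda>x. \<bar>2 * x\<bar> * ?f (x^2)) = Gamma b / (2 * l powr b)" by auto
  then have si2: "set_integrable lborel {0<..} (\<lambda>x. \<bar>2 * x\<bar> * ?f (x^2))"
    unfolding set_integrable_def by (subst (asm) integrable_completion) auto
  have si2I: "(LINT x:{0<..}|lborel. \<bar>2 * x\<bar> * ?f (x^2)) = Gamma b / (2 * l powr b)"
    using set_borel_integral_eq_integral(2)[OF si2] I by (rule trans)
  have eq: "indicator {0<..} x *\<^sub>R (\<bar>2 * x\<bar> * ?f (x^2)) = indicator {0<..} x * (x powr (2 * b - 1) * exp (- (l * x^2)))" for x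
  proof (cases "x > 0")
    case True
    have "(x^2) powr (b - 1) = x powr (2 * b - 2)"
    proof -
      have "(x^2) powr (b - 1) = (x powr 2) powr (b - 1)" using True by simp
      also have "\<dots> = x powr (2 * (b - 1))" by (rule powr_powr)
      finally show ?thesis by (simp add: algebra_simps)
    qed
    moreover have "x * x powr (2 * b - 2) = x powr (2 * b - 1)"
      using True by (simp add: powr_mult_base)
    ultimately show ?thesis using True by (simp add: mult.assoc[symmetric])
  qed simp
  show ?thesis
    using si2 si2I unfolding set_integrable_def set_lebesgue_integral_def eq
    by (simp only: has_bochner_integral_iff)
qed

lemma Gamma_reflection_half:
  fixes \<alpha> :: real
  shows "Gamma (\<alpha> / 2) * Gamma (1 - \<alpha> / 2) = pi / sin (pi * \<alpha> / 2)"
proof -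
  have "complex_of_real (Gamma (\<alpha> / 2) * Gamma (1 - \<alpha> / 2)) = of_real (pi / sin (pi * \<alpha> / 2))"
    using Gamma_reflection_complex[of "of_real (\<alpha> / 2)"]
    by (simp add: Gamma_complex_of_real[symmetric] sin_of_real[symmetric] mult_ac)
  then show ?thesis by (simp only: of_real_eq_iff)
qed

text \<open>Write 1/(1+t^2) as the integral of exp (-(1+t^2) v) over v > 0 and exchange by Tonelli.
  The inner integral gives Gamma (\<alpha>/2), the outer one Gamma (1-\<alpha>/2), and the
  reflection formula combines them.\<close>

lemma nn_powr_over_one_plus_square:
  fixes \<alpha> :: real
  assumes "0 < \<alpha>" "\<alpha> < 2"
  shows "(\<integral>\<^sup>+t. ennreal (indicator {0<..} t * (t powr (\<alpha> - 1) / (1 + t^2))) \<partial>lborel) = ennreal (pi / (2 * sin (pi * \<alpha> / 2)))"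
proof -
  have p: "1 + t^2 > 0" for t :: real by (simp add: add_pos_nonneg)
  let ?h = "\<lambda>t v. indicator {0<..} t * indicator {0<..} v * (t powr (\<alpha> - 1) * exp (- ((1 + t^2) * v))) :: real"
  have inner1: "(\<integral>\<^sup>+v. ennreal (?h t v) \<partial>lborel) = ennreal (indicator {0<..} t * (t powr (\<alpha> - 1) / (1 + t^2)))" for t
  proof -
    have "(\<integral>\<^sup>+v. ennreal (?h t v) \<partial>lborel) = (\<integral>\<^sup>+v. ennreal (indicator {0<..} t * t powr (\<alpha> - 1)) *
        ennreal (indicator {0<..} v * (v powr (1 - 1) * exp (- ((1 + t^2) * v)))) \<partial>lborel)"
      by (intro nn_integral_cong) (auto simp: indicator_def ennreal_mult[symmetric])
    also have "\<dots> = ennreal (indicator {0<..} t * t powr (\<alpha> - 1)) * ennreal (Gamma 1 / (1 + t^2) powr 1)"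
      by (subst nn_integral_cmult, measurable, subst nn_gamma_halfline) (use p in auto)
    also have "\<dots> = ennreal (indicator {0<..} t * (t powr (\<alpha> - 1) / (1 + t^2)))"
      using p[of t] by (subst ennreal_mult[symmetric]) auto
    finally show ?thesis .
  qed
  have inner2: "(\<integral>\<^sup>+t. ennreal (?h t v) \<partial>lborel)
      = ennreal (Gamma (\<alpha> / 2) / 2) * ennreal (indicator {0<..} v * (v powr ((1 - \<alpha> / 2) - 1) * exp (- (1 * v))))" for v
  proof (cases "v > 0")
    case True
    have "(\<integral>\<^sup>+t. ennreal (?h t v) \<partial>lborel) = (\<integral>\<^sup>+t. ennreal (exp (- v)) *
        ennreal (indicator {0<..} t * (t powr (2 * (\<alpha> / 2) - 1) * exp (- (v * t^2)))) \<partial>lborel)"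
      using True by (intro nn_integral_cong) (auto simp: indicator_def ennreal_mult[symmetric] exp_add[symmetric] algebra_simps)
    also have "\<dots> = ennreal (exp (- v)) * ennreal (Gamma (\<alpha> / 2) / (2 * v powr (\<alpha> / 2)))"
      using gamma_halfline_square[of "\<alpha> / 2" v] assms True
      by (subst nn_integral_cmult, measurable, subst nn_integral_eq_integral) (auto simp: has_bochner_integral_iff)
    also have "\<dots> = ennreal (Gamma (\<alpha> / 2) / 2) * ennreal (indicator {0<..} v * (v powr ((1 - \<alpha> / 2) - 1) * exp (- (1 * v))))"
      using True assms by (simp add: ennreal_mult[symmetric] powr_minus field_simps Gamma_real_nonneg)
    finally show ?thesis .
  qed simp
  have "(\<integral>\<^sup>+t. ennreal (indicator {0<..} t * (t powr (\<alpha> - 1) / (1 + t^2))) \<partial>lborel)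
      = (\<integral>\<^sup>+t. \<integral>\<^sup>+v. ennreal (?h t v) \<partial>lborel \<partial>lborel)"
    by (simp only: inner1)
  also have "\<dots> = (\<integral>\<^sup>+v. \<integral>\<^sup>+t. ennreal (?h t v) \<partial>lborel \<partial>lborel)"
    by (rule lborel_pair.Fubini') (simp add: case_prod_unfold)
  also have "\<dots> = ennreal (Gamma (\<alpha> / 2) / 2) * ennreal (Gamma (1 - \<alpha> / 2) / 1 powr (1 - \<alpha> / 2))"
    unfolding inner2 using assms by (subst nn_integral_cmult, measurable, subst nn_gamma_halfline) auto
  also have "\<dots> = ennreal (Gamma (\<alpha> / 2) * Gamma (1 - \<alpha> / 2) / 2)"
    using assms by (simp add: ennreal_mult[symmetric] Gamma_real_nonneg)
  finally show ?thesis unfolding Gamma_reflection_half by (simp add: mult.commute)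
qed

text \<open>The integral of (1 - cos (u z)) \<alpha> |z|^(-1-\<alpha>) over the line is this
  constant times |u|^\<alpha>. The form with Gamma and sine is the one that cancels against the tail
  of the density.\<close>

definition stable_const :: "real \<Rightarrow> real" where
  "stable_const \<alpha> = \<alpha> * pi / (Gamma (1 + \<alpha>) * sin (pi * \<alpha> / 2))"

lemma stable_const_pos: "0 < \<alpha> \<Longrightarrow> \<alpha> < 2 \<Longrightarrow> 0 < stable_const \<alpha>"
  unfolding stable_const_def
  by (intro divide_pos_pos mult_pos_pos Gamma_real_pos sin_gt_zero) (auto simp: field_simps)

text \<open>Write Gamma (1+\<alpha>) z^(-1-\<alpha>) as the integral of t^\<alpha> exp (-z t) over t
  > 0. All integrands are nonnegative, so Tonelli exchanges freely and leaves the Laplace transform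
  of 1 - cos, then \<open>nn_powr_over_one_plus_square\<close>.\<close>

lemma levy_exponent_halfline:
  fixes \<alpha> :: real
  assumes "0 < \<alpha>" "\<alpha> < 2"
  shows "has_bochner_integral lborel (\<lambda>z. indicator {0<..} z *\<^sub>R ((1 - cos z) * z powr (- 1 - \<alpha>)))
           (stable_const \<alpha> / (2 * \<alpha>))"
proof (rule has_bochner_integral_nn_integral)
  let ?h = "\<lambda>z t. indicator {0<..} z * indicator {0<..} t * ((1 - cos z) * (t powr \<alpha> * exp (- (z * t)))) :: real"
  have G: "Gamma (1 + \<alpha>) > 0" using assms by (intro Gamma_real_pos) auto
  have inner1: "(\<integral>\<^sup>+t. ennreal (?h z t) \<partial>lborel)
      = ennreal (Gamma (1 + \<alpha>)) * ennreal (indicator {0<..} z *\<^sub>R ((1 - cos z) * z powr (- 1 - \<alpha>)))" for z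
  proof (cases "z > 0")
    case True
    have "(\<integral>\<^sup>+t. ennreal (?h z t) \<partial>lborel) = (\<integral>\<^sup>+t. ennreal (1 - cos z) *
        ennreal (indicator {0<..} t * (t powr ((1 + \<alpha>) - 1) * exp (- (z * t)))) \<partial>lborel)"
      using True by (intro nn_integral_cong) (auto simp: indicator_def ennreal_mult[symmetric])
    also have "\<dots> = ennreal (1 - cos z) * ennreal (Gamma (1 + \<alpha>) / z powr (1 + \<alpha>))"
      using True assms by (subst nn_integral_cmult, measurable, subst nn_gamma_halfline) auto
    also have "\<dots> = ennreal (Gamma (1 + \<alpha>)) * ennreal ((1 - cos z) * z powr (- 1 - \<alpha>))"
      using G True powr_minus_divide[of z "1 + \<alpha>"] by (simp add: ennreal_mult[symmetric] mult_ac)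
    finally show ?thesis using True by simp
  qed simp
  have inner2: "(\<integral>\<^sup>+z. ennreal (?h z t) \<partial>lborel) = ennreal (indicator {0<..} t * (t powr (\<alpha> - 1) / (1 + t^2)))" for t
  proof (cases "t > 0")
    case True
    have "(\<integral>\<^sup>+z. ennreal (?h z t) \<partial>lborel) = (\<integral>\<^sup>+z. ennreal (t powr \<alpha>) *
        ennreal (indicator {0<..} z * ((1 - cos z) * exp (- (z * t)))) \<partial>lborel)"
      using True by (intro nn_integral_cong) (auto simp: indicator_def ennreal_mult[symmetric] mult_ac)
    also have "\<dots> = ennreal (t powr \<alpha>) * ennreal (1 / (t * (1 + t^2)))"
      using True by (subst nn_integral_cmult, measurable, subst nn_laplace_one_minus_cos) auto
    also have "\<dots> = ennreal (t powr (\<alpha> - 1) / (1 + t^2))"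
      using True by (simp add: ennreal_mult[symmetric] powr_diff add_pos_nonneg)
    finally show ?thesis using True by simp
  qed simp
  have "ennreal (Gamma (1 + \<alpha>)) * (\<integral>\<^sup>+z. ennreal (indicator {0<..} z *\<^sub>R ((1 - cos z) * z powr (- 1 - \<alpha>))) \<partial>lborel)
      = (\<integral>\<^sup>+z. \<integral>\<^sup>+t. ennreal (?h z t) \<partial>lborel \<partial>lborel)"
    unfolding inner1 by (subst nn_integral_cmult) auto
  also have "\<dots> = (\<integral>\<^sup>+t. \<integral>\<^sup>+z. ennreal (?h z t) \<partial>lborel \<partial>lborel)"
    by (rule lborel_pair.Fubini') (simp add: case_prod_unfold)
  also have "\<dots> = ennreal (pi / (2 * sin (pi * \<alpha> / 2)))"
    unfolding inner2 by (rule nn_powr_over_one_plus_square[OF assms])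
  also have "pi / (2 * sin (pi * \<alpha> / 2)) = Gamma (1 + \<alpha>) * (stable_const \<alpha> / (2 * \<alpha>))"
    using less_imp_neq[OF G] assms by (simp add: stable_const_def)
  also have "ennreal \<dots> = ennreal (Gamma (1 + \<alpha>)) * ennreal (stable_const \<alpha> / (2 * \<alpha>))"
    using G assms stable_const_pos[OF assms] by (intro ennreal_mult) auto
  finally show "(\<integral>\<^sup>+z. ennreal (indicator {0<..} z *\<^sub>R ((1 - cos z) * z powr (- 1 - \<alpha>))) \<partial>lborel)
      = ennreal (stable_const \<alpha> / (2 * \<alpha>))"
    using G by (simp add: ennreal_mult_cancel_left)
  show "0 \<le> stable_const \<alpha> / (2 * \<alpha>)" using stable_const_pos[OF assms] assms by simp
qed auto

lemma levy_exponent: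
  fixes \<alpha> u r :: real
  assumes "0 < \<alpha>" "\<alpha> < 2"
  shows "(\<integral>z. (cos (u * z) - 1) * (r * \<alpha> * \<bar>z\<bar> powr (- 1 - \<alpha>)) \<partial>lborel) = - (r * stable_const \<alpha> * \<bar>u\<bar> powr \<alpha>)"
proof (cases "u = 0")
  case False
  let ?f = "\<lambda>z. (cos (u * z) - 1) * (r * \<alpha> * \<bar>z\<bar> powr (- 1 - \<alpha>))"
  let ?g = "\<lambda>z::real. (1 - cos z) * \<bar>z\<bar> powr (- 1 - \<alpha>)"
  have h: "has_bochner_integral lborel (\<lambda>z. indicator {0<..} z *\<^sub>R ?g z) (stable_const \<alpha> / (2 * \<alpha>))"
    using levy_exponent_halfline[OF assms]
    by (rule has_bochner_integral_cong[THEN iffD1, rotated -1]) (auto simp: indicator_def)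
  have g: "(\<integral>z. ?g z \<partial>lborel) = stable_const \<alpha> / \<alpha>"
    using integral_lborel_even(2)[of ?g] h assms
    by (simp add: set_integrable_def set_lebesgue_integral_def has_bochner_integral_iff)
  \<comment> \<open>Substituting z/u for z extracts |u|^\<alpha>: the power contributes
    |u|^(1+\<alpha>) and the Jacobian takes one factor |u| back.\<close>
  have "(\<integral>z. ?f z \<partial>lborel) = \<bar>1 / u\<bar> *\<^sub>R (\<integral>z. ?f (0 + 1 / u * z) \<partial>lborel)"
    using False by (intro lborel_integral_real_affine) auto
  also have "(\<lambda>z. ?f (0 + 1 / u * z)) = (\<lambda>z. - (r * \<alpha> * \<bar>u\<bar> powr (1 + \<alpha>)) * ?g z)"
  proof
    fix z :: real
    have "\<bar>1 / u * z\<bar> powr (- 1 - \<alpha>) = \<bar>u\<bar> powr (1 + \<alpha>) * \<bar>z\<bar> powr (- 1 - \<alpha>)"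
      using False powr_minus_divide[of "\<bar>u\<bar>" "1 + \<alpha>"] by (simp add: abs_mult powr_divide powr_diff powr_minus powr_add field_simps)
    then show "?f (0 + 1 / u * z) = - (r * \<alpha> * \<bar>u\<bar> powr (1 + \<alpha>)) * ?g z"
      using False by (simp add: algebra_simps)
  qed
  also have "\<bar>1 / u\<bar> *\<^sub>R (\<integral>z. - (r * \<alpha> * \<bar>u\<bar> powr (1 + \<alpha>)) * ?g z \<partial>lborel) = - (r * stable_const \<alpha> * \<bar>u\<bar> powr \<alpha>)"
    using False assms by (simp only: integral_mult_right_zero g) (simp add: powr_add field_simps)
  finally show ?thesis .
qed simp

section \<open>The continuous density of a Gaussian mixture\<close>

text \<open>The Gaussian is its own Fourier transform: the characteristic function of the standard
  normal law is read with the roles of density and transform exchanged.\<close>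

lemma gaussian_fourier:
  assumes "s > 0"
  shows "set_integrable lborel {0<..} (\<lambda>u. cos (u * y) * exp (- (s^2 * u^2 / 2)))"
    and "(LINT u:{0<..}|lborel. cos (u * y) * exp (- (s^2 * u^2 / 2))) = pi * normal_density 0 s y"
proof -
  let ?g = "\<lambda>u. cos (u * y) * exp (- (s^2 * u^2 / 2))"
  have gi: "set_integrable lborel {0<..} (\<lambda>u. u powr 0 * exp (- (s^2 / 2 * u^2)))"
    using assms by (intro gaussian_halfline_integrable) auto
  show si: "set_integrable lborel {0<..} ?g"
  proof (rule set_integrable_bound[OF gi])
    show "set_borel_measurable lborel {0<..} ?g"
      unfolding set_borel_measurable_def by measurable
  qed (auto intro!: AE_I2 simp: abs_mult mult_left_le_one_le)
  \<comment> \<open>Evaluation at y/s matches the substitution x = s u, which turns the standard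
    normal density into the weight exp (-s^2 u^2 / 2).\<close>
  define t where "t = y / s"
  have "complex_of_real (exp (- (t^2) / 2)) = (CLINT x|density lborel (\<lambda>x. ennreal (std_normal_density x)). iexp (t * x))"
    using char_std_normal_distribution by (simp add: char_def fun_eq_iff)
  also have "\<dots> = (CLINT x|lborel. std_normal_density x *\<^sub>R iexp (t * x))"
    by (subst integral_density) auto
  finally have c: "complex_of_real (exp (- (t^2) / 2)) = (CLINT x|lborel. std_normal_density x *\<^sub>R iexp (t * x))" .
  have "complex_integrable lborel (\<lambda>x. std_normal_density x *\<^sub>R iexp (t * x))"
    by (rule Bochner_Integration.integrable_bound[of lborel "std_normal_density"]) (auto intro!: AE_I2)
  from integral_Re[OF this] have "(\<integral>x. std_normal_density x * cos (t * x) \<partial>lborel) = exp (- (t^2) / 2)"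
    unfolding c[symmetric] by (simp add: Re_exp)
  moreover have "(\<integral>x. std_normal_density x * cos (t * x) \<partial>lborel)
      = \<bar>s\<bar> *\<^sub>R (\<integral>u. std_normal_density (0 + s * u) * cos (t * (0 + s * u)) \<partial>lborel)"
    using assms by (intro lborel_integral_real_affine) auto
  moreover have "(\<lambda>u. std_normal_density (0 + s * u) * cos (t * (0 + s * u))) = (\<lambda>u. 1 / sqrt (2 * pi) * ?g u)"
    using assms by (simp add: std_normal_density_def t_def fun_eq_iff power_mult_distrib mult_ac)
  moreover have "(\<integral>u. ?g u \<partial>lborel) = 2 * (LINT u:{0<..}|lborel. ?g u)"
    by (rule integral_lborel_even(2)[OF si]) simp
  ultimately have "s * (1 / sqrt (2 * pi) * (2 * (LINT u:{0<..}|lborel. ?g u))) = exp (- (t^2) / 2)"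
    using assms by (simp only: integral_mult_right_zero real_scaleR_def abs_of_pos)
  then have "(LINT u:{0<..}|lborel. ?g u) = sqrt (2 * pi) / (2 * s) * exp (- (t^2) / 2)"
    using assms by (simp add: field_simps)
  also have "sqrt (2 * pi) / (2 * s) = pi / sqrt (2 * pi * s^2)"
    using assms by (simp add: real_sqrt_mult field_simps)
  also have "exp (- (t^2) / 2) = exp (- (y - 0)\<^sup>2 / (2 * s^2))"
    by (simp add: t_def power_divide)
  finally show "(LINT u:{0<..}|lborel. ?g u) = pi * normal_density 0 s y"
    by (simp add: normal_density_def)
qed

lemma osc_integral_gaussian:
  "s > 0 \<Longrightarrow> osc_integral (\<lambda>_. 1) s \<alpha> 0 y = pi * normal_density 0 s y"
  using gaussian_fourier(2)[of s y] by (simp add: osc_integral_def)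

lemma normal_density_le:
  assumes "s > 0"
  shows "normal_density 0 s x \<le> 1 / sqrt (2 * pi * s^2)"
  using assms by (simp add: normal_density_def divide_right_mono)

text \<open>Inversion is applied to the Gaussian kernel only. Fubini then integrates over \<nu>
  inside, where the characteristic function of \<nu> appears; as it is real, the sine part drops
  out.\<close>

lemma normal_mixture_fourier:
  assumes "real_distribution \<nu>" and "s > 0"
    and char: "\<And>u. char \<nu> u = of_real (exp (- m * \<bar>u\<bar> powr \<alpha>))"
  shows "(\<integral>z. normal_density 0 s (x - z) \<partial>\<nu>) = osc_integral (\<lambda>_. 1) s \<alpha> m x / pi"
proof -
  interpret real_distribution \<nu> by fact
  interpret P: pair_sigma_finite \<nu> lborel ..
  let ?e = "\<lambda>u. indicator {0<..} u * exp (- (s^2 * u^2 / 2)) :: real"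
  let ?h = "\<lambda>z u. ?e u * cos (u * (x - z))"
  have ei: "integrable lborel ?e"
    using gaussian_fourier(1)[OF assms(2), of 0] by (simp add: set_integrable_def)
  have hi: "integrable lborel (?h z)" for z
    by (rule Bochner_Integration.integrable_bound[OF ei]) (auto intro!: AE_I2 simp: abs_mult mult_left_le_one_le mult_le_one indicator_def)
  have "pi * normal_density 0 s (x - z) = (\<integral>u. ?h z u \<partial>lborel)" for z
    using gaussian_fourier(2)[OF assms(2), of "x - z"] by (simp add: set_lebesgue_integral_def mult_ac)
  then have "(\<integral>z. pi * normal_density 0 s (x - z) \<partial>\<nu>) = (\<integral>z. (\<integral>u. ?h z u \<partial>lborel) \<partial>\<nu>)"
    by (simp only:)
  also have "\<dots> = (\<integral>u. (\<integral>z. ?h z u \<partial>\<nu>) \<partial>lborel)"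
  proof (rule P.Fubini_integral[symmetric], rule P.Fubini_integrable)
    show "AE z in \<nu>. integrable lborel (\<lambda>u. (case (z, u) of (z, u) \<Rightarrow> ?h z u))" using hi by simp
    show "integrable \<nu> (\<lambda>z. \<integral>u. norm (case (z, u) of (z, u) \<Rightarrow> ?h z u) \<partial>lborel)"
    proof (rule integrable_const_bound[of _ "\<integral>u. ?e u \<partial>lborel"])
      show "AE z in \<nu>. norm (\<integral>u. norm (case (z, u) of (z, u) \<Rightarrow> ?h z u) \<partial>lborel) \<le> (\<integral>u. ?e u \<partial>lborel)"
      proof (rule AE_I2)
        fix z
        have "(\<integral>u. norm (?h z u) \<partial>lborel) \<le> (\<integral>u. ?e u \<partial>lborel)"
          by (rule integral_mono[OF integrable_norm[OF hi] ei]) (simp add: abs_mult mult_left_le)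
        then show "norm (\<integral>u. norm (case (z, u) of (z, u) \<Rightarrow> ?h z u) \<partial>lborel) \<le> (\<integral>u. ?e u \<partial>lborel)"
          by simp
      qed
    qed simp
  qed simp
  also have "\<dots> = (\<integral>u. indicator {0<..} u *\<^sub>R (cos (u * x) * 1 * exp (- (s^2 * u^2 / 2) - m * u powr \<alpha>)) \<partial>lborel)"
  proof (rule Bochner_Integration.integral_cong[OF refl])
    fix u :: real
    have ii: "complex_integrable \<nu> (\<lambda>z. iexp (u * z))" by (rule integrable_iexp) auto
    have C: "(\<integral>z. cos (u * z) \<partial>\<nu>) = Re (char \<nu> u)" "(\<integral>z. sin (u * z) \<partial>\<nu>) = Im (char \<nu> u)"
      using integral_Re[OF ii] integral_Im[OF ii] by (simp_all add: char_def Re_exp Im_exp)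
    have ci: "integrable \<nu> (\<lambda>z. cos (u * z))" "integrable \<nu> (\<lambda>z. sin (u * z))"
      by (rule integrable_const_bound[of _ 1]; simp)+
    have "(\<integral>z. cos (u * (x - z)) \<partial>\<nu>) = (\<integral>z. cos (u * x) * cos (u * z) + sin (u * x) * sin (u * z) \<partial>\<nu>)"
      by (simp add: right_diff_distrib cos_diff)
    also have "\<dots> = cos (u * x) * (\<integral>z. cos (u * z) \<partial>\<nu>) + sin (u * x) * (\<integral>z. sin (u * z) \<partial>\<nu>)"
      using ci by simp
    also have "\<dots> = cos (u * x) * exp (- m * \<bar>u\<bar> powr \<alpha>)"
      unfolding C char by simp
    finally have I: "(\<integral>z. cos (u * (x - z)) \<partial>\<nu>) = cos (u * x) * exp (- m * \<bar>u\<bar> powr \<alpha>)" .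
    have "exp (- (s^2 * u^2 / 2) - m * u powr \<alpha>) = exp (- (s^2 * u^2 / 2)) * exp (- m * u powr \<alpha>)"
      by (simp flip: exp_add)
    then show "(\<integral>z. ?h z u \<partial>\<nu>) = indicator {0<..} u *\<^sub>R (cos (u * x) * 1 * exp (- (s^2 * u^2 / 2) - m * u powr \<alpha>))"
      unfolding integral_mult_right_zero I by (simp add: indicator_def)
  qed
  finally show ?thesis
    by (simp add: osc_integral_def set_lebesgue_integral_def field_simps)
qed

lemma (in prob_space) distributed_normal_mixture:
  assumes X: "distributed M lborel X (\<lambda>x. ennreal (normal_density 0 s x))"
    and S: "S \<in> borel_measurable M" and ind: "indep_var borel X borel S" and "s > 0"
  shows "distributed M lborel (\<lambda>\<omega>. X \<omega> + S \<omega>)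
    (\<lambda>x. ennreal (\<integral>z. normal_density 0 s (x - z) \<partial>distr M borel S))"
proof -
  let ?\<nu> = "distr M borel S"
  interpret \<nu>: real_distribution ?\<nu> using S by (rule real_distribution_distr)
  have Xm: "X \<in> borel_measurable M" using X by (simp add: distributed_def measurable_lborel1)
  have dX: "distr M borel X = density lborel (\<lambda>x. ennreal (normal_density 0 s x))"
    using X by (simp add: distributed_def cong: distr_cong)
  let ?f = "\<lambda>x. \<integral>z. normal_density 0 s (x - z) \<partial>?\<nu>"
  have fint: "integrable ?\<nu> (\<lambda>z. normal_density 0 s (x - z))" for x
    using normal_density_le[OF \<open>s > 0\<close>] by (intro \<nu>.integrable_const_bound[of _ "1 / sqrt (2 * pi * s^2)"]) auto
  interpret P: pair_sigma_finite ?\<nu> lborel ..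
  interpret N: prob_space "density lborel (\<lambda>x. ennreal (normal_density 0 s x))"
    using \<open>s > 0\<close> by (rule prob_space_normal_density)
  have "distr M borel (\<lambda>\<omega>. X \<omega> + S \<omega>) = convolution (distr M borel X) ?\<nu>"
    using ind Xm S by (rule sum_indep_random_variable)
  \<comment> \<open>The factors are exchanged so that the Gaussian integral is the inner one, where
    Lebesgue measure can be translated by z.\<close>
  also have "\<dots> = convolution ?\<nu> (distr M borel X)"
    unfolding dX by (rule convolution_commutative) (auto intro: \<nu>.finite_measure_axioms N.finite_measure_axioms)
  also have "\<dots> = density lborel (\<lambda>x. ennreal (?f x))"
  proof (rule measure_eqI)
    fix A assume "A \<in> sets (convolution ?\<nu> (distr M borel X))"
    then have A[measurable]: "A \<in> sets borel" by simp
    have "emeasure (convolution ?\<nu> (distr M borel X)) A = (\<integral>\<^sup>+y. indicator A y \<partial>convolution ?\<nu> (distr M borel X))"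
      by simp
    also have "\<dots> = (\<integral>\<^sup>+z. \<integral>\<^sup>+y. indicator A (z + y) \<partial>distr M borel X \<partial>?\<nu>)"
      unfolding dX by (rule nn_integral_convolution) (auto intro: \<nu>.finite_measure_axioms N.finite_measure_axioms)
    also have "\<dots> = (\<integral>\<^sup>+z. \<integral>\<^sup>+x. ennreal (normal_density 0 s (x - z)) * indicator A x \<partial>lborel \<partial>?\<nu>)"
    proof (rule nn_integral_cong)
      fix z :: real
      have "(\<integral>\<^sup>+y. indicator A (z + y) \<partial>distr M borel X) = (\<integral>\<^sup>+y. ennreal (normal_density 0 s y) * indicator A (z + y) \<partial>lborel)"
        unfolding dX by (subst nn_integral_density) auto
      also have "\<dots> = (\<integral>\<^sup>+x. ennreal (normal_density 0 s (x - z)) * indicator A x \<partial>lborel)"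
        by (subst nn_integral_real_affine[where c=1 and t="-z"]) (auto simp: algebra_simps)
      finally show "(\<integral>\<^sup>+y. indicator A (z + y) \<partial>distr M borel X) = (\<integral>\<^sup>+x. ennreal (normal_density 0 s (x - z)) * indicator A x \<partial>lborel)" .
    qed
    also have "\<dots> = (\<integral>\<^sup>+x. \<integral>\<^sup>+z. ennreal (normal_density 0 s (x - z)) * indicator A x \<partial>?\<nu> \<partial>lborel)"
      by (rule P.Fubini'[symmetric]) (simp add: case_prod_unfold)
    also have "\<dots> = (\<integral>\<^sup>+x. ennreal (?f x) * indicator A x \<partial>lborel)"
      using fint by (intro nn_integral_cong) (simp add: nn_integral_multc nn_integral_eq_integral)
    also have "\<dots> = emeasure (density lborel (\<lambda>x. ennreal (?f x))) A"
      by (simp add: emeasure_density)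
    finally show "emeasure (convolution ?\<nu> (distr M borel X)) A = emeasure (density lborel (\<lambda>x. ennreal (?f x))) A" .
  qed simp
  finally show ?thesis
    using Xm S by (simp add: distributed_def add.commute cong: distr_cong)
qed

text \<open>Needed because \<open>lebesgue_density\<close> selects the continuous version.\<close>

lemma continuous_normal_mixture:
  assumes "real_distribution \<nu>" "s > 0"
  shows "continuous_on UNIV (\<lambda>x. \<integral>z. normal_density 0 s (x - z) \<partial>\<nu>)"
proof -
  interpret real_distribution \<nu> by fact
  show ?thesis
    unfolding continuous_on_sequentially comp_def
  proof (intro allI ballI impI)
    fix X :: "nat \<Rightarrow> real" and x
    assume X: "(\<forall>n. X n \<in> UNIV) \<and> X \<longlonglongrightarrow> x"
    show "(\<lambda>n. \<integral>z. normal_density 0 s (X n - z) \<partial>\<nu>) \<longlonglongrightarrow> (\<integral>z. normal_density 0 s (x - z) \<partial>\<nu>)"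
    proof (rule integral_dominated_convergence[where w="\<lambda>_. 1 / sqrt (2 * pi * s^2)"])
      show "AE z in \<nu>. (\<lambda>n. normal_density 0 s (X n - z)) \<longlonglongrightarrow> normal_density 0 s (x - z)"
        using X \<open>s > 0\<close> unfolding normal_density_def by (intro AE_I2 tendsto_intros) auto
    qed (use normal_density_le[OF \<open>s > 0\<close>] in auto)
  qed
qed

text \<open>Two densities of the same law agree almost everywhere. For continuous ones the set of
  agreement is closed, and a closed set of full measure is the whole line.\<close>

lemma lebesgue_density_eqI:
  assumes "prob_space M" "continuous_on UNIV f" "\<And>x. 0 \<le> f x" "distributed M lborel X (\<lambda>x. ennreal (f x))"
  shows "lebesgue_density M X = f"
  unfolding lebesgue_density_def
proof (rule the_equality)
  interpret prob_space M by fact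
  fix g :: "real \<Rightarrow> real"
  assume g: "continuous_on UNIV g \<and> (\<forall>x. 0 \<le> g x) \<and> distributed M lborel X (\<lambda>x. ennreal (g x))"
  have "density lborel (\<lambda>x. ennreal (f x)) = density lborel (\<lambda>x. ennreal (g x))"
    using g assms(4) by (simp add: distributed_def)
  then have "AE x in lborel. ennreal (f x) = ennreal (g x)"
    using g assms by (intro sigma_finite_measure.density_unique_iff[OF lborel.sigma_finite_measure_axioms, THEN iffD1])
      (auto simp: distributed_def)
  then have "AE x in lborel. x \<in> {x. g x = f x}"
    by eventually_elim (use g assms(3) in auto)
  then have ae: "AE x in lebesgue. x \<in> {x. g x = f x}" by (rule AE_completion)
  have "closed {x. g x = f x}" using g assms(2) by (intro closed_Collect_eq) auto
  then show "g = f" using mem_closed_if_AE_lebesgue[OF _ ae] by auto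
qed (use assms in auto)

section \<open>Derivatives in the parameters\<close>

text \<open>Dominated convergence for difference quotients along sequences, so the Lipschitz bound
  is needed only against the base point \<open>x0\<close>. Differentiating within \<open>S\<close>
  also covers one-sided derivatives.\<close>

lemma integral_has_derivative_dominated:
  fixes f :: "real \<Rightarrow> 'a \<Rightarrow> real"
  assumes x0: "x0 \<in> S"
    and int: "\<And>x. x \<in> S \<Longrightarrow> integrable M (f x)"
    and der: "\<And>t. ((\<lambda>x. f x t) has_real_derivative f' t) (at x0 within S)"
    and lip: "\<And>x t. x \<in> S \<Longrightarrow> \<bar>f x t - f x0 t\<bar> \<le> g t * \<bar>x - x0\<bar>"
    and g: "integrable M g" and f': "f' \<in> borel_measurable M"
  shows "((\<lambda>x. \<integral>t. f x t \<partial>M) has_real_derivative (\<integral>t. f' t \<partial>M)) (at x0 within S)"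
  unfolding has_field_derivative_iff tendsto_at_iff_sequentially comp_def
proof (intro allI impI)
  fix X :: "nat \<Rightarrow> real"
  assume X: "\<forall>i. X i \<in> S - {x0}" "X \<longlonglongrightarrow> x0"
  have eq: "((\<integral>t. f (X n) t \<partial>M) - (\<integral>t. f x0 t \<partial>M)) / (X n - x0) = (\<integral>t. (f (X n) t - f x0 t) / (X n - x0) \<partial>M)" for n
    using X(1) int x0 by simp
  show "(\<lambda>n. ((\<integral>t. f (X n) t \<partial>M) - (\<integral>t. f x0 t \<partial>M)) / (X n - x0)) \<longlonglongrightarrow> (\<integral>t. f' t \<partial>M)"
    unfolding eq
  proof (rule integral_dominated_convergence[where w=g])
    show "(\<lambda>t. (f (X n) t - f x0 t) / (X n - x0)) \<in> borel_measurable M" for n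
      using X(1) int[of "X n"] int[OF x0] by (intro borel_measurable_divide borel_measurable_diff) auto
    show "AE t in M. (\<lambda>n. (f (X n) t - f x0 t) / (X n - x0)) \<longlonglongrightarrow> f' t"
      using der[unfolded has_field_derivative_iff tendsto_at_iff_sequentially comp_def] X by (intro AE_I2) blast
    show "AE t in M. norm ((f (X n) t - f x0 t) / (X n - x0)) \<le> g t" for n
    proof (rule AE_I2)
      fix t
      have "0 < \<bar>X n - x0\<bar>" using X(1) by auto
      then show "norm ((f (X n) t - f x0 t) / (X n - x0)) \<le> g t"
        using lip[of "X n" t] X(1) by (simp add: abs_divide pos_divide_le_eq)
    qed
  qed (use f' g in auto)
qed

lemma exp_minus_diff_le:
  fixes x y :: real
  assumes "x \<ge> 0" "y \<ge> 0"
  shows "\<bar>exp (- x) - exp (- y)\<bar> \<le> \<bar>x - y\<bar>"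
proof -
  have *: "\<bar>exp (- x) - exp (- y)\<bar> \<le> y - x" if "0 \<le> x" "x \<le> y" for x y :: real
  proof -
    have "1 - exp (x - y) \<le> y - x" using exp_ge_add_one_self[of "x - y"] by linarith
    moreover have "exp (- x) - exp (- y) = exp (- x) * (1 - exp (x - y))"
      by (simp add: right_diff_distrib flip: exp_add)
    moreover have "exp (- x) * (1 - exp (x - y)) \<le> 1 * (1 - exp (x - y))"
      using that by (intro mult_right_mono) auto
    ultimately show ?thesis using that by simp
  qed
  show ?thesis
  proof (cases "x \<le> y")
    case True
    then show ?thesis using *[of x y] assms by simp
  next
    case False
    then show ?thesis using *[of y x] assms by (simp add: abs_minus_commute)
  qed
qed

lemma powr_between_le:
  fixes v p lo hi :: real
  assumes "v > 0" "lo \<le> p" "p \<le> hi"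
  shows "v powr p \<le> v powr lo + v powr hi"
proof (cases "v \<ge> 1")
  case True
  then show ?thesis using powr_mono[of p hi v] assms powr_ge_zero[of v lo] by linarith
next
  case False
  then show ?thesis using powr_mono'[of lo p v] assms powr_ge_zero[of v hi] by linarith
qed

lemma has_real_derivative_powr_exponent:
  assumes "v > (0::real)"
  shows "((\<lambda>\<theta>. v powr \<theta>) has_real_derivative v powr \<xi> * ln v) (at \<xi> within S)"
proof -
  have "(\<lambda>\<theta>. v powr \<theta>) = (\<lambda>\<theta>. exp (\<theta> * ln v))" using assms by (simp add: powr_def fun_eq_iff)
  then show ?thesis by (auto intro!: derivative_eq_intros)
qed

lemma osc_integral_minus: "osc_integral g \<sigma> \<alpha> \<mu> (- y) = osc_integral g \<sigma> \<alpha> \<mu> y"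
  by (simp add: osc_integral_def)

lemma osc_integral_abs: "osc_integral g \<sigma> \<alpha> \<mu> \<bar>y\<bar> = osc_integral g \<sigma> \<alpha> \<mu> y"
  by (simp add: abs_if osc_integral_minus)

lemma borel_measurable_osc_integral[measurable]:
  assumes [measurable]: "g \<in> borel_measurable borel"
  shows "osc_integral g \<sigma> \<alpha> \<mu> \<in> borel_measurable borel"
  unfolding osc_integral_def[abs_def] set_lebesgue_integral_def by measurable

lemma gaussian_weight_integrable:
  fixes a b K \<sigma> :: real
  assumes "a > -1" "b > -1" "\<sigma> > 0"
  shows "set_integrable lborel {0<..} (\<lambda>v. K * (v powr a + v powr b) * exp (- (\<sigma>^2 * v^2 / 2)))"
proof -
  have e: "K * (v powr a + v powr b) * exp (- (\<sigma>^2 * v^2 / 2)) =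
      K * (v powr a * exp (- (\<sigma>^2 / 2 * v^2)) + v powr b * exp (- (\<sigma>^2 / 2 * v^2)))" for v
    by (simp add: algebra_simps)
  show ?thesis unfolding e using assms
    by (intro set_integrable_mult_right set_integral_add gaussian_halfline_integrable) auto
qed

section \<open>Domination by the Gaussian weight, and derivatives in scale and index\<close>

context
  fixes g :: "real \<Rightarrow> real" and K a b \<sigma> :: real
  assumes g[measurable]: "g \<in> borel_measurable borel"
    and bound: "\<And>v. v > 0 \<Longrightarrow> \<bar>g v\<bar> \<le> K * (v powr a + v powr b)"
    and par: "a > -1" "b > -1" "\<sigma> > 0"
begin

lemma osc_integrand_le:
  assumes "\<mu> \<ge> 0" "v > 0"
  shows "\<bar>cos (v * y) * g v * exp (- (\<sigma>^2 * v^2 / 2) - \<mu> * v powr \<alpha>)\<bar>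
     \<le> K * (v powr a + v powr b) * exp (- (\<sigma>^2 * v^2 / 2))"
proof -
  have "\<bar>cos (v * y) * g v * exp (- (\<sigma>^2 * v^2 / 2) - \<mu> * v powr \<alpha>)\<bar>
     \<le> 1 * (K * (v powr a + v powr b)) * exp (- (\<sigma>^2 * v^2 / 2))"
    unfolding abs_mult using assms order_trans[OF abs_ge_zero bound[OF assms(2)]]
    by (intro mult_mono bound) auto
  then show ?thesis by simp
qed

lemma osc_integrable:
  assumes "\<mu> \<ge> 0"
  shows "set_integrable lborel {0<..} (\<lambda>v. cos (v * y) * g v * exp (- (\<sigma>^2 * v^2 / 2) - \<mu> * v powr \<alpha>))"
proof (rule set_integrable_bound[OF gaussian_weight_integrable[OF par, of K]])
  show "set_borel_measurable lborel {0<..} (\<lambda>v. cos (v * y) * g v * exp (- (\<sigma>^2 * v^2 / 2) - \<mu> * v powr \<alpha>))"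
    unfolding set_borel_measurable_def by measurable
  show "AE v in lborel. v \<in> {0<..} \<longrightarrow> norm (cos (v * y) * g v * exp (- (\<sigma>^2 * v^2 / 2) - \<mu> * v powr \<alpha>))
      \<le> norm (K * (v powr a + v powr b) * exp (- (\<sigma>^2 * v^2 / 2)))"
    using osc_integrand_le[OF assms] by (intro AE_I2 impI) (simp only: real_norm_def greaterThan_iff order_trans[OF _ abs_ge_self])
qed

lemma osc_integral_bounded: "\<exists>C\<ge>0. \<forall>\<mu>\<ge>0. \<forall>y. \<bar>osc_integral g \<sigma> \<alpha> \<mu> y\<bar> \<le> C"
proof -
  define C where "C = (LINT v:{0<..}|lborel. K * (v powr a + v powr b) * exp (- (\<sigma>^2 * v^2 / 2)))"
  have le: "\<bar>osc_integral g \<sigma> \<alpha> \<mu> y\<bar> \<le> C" if "\<mu> \<ge> 0" for \<mu> y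
  proof -
    have "norm (osc_integral g \<sigma> \<alpha> \<mu> y) \<le> C"
      unfolding osc_integral_def C_def
      by (rule order_trans[OF set_integral_norm_bound[OF osc_integrable[OF that]]
            set_integral_mono[OF set_integrable_norm[OF osc_integrable[OF that]] gaussian_weight_integrable[OF par]]])
         (simp only: real_norm_def greaterThan_iff osc_integrand_le[OF that])
    then show ?thesis by simp
  qed
  show ?thesis
    using le order_trans[OF abs_ge_zero le[OF order_refl, of 0]] by (intro exI[of _ C]) auto
qed

end

lemma weighted_exp_diff_le:
  fixes p q a t D :: real
  assumes "\<bar>exp (- p) - exp (- q)\<bar> \<le> D"
  shows "\<bar>cos t * 1 * exp (a - p) - cos t * 1 * exp (a - q)\<bar> \<le> exp a * D"
proof -
  have "cos t * 1 * exp (a - p) - cos t * 1 * exp (a - q) = cos t * (exp a * (exp (- p) - exp (- q)))"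
    by (simp add: right_diff_distrib flip: exp_add)
  then have "\<bar>cos t * 1 * exp (a - p) - cos t * 1 * exp (a - q)\<bar> = \<bar>cos t\<bar> * (exp a * \<bar>exp (- p) - exp (- q)\<bar>)"
    by (simp only: abs_mult abs_exp_cancel)
  also have "\<dots> \<le> 1 * (exp a * D)"
    using assms by (intro mult_mono mult_left_mono) auto
  finally show ?thesis by simp
qed

lemma set_integral_deriv_dominated:
  fixes f :: "real \<Rightarrow> real \<Rightarrow> real"
  assumes x0: "x0 \<in> S"
    and int: "\<And>x. x \<in> S \<Longrightarrow> set_integrable lborel {0<..} (f x)"
    and der: "\<And>t. t > 0 \<Longrightarrow> ((\<lambda>x. f x t) has_real_derivative f' t) (at x0 within S)"
    and lip: "\<And>x t. x \<in> S \<Longrightarrow> t > 0 \<Longrightarrow> \<bar>f x t - f x0 t\<bar> \<le> g t * \<bar>x - x0\<bar>"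
    and g: "set_integrable lborel {0<..} g" and f': "f' \<in> borel_measurable borel"
  shows "((\<lambda>x. LINT t:{0<..}|lborel. f x t) has_real_derivative (LINT t:{0<..}|lborel. f' t)) (at x0 within S)"
  unfolding set_lebesgue_integral_def
proof (rule integral_has_derivative_dominated[where g="\<lambda>t. indicator {0<..} t *\<^sub>R g t"])
  show "((\<lambda>x. indicator {0<..} t *\<^sub>R f x t) has_real_derivative indicator {0<..} t *\<^sub>R f' t) (at x0 within S)" for t
    using der[of t] by (cases "t > 0") auto
  show "\<bar>indicator {0<..} t *\<^sub>R f x t - indicator {0<..} t *\<^sub>R f x0 t\<bar> \<le> indicator {0<..} t *\<^sub>R g t * \<bar>x - x0\<bar>" if "x \<in> S" for x t
    using lip[OF that, of t] by (cases "t > 0") auto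
qed (use x0 int g f' in \<open>auto simp: set_integrable_def\<close>)

text \<open>The derivative is taken within [0, infinity) to include \<mu> = 0, the Gaussian case
  from which the mean value theorem starts.\<close>

lemma osc_integral_deriv_scale:
  assumes "\<sigma> > 0" "\<alpha> > 0" "\<mu> \<ge> 0"
  shows "((\<lambda>\<mu>. osc_integral (\<lambda>_. 1) \<sigma> \<alpha> \<mu> y) has_real_derivative
      - osc_integral (\<lambda>v. v powr \<alpha>) \<sigma> \<alpha> \<mu> y) (at \<mu> within {0..})"
proof -
  let ?E = "\<lambda>v. exp (- (\<sigma>^2 * v^2 / 2))"
  have m: "- osc_integral (\<lambda>v. v powr \<alpha>) \<sigma> \<alpha> \<mu> y
      = (LINT v:{0<..}|lborel. (-1) * (cos (v * y) * v powr \<alpha> * exp (- (\<sigma>^2 * v^2 / 2) - \<mu> * v powr \<alpha>)))"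
    unfolding osc_integral_def by (subst set_integral_mult_right) simp
  show ?thesis unfolding m
    unfolding osc_integral_def
  \<comment> \<open>The power is doubled only to match the two-power shape in
    \<open>gaussian_weight_integrable\<close>.\<close>
  proof (rule set_integral_deriv_dominated[where g="\<lambda>v. 1 * (v powr \<alpha> + v powr \<alpha>) * ?E v"])
    show "set_integrable lborel {0<..} (\<lambda>v. cos (v * y) * 1 * exp (- (\<sigma>^2 * v^2 / 2) - \<mu>' * v powr \<alpha>))" if "\<mu>' \<in> {0..}" for \<mu>'
      by (rule osc_integrable[where K=1 and a=0 and b=0]) (use assms that in auto)
    show "((\<lambda>\<mu>. cos (v * y) * 1 * exp (- (\<sigma>^2 * v^2 / 2) - \<mu> * v powr \<alpha>)) has_real_derivative
        (-1) * (cos (v * y) * v powr \<alpha> * exp (- (\<sigma>^2 * v^2 / 2) - \<mu> * v powr \<alpha>))) (at \<mu> within {0..})" for v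
      by (auto intro!: derivative_eq_intros)
    show "\<bar>cos (v * y) * 1 * exp (- (\<sigma>^2 * v^2 / 2) - \<mu>' * v powr \<alpha>) - cos (v * y) * 1 * exp (- (\<sigma>^2 * v^2 / 2) - \<mu> * v powr \<alpha>)\<bar>
        \<le> 1 * (v powr \<alpha> + v powr \<alpha>) * ?E v * \<bar>\<mu>' - \<mu>\<bar>" if "\<mu>' \<in> {0..}" "v > 0" for \<mu>' v
    proof -
      have "\<bar>exp (- (\<mu>' * v powr \<alpha>)) - exp (- (\<mu> * v powr \<alpha>))\<bar> \<le> \<bar>\<mu>' * v powr \<alpha> - \<mu> * v powr \<alpha>\<bar>"
        using assms that by (intro exp_minus_diff_le) auto
      also have "\<dots> = v powr \<alpha> * \<bar>\<mu>' - \<mu>\<bar>" by (simp add: abs_mult flip: left_diff_distrib)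
      also have "\<dots> \<le> (v powr \<alpha> + v powr \<alpha>) * \<bar>\<mu>' - \<mu>\<bar>" by (intro mult_right_mono) auto
      finally have d: "\<bar>exp (- (\<mu>' * v powr \<alpha>)) - exp (- (\<mu> * v powr \<alpha>))\<bar> \<le> (v powr \<alpha> + v powr \<alpha>) * \<bar>\<mu>' - \<mu>\<bar>" .
      show ?thesis
        using weighted_exp_diff_le[OF d, of "v * y" "- (\<sigma>^2 * v^2 / 2)"] by (simp only: mult_1 mult_ac)
    qed
    show "set_integrable lborel {0<..} (\<lambda>v. 1 * (v powr \<alpha> + v powr \<alpha>) * ?E v)"
      using assms by (intro gaussian_weight_integrable) auto
  qed (use assms in auto)
qed

text \<open>The index enters both through the power of v and through the intensity \<open>m\<close>,
  because the constant and the factor h^(1-\<alpha>/2) depend on it; hence a total derivative with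
  two terms.\<close>

lemma osc_integral_deriv_index:
  assumes "\<sigma> > 0" "0 < \<alpha>" "\<alpha> < 2"
    and m: "(m has_real_derivative m') (at \<alpha>)" and m_pos: "m \<alpha> > 0"
  shows "((\<lambda>\<theta>. osc_integral (\<lambda>_. 1) \<sigma> \<theta> (m \<theta>) y) has_real_derivative
      - osc_integral (\<lambda>v. m' * v powr \<alpha> + m \<alpha> * (v powr \<alpha> * ln v)) \<sigma> \<alpha> (m \<alpha>) y) (at \<alpha>)"
proof -
  let ?E = "\<lambda>v. exp (- (\<sigma>^2 * v^2 / 2))"
  \<comment> \<open>For \<theta> in [\<alpha>/2, 2] all exponents \<theta> - \<eta> and \<theta> +
    \<eta> then lie between \<eta> and 2 + \<eta>, so one envelope serves for every \<theta> near
    \<alpha>.\<close>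
  define \<eta> where "\<eta> = \<alpha> / 4"
  have eta: "\<eta> > 0" using assms by (simp add: \<eta>_def)
  \<comment> \<open>Near \<alpha> the difference quotients of \<open>m\<close> stay below |m'| + 1,
    and 2/\<eta> times the envelope is a Lipschitz constant for v^\<theta> in \<theta>.\<close>
  define K where "K = \<bar>m'\<bar> + 1 + m \<alpha> * (2 / \<eta>)"
  have "((\<lambda>\<theta>. \<bar>(m \<theta> - m \<alpha>) / (\<theta> - \<alpha>)\<bar>) \<longlongrightarrow> \<bar>m'\<bar>) (at \<alpha>)"
    using m unfolding has_field_derivative_iff by (rule tendsto_rabs)
  then have e1: "\<forall>\<^sub>F \<theta> in at \<alpha>. \<bar>(m \<theta> - m \<alpha>) / (\<theta> - \<alpha>)\<bar> < \<bar>m'\<bar> + 1"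
    by (rule order_tendstoD(2)) simp
  have "(m \<longlongrightarrow> m \<alpha>) (at \<alpha>)" using DERIV_isCont[OF m] by (simp only: isCont_def)
  then have e2: "\<forall>\<^sub>F \<theta> in at \<alpha>. 0 < m \<theta>" using m_pos by (rule order_tendstoD(1))
  obtain d where d: "d > 0" "\<And>\<theta>. \<bar>\<theta> - \<alpha>\<bar> < d \<Longrightarrow> \<theta> \<noteq> \<alpha> \<Longrightarrow> \<bar>(m \<theta> - m \<alpha>) / (\<theta> - \<alpha>)\<bar> < \<bar>m'\<bar> + 1 \<and> 0 < m \<theta>"
    using eventually_conj[OF e1 e2] unfolding eventually_at dist_real_def by blast
  define S where "S = {max (\<alpha> - d) (\<alpha> / 2)<..<min (\<alpha> + d) 2}"
  have S: "open S" "\<alpha> \<in> S" "convex S" using d assms by (auto simp: S_def)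
  have Sm: "\<bar>m \<theta> - m \<alpha>\<bar> \<le> (\<bar>m'\<bar> + 1) * \<bar>\<theta> - \<alpha>\<bar>" "m \<theta> > 0" if "\<theta> \<in> S" for \<theta>
  proof -
    have "\<bar>\<theta> - \<alpha>\<bar> < d" using that by (auto simp: S_def)
    then have *: "\<bar>(m \<theta> - m \<alpha>) / (\<theta> - \<alpha>)\<bar> < \<bar>m'\<bar> + 1" "0 < m \<theta>" if "\<theta> \<noteq> \<alpha>"
      using d(2)[of \<theta>] that by blast+
    show "m \<theta> > 0" using *(2) m_pos by (cases "\<theta> = \<alpha>") simp_all
    show "\<bar>m \<theta> - m \<alpha>\<bar> \<le> (\<bar>m'\<bar> + 1) * \<bar>\<theta> - \<alpha>\<bar>"
    proof (cases "\<theta> = \<alpha>")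
      case False
      then have "0 < \<bar>\<theta> - \<alpha>\<bar>" by simp
      then show ?thesis using *(1)[OF False] unfolding abs_divide by (simp only: pos_divide_less_eq less_imp_le)
    qed simp
  qed
  have Sb: "\<alpha> / 2 \<le> \<theta>" "\<theta> \<le> 2" if "\<theta> \<in> S" for \<theta>
    using that by (simp_all add: S_def)
  let ?f = "\<lambda>v. m' * v powr \<alpha> + m \<alpha> * (v powr \<alpha> * ln v)"
  have neg: "- osc_integral ?f \<sigma> \<alpha> (m \<alpha>) y
      = (LINT v:{0<..}|lborel. (-1) * (cos (v * y) * ?f v * exp (- (\<sigma>^2 * v^2 / 2) - m \<alpha> * v powr \<alpha>)))"
    unfolding osc_integral_def by (subst set_integral_mult_right) simp
  have "((\<lambda>\<theta>. osc_integral (\<lambda>_. 1) \<sigma> \<theta> (m \<theta>) y) has_real_derivative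
      - osc_integral ?f \<sigma> \<alpha> (m \<alpha>) y) (at \<alpha> within S)"
    unfolding neg
    unfolding osc_integral_def
  proof (rule set_integral_deriv_dominated[where g="\<lambda>v. K * (v powr \<eta> + v powr (2 + \<eta>)) * ?E v"])
    show "set_integrable lborel {0<..} (\<lambda>v. cos (v * y) * 1 * exp (- (\<sigma>^2 * v^2 / 2) - m \<theta> * v powr \<theta>))" if "\<theta> \<in> S" for \<theta>
      by (rule osc_integrable[where K=1 and a=0 and b=0]) (use assms Sm(2)[OF that] in auto)
    show "((\<lambda>\<theta>. cos (v * y) * 1 * exp (- (\<sigma>^2 * v^2 / 2) - m \<theta> * v powr \<theta>)) has_real_derivative
        (-1) * (cos (v * y) * ?f v * exp (- (\<sigma>^2 * v^2 / 2) - m \<alpha> * v powr \<alpha>))) (at \<alpha> within S)" if "v > 0" for v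
    proof -
      let ?c = "- (\<sigma>^2 * v^2 / 2)"
      have "((\<lambda>\<theta>. m \<theta> * v powr \<theta>) has_real_derivative m' * v powr \<alpha> + (v powr \<alpha> * ln v) * m \<alpha>) (at \<alpha> within S)"
        by (rule DERIV_mult[OF DERIV_subset[OF m] has_real_derivative_powr_exponent[OF that]]) simp
      from DERIV_cmult[OF DERIV_chain2[OF DERIV_exp DERIV_diff[OF DERIV_const this]], of "cos (v * y) * 1" ?c]
      have "((\<lambda>\<theta>. cos (v * y) * 1 * exp (?c - m \<theta> * v powr \<theta>)) has_real_derivative
        cos (v * y) * 1 * (exp (?c - m \<alpha> * v powr \<alpha>) * (0 - (m' * v powr \<alpha> + (v powr \<alpha> * ln v) * m \<alpha>)))) (at \<alpha> within S)" .
      moreover have "cos (v * y) * 1 * (exp (?c - m \<alpha> * v powr \<alpha>) * (0 - (m' * v powr \<alpha> + (v powr \<alpha> * ln v) * m \<alpha>)))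
          = (-1) * (cos (v * y) * ?f v * exp (?c - m \<alpha> * v powr \<alpha>))"
        by (simp add: algebra_simps)
      ultimately show ?thesis by (simp only:)
    qed
    show "\<bar>cos (v * y) * 1 * exp (- (\<sigma>^2 * v^2 / 2) - m \<theta> * v powr \<theta>) - cos (v * y) * 1 * exp (- (\<sigma>^2 * v^2 / 2) - m \<alpha> * v powr \<alpha>)\<bar>
        \<le> K * (v powr \<eta> + v powr (2 + \<eta>)) * ?E v * \<bar>\<theta> - \<alpha>\<bar>" if t: "\<theta> \<in> S" and v: "v > 0" for \<theta> v
    proof -
      let ?P = "v powr \<eta> + v powr (2 + \<eta>)"
      have "norm (v powr \<theta> - v powr \<alpha>) \<le> (2 / \<eta> * ?P) * norm (\<theta> - \<alpha>)"
      proof (rule field_differentiable_bound[OF S(3) _ _ t S(2)])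
        show "((\<lambda>\<theta>. v powr \<theta>) has_real_derivative v powr \<xi> * ln v) (at \<xi> within S)" for \<xi>
          using v by (rule has_real_derivative_powr_exponent)
        show "norm (v powr \<xi> * ln v) \<le> 2 / \<eta> * ?P" if "\<xi> \<in> S" for \<xi>
        proof -
          have "norm (v powr \<xi> * ln v) \<le> 1 / \<eta> * (v powr (\<xi> - \<eta>) + v powr (\<xi> + \<eta>))"
            using powr_abs_ln_le[OF v eta, of \<xi>] by (simp add: abs_mult)
          also have "\<dots> \<le> 1 / \<eta> * (?P + ?P)"
            using Sb[OF that] eta v by (intro mult_left_mono add_mono powr_between_le) (auto simp: \<eta>_def)
          finally show ?thesis by (simp add: mult.commute)
        qed
      qed
      then have 1: "\<bar>v powr \<theta> - v powr \<alpha>\<bar> \<le> 2 / \<eta> * ?P * \<bar>\<theta> - \<alpha>\<bar>" by simp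
      have 2: "v powr \<theta> \<le> ?P" using Sb[OF t] eta v by (intro powr_between_le) (auto simp: \<eta>_def)
      have "\<bar>exp (- (m \<theta> * v powr \<theta>)) - exp (- (m \<alpha> * v powr \<alpha>))\<bar> \<le> \<bar>m \<theta> * v powr \<theta> - m \<alpha> * v powr \<alpha>\<bar>"
        using m_pos Sm(2)[OF t] by (intro exp_minus_diff_le) auto
      also have "m \<theta> * v powr \<theta> - m \<alpha> * v powr \<alpha> = (m \<theta> - m \<alpha>) * v powr \<theta> + m \<alpha> * (v powr \<theta> - v powr \<alpha>)"
        by (simp add: algebra_simps)
      also have "\<bar>\<dots>\<bar> \<le> \<bar>m \<theta> - m \<alpha>\<bar> * v powr \<theta> + m \<alpha> * \<bar>v powr \<theta> - v powr \<alpha>\<bar>"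
        by (rule order_trans[OF abs_triangle_ineq]) (simp only: abs_mult abs_of_pos[OF m_pos] order_refl abs_of_nonneg[OF powr_ge_zero])
      also have "\<dots> \<le> ((\<bar>m'\<bar> + 1) * \<bar>\<theta> - \<alpha>\<bar>) * ?P + m \<alpha> * (2 / \<eta> * ?P * \<bar>\<theta> - \<alpha>\<bar>)"
      proof (rule add_mono)
        show "\<bar>m \<theta> - m \<alpha>\<bar> * v powr \<theta> \<le> ((\<bar>m'\<bar> + 1) * \<bar>\<theta> - \<alpha>\<bar>) * ?P"
          by (rule mult_mono[OF Sm(1)[OF t] 2]) simp_all
        show "m \<alpha> * \<bar>v powr \<theta> - v powr \<alpha>\<bar> \<le> m \<alpha> * (2 / \<eta> * ?P * \<bar>\<theta> - \<alpha>\<bar>)"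
          by (rule mult_left_mono[OF 1]) (use m_pos in simp)
      qed
      also have "\<dots> = K * ?P * \<bar>\<theta> - \<alpha>\<bar>"
      proof -
        have "b * D * P + e * (c * P * D) = (b + e * c) * P * D" for b c e D P :: real by (simp add: algebra_simps)
        then show ?thesis unfolding K_def by (simp only:)
      qed
      finally have d: "\<bar>exp (- (m \<theta> * v powr \<theta>)) - exp (- (m \<alpha> * v powr \<alpha>))\<bar> \<le> K * ?P * \<bar>\<theta> - \<alpha>\<bar>" .
      show ?thesis
        by (rule order_trans[OF weighted_exp_diff_le[OF d]]) (simp only: mult_ac order_refl)
    qed
    show "set_integrable lborel {0<..} (\<lambda>v. K * (v powr \<eta> + v powr (2 + \<eta>)) * ?E v)"
      using assms eta by (intro gaussian_weight_integrable) auto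
  qed (use S in auto)
  then show ?thesis by (simp only: at_within_open[OF S(2) S(1)])
qed

text \<open>Substituting v / sqrt h for v frees the Gaussian factor from h and moves that dependence
  into the stable intensity.\<close>

lemma osc_integral_rescale:
  assumes "h > 0"
  shows "osc_integral (\<lambda>_. 1) (\<sigma> * sqrt h) \<alpha> m x =
    osc_integral (\<lambda>_. 1) \<sigma> \<alpha> (m * h powr (- \<alpha> / 2)) (x / sqrt h) / sqrt h"
proof -
  let ?f = "\<lambda>v. indicator {0<..} v *\<^sub>R (cos (v * x) * 1 * exp (- ((\<sigma> * sqrt h)^2 * v^2 / 2) - m * v powr \<alpha>))"
  have sub: "(\<integral>v. ?f v \<partial>lborel) = \<bar>1 / sqrt h\<bar> *\<^sub>R (\<integral>v. ?f (0 + 1 / sqrt h * v) \<partial>lborel)"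
    using assms by (intro lborel_integral_real_affine) auto
  have eq: "?f (0 + 1 / sqrt h * v) = indicator {0<..} v *\<^sub>R (cos (v * (x / sqrt h)) * 1 *
      exp (- (\<sigma>^2 * v^2 / 2) - m * h powr (- \<alpha> / 2) * v powr \<alpha>))" for v
  proof (cases "v > 0")
    case True
    have "(1 / sqrt h * v) powr \<alpha> = h powr (- \<alpha> / 2) * v powr \<alpha>"
    proof -
      have "1 / sqrt h = h powr - (1 / 2)"
        using assms by (simp add: powr_minus_divide powr_half_sqrt)
      then have "(1 / sqrt h * v) powr \<alpha> = (h powr - (1 / 2)) powr \<alpha> * v powr \<alpha>"
        by (simp only: powr_mult)
      then show ?thesis by (simp add: powr_powr)
    qed
    moreover have "(\<sigma> * sqrt h)^2 * (1 / sqrt h * v)^2 = \<sigma>^2 * v^2"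
      using assms by (simp add: power_mult_distrib power_divide)
    moreover have "1 / sqrt h * v * x = v * (x / sqrt h)" "1 / sqrt h * v > 0"
      using assms True by simp_all
    ultimately show ?thesis using True by (simp only: add_0 indicator_def greaterThan_iff if_True mult.assoc)
  next
    case False
    then have n: "0 + 1 / sqrt h * v \<notin> {0<..}" "v \<notin> {0<..}" using assms by (simp_all add: zero_less_divide_iff)
    show ?thesis by (simp only: indicator_simps(2)[OF n(1)] indicator_simps(2)[OF n(2)] scaleR_zero_left)
  qed
  show ?thesis
    unfolding osc_integral_def set_lebesgue_integral_def sub eq
    using assms by (simp only: real_scaleR_def abs_of_pos real_sqrt_gt_zero divide_pos_pos zero_less_one) simp
qed

section \<open>The limit of the information integrals\<close>

lemma powr_tail_integral:
  fixes e a :: real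
  assumes "e < -1" "a > 0"
  shows "has_bochner_integral lborel (\<lambda>x. indicator {x. a \<le> \<bar>x\<bar>} x * \<bar>x\<bar> powr e) (- 2 * a powr (e + 1) / (e + 1))"
proof -
  let ?F = "\<lambda>x. x powr (e + 1) / (e + 1)"
  have "(\<integral>\<^sup>+x. ennreal (x powr e) * indicator {a..} x \<partial>lborel) = ennreal (0 - ?F a)"
  proof (rule nn_integral_FTC_atLeast)
    show "DERIV ?F x :> x powr e" if "a \<le> x" for x
      using that assms by (auto intro!: derivative_eq_intros)
    show "(?F \<longlongrightarrow> 0) at_top"
      using assms by (intro tendsto_divide_zero tendsto_neg_powr filterlim_ident) auto
  qed auto
  then have h: "has_bochner_integral lborel (\<lambda>x. indicator {a..} x * x powr e) (- ?F a)"
    using assms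
    by (intro has_bochner_integral_nn_integral)
       (auto simp: divide_nonneg_neg mult.commute ennreal_mult'' ennreal_indicator[symmetric] simp del: ennreal_indicator intro!: divide_nonneg_neg)
  let ?f = "\<lambda>x. indicator {x. a \<le> \<bar>x\<bar>} x * \<bar>x\<bar> powr e"
  have eq: "indicator {0<..} x *\<^sub>R ?f x = indicator {a..} x * x powr e" for x
    using assms by (auto simp: indicator_def)
  have si: "set_integrable lborel {0<..} ?f"
    using h unfolding set_integrable_def eq by (simp add: has_bochner_integral_iff)
  have "(LINT x:{0<..}|lborel. ?f x) = - ?F a"
    using h unfolding set_lebesgue_integral_def eq by (simp add: has_bochner_integral_iff)
  then show ?thesis
    using integral_lborel_even[OF si] by (simp add: has_bochner_integral_iff indicator_def)
qed

abbreviation tail_weight :: "real \<Rightarrow> real \<Rightarrow> real \<Rightarrow> real" where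
  "tail_weight \<alpha> L w \<equiv> (sqrt L * \<bar>w\<bar>) powr (1 + \<alpha>)"

text \<open>The variable \<open>w\<close> is \<open>y / sqrt L\<close>; the power \<open>\<eta>\<close> absorbs the logarithm in the score of \<open>\<alpha>\<close>.\<close>

definition score_profile :: "real \<Rightarrow> real \<Rightarrow> (real \<Rightarrow> real \<Rightarrow> real) \<Rightarrow> real \<Rightarrow> bool" where
  "score_profile \<alpha> \<eta> A a \<longleftrightarrow>
     (\<forall>L. A L \<in> borel_measurable borel) \<and>
     (\<exists>C R. C \<ge> 0 \<and> (\<forall>\<^sub>F L in at_top. \<forall>y. \<bar>A L y\<bar> \<le> C) \<and>
       (\<forall>\<^sub>F L in at_top. \<forall>w. R \<le> sqrt L * \<bar>w\<bar> \<longrightarrow>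
          \<bar>A L (sqrt L * w)\<bar> * tail_weight \<alpha> L w \<le> C * (1 + \<bar>w\<bar> powr \<eta>))) \<and>
     (\<forall>w. w \<noteq> 0 \<longrightarrow> ((\<lambda>L. A L (sqrt L * w) * tail_weight \<alpha> L w) \<longlongrightarrow> a) at_top)"

lemma information_integral_limit:
  fixes q A B :: "real \<Rightarrow> real \<Rightarrow> real" and \<sigma> r \<alpha> \<eta> \<kappa> R a b :: real
  defines "s \<equiv> \<lambda>L. r * exp (- ((1 - \<alpha> / 2) * L))"
  assumes par: "\<sigma> > 0" "r > 0" "0 < \<alpha>" "\<alpha> < 2" "0 < \<eta>" "2 * \<eta> < \<alpha>" "\<kappa> > 0"
    and A: "score_profile \<alpha> \<eta> A a" and B: "score_profile \<alpha> \<eta> B b"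
    and qm[measurable]: "\<And>L. q L \<in> borel_measurable borel"
    and q1: "\<forall>\<^sub>F L in at_top. \<forall>y. normal_density 0 \<sigma> y / 2 \<le> q L y"
    and q2: "\<forall>\<^sub>F L in at_top. \<forall>y. R \<le> \<bar>y\<bar> \<longrightarrow> \<kappa> * s L \<le> q L y * \<bar>y\<bar> powr (1 + \<alpha>)"
    and q3: "\<And>w. w \<noteq> 0 \<Longrightarrow> ((\<lambda>L. (q L (sqrt L * w) - normal_density 0 \<sigma> (sqrt L * w)) * tail_weight \<alpha> L w / s L) \<longlongrightarrow> \<alpha>) at_top"
  shows "((\<lambda>L. L powr (\<alpha> / 2) * (\<integral>y. s L * A L y * B L y / q L y \<partial>lborel)) \<longlongrightarrow>
           2 * a * b / (\<alpha>^2 * (\<sigma> * sqrt (2 - \<alpha>)) powr \<alpha>)) at_top"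
proof -
  have Am[measurable]: "A L \<in> borel_measurable borel" and Bm[measurable]: "B L \<in> borel_measurable borel" for L
    using A B by (auto simp: score_profile_def)
  obtain CA RA where CA: "CA \<ge> 0" "\<forall>\<^sub>F L in at_top. \<forall>y. \<bar>A L y\<bar> \<le> CA"
     "\<forall>\<^sub>F L in at_top. \<forall>w. RA \<le> sqrt L * \<bar>w\<bar> \<longrightarrow>
          \<bar>A L (sqrt L * w)\<bar> * tail_weight \<alpha> L w \<le> CA * (1 + \<bar>w\<bar> powr \<eta>)"
    using A unfolding score_profile_def by blast
  obtain CB RB where CB: "CB \<ge> 0" "\<forall>\<^sub>F L in at_top. \<forall>y. \<bar>B L y\<bar> \<le> CB"
     "\<forall>\<^sub>F L in at_top. \<forall>w. RB \<le> sqrt L * \<bar>w\<bar> \<longrightarrow>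
          \<bar>B L (sqrt L * w)\<bar> * tail_weight \<alpha> L w \<le> CB * (1 + \<bar>w\<bar> powr \<eta>)"
    using B unfolding score_profile_def by blast
  \<comment> \<open>The solution of w^2 / (2 \<sigma>^2) = 1 - \<alpha>/2, where the Gaussian
    density at sqrt L * w and the factor \<open>s L\<close> have the same exponential rate in
    L.\<close>
  define w0 where "w0 = \<sigma> * sqrt (2 - \<alpha>)"
  define w1 where "w1 = w0 / 2"
  have w01: "w0 > 0" "w1 > 0" using par by (auto simp: w0_def w1_def)
  \<comment> \<open>The exponent (1+\<alpha>)/2 joins the normalisation L^(\<alpha>/2) and the
    Jacobian sqrt L of y = sqrt L * w.\<close>
  define G where "G = (\<lambda>L w. L powr ((1 + \<alpha>) / 2) * (s L * A L (sqrt L * w) * B L (sqrt L * w) / q L (sqrt L * w)))"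
  define f where "f = (\<lambda>w. a * b / \<alpha> * (indicator {w. w0 \<le> \<bar>w\<bar>} w * \<bar>w\<bar> powr (- 1 - \<alpha>)))"
  \<comment> \<open>The bracket absorbs 1 into |w|^\<eta> for |w| >= w1. Two scores over one density
    leave the exponent 2 \<eta> - 1 - \<alpha>, which is below -1 since 2 \<eta> < \<alpha>; hence
    the majorant \<open>W\<close> below is integrable.\<close>
  define C2 where "C2 = CA * CB / \<kappa> * (w1 powr - \<eta> + 1)^2"
  define W where "W = (\<lambda>w. indicator {- w1..w1} w * 1 + C2 * (indicator {w. w1 \<le> \<bar>w\<bar>} w * \<bar>w\<bar> powr (2 * \<eta> - 1 - \<alpha>)))"
  define N where "N = sqrt (2 * pi * \<sigma>^2)"
  have N: "N > 0" using par by (simp add: N_def)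
  have s_pos: "s L > 0" for L using par by (simp add: s_def)
  have phi: "normal_density 0 \<sigma> (sqrt L * w) = exp (- (w^2 / (2 * \<sigma>^2) * L)) / N" if "L \<ge> 0" for L w
    using that by (simp add: normal_density_def N_def power_mult_distrib mult.commute)

  \<comment> \<open>In the core only the Gaussian lower bound on \<open>q\<close> and the
    boundedness of the scores are used; the result is exponentially small when |w| < w0.\<close>
  have small: "\<bar>G L w\<bar> \<le> 2 * N * r * CA * CB * (L powr ((1 + \<alpha>) / 2) * exp (- ((1 - \<alpha> / 2 - w^2 / (2 * \<sigma>^2)) * L)))"
    if L: "L \<ge> 0" "\<forall>y. normal_density 0 \<sigma> y / 2 \<le> q L y" "\<forall>y. \<bar>A L y\<bar> \<le> CA" "\<forall>y. \<bar>B L y\<bar> \<le> CB" for L w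
  proof -
    let ?y = "sqrt L * w"
    have ph: "0 < normal_density 0 \<sigma> ?y / 2" using normal_density_pos[OF par(1)] by simp
    have qp: "0 < q L ?y" using L(2)[rule_format, of ?y] ph by linarith
    have "\<bar>G L w\<bar> = L powr ((1 + \<alpha>) / 2) * (s L * \<bar>A L ?y\<bar> * \<bar>B L ?y\<bar> / q L ?y)"
      using s_pos[of L] qp by (simp add: G_def abs_mult)
    also have "\<dots> \<le> L powr ((1 + \<alpha>) / 2) * (s L * CA * CB / (normal_density 0 \<sigma> ?y / 2))"
      using L s_pos[of L] CA(1) CB(1) ph
      by (intro mult_left_mono frac_le mult_mono) (auto intro!: mult_nonneg_nonneg)
    also have "\<dots> = 2 * N * r * CA * CB * (L powr ((1 + \<alpha>) / 2) * (exp (- ((1 - \<alpha> / 2) * L)) / exp (- (w^2 / (2 * \<sigma>^2) * L))))"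
      unfolding phi[OF L(1)] s_def using N by (simp add: field_simps)
    also have "exp (- ((1 - \<alpha> / 2) * L)) / exp (- (w^2 / (2 * \<sigma>^2) * L)) = exp (- ((1 - \<alpha> / 2 - w^2 / (2 * \<sigma>^2)) * L))"
      by (simp add: exp_diff[symmetric] left_diff_distrib)
    finally show ?thesis .
  qed
  have w0sq: "w0^2 / (2 * \<sigma>^2) = 1 - \<alpha> / 2"
    using par by (simp add: w0_def power_mult_distrib field_simps)
  have pL: "tail_weight \<alpha> L w = L powr ((1 + \<alpha>) / 2) * \<bar>w\<bar> powr (1 + \<alpha>)" if "L > 0" for L w
    using that by (simp add: powr_mult powr_half_sqrt[symmetric] powr_powr)

  \<comment> \<open>The origin is excluded because the profiles have no limit prescribed there, and
    the two points of modulus w0 because the exponential rates tie.\<close>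
  have lim: "AE w in lborel. ((\<lambda>L. G L w) \<longlongrightarrow> f w) at_top"
    using AE_lborel_singleton[of "0::real"] AE_lborel_singleton[of w0] AE_lborel_singleton[of "-w0"]
  proof eventually_elim
    fix w assume w: "w \<noteq> 0" "w \<noteq> w0" "w \<noteq> - w0"
    consider "\<bar>w\<bar> < w0" | "\<bar>w\<bar> > w0" using w by fastforce
    then show "((\<lambda>L. G L w) \<longlongrightarrow> f w) at_top"
    proof cases
      case 1
      define \<delta> where "\<delta> = 1 - \<alpha> / 2 - w^2 / (2 * \<sigma>^2)"
      have "w^2 < w0^2" using 1 w01 power_strict_mono[of "\<bar>w\<bar>" w0 2] by simp
      then have d: "\<delta> > 0" using w0sq par unfolding \<delta>_def by (metis diff_gt_0_iff_gt divide_strict_right_mono zero_less_mult_iff zero_less_numeral zero_less_power)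
      have "((\<lambda>L. G L w) \<longlongrightarrow> 0) at_top"
      proof (rule Lim_null_comparison)
        show "\<forall>\<^sub>F L in at_top. norm (G L w) \<le> 2 * N * r * CA * CB * (L powr ((1 + \<alpha>) / 2) * exp (- (\<delta> * L)))"
          using q1 CA(2) CB(2) eventually_ge_at_top[of 0]
          by eventually_elim (use small in \<open>simp add: \<delta>_def\<close>)
        have "((\<lambda>L. L powr ((1 + \<alpha>) / 2) * exp (- (\<delta> * L))) \<longlongrightarrow> 0) at_top"
          using d by real_asymp
        then show "((\<lambda>L. 2 * N * r * CA * CB * (L powr ((1 + \<alpha>) / 2) * exp (- (\<delta> * L)))) \<longlongrightarrow> 0) at_top"
          by (rule tendsto_mult_right_zero)
      qed
      then show ?thesis using 1 by (simp add: f_def)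
    next
      case 2
      define \<delta> where "\<delta> = w^2 / (2 * \<sigma>^2) - (1 - \<alpha> / 2)"
      have "w0^2 < w^2" using 2 w01 power_strict_mono[of w0 "\<bar>w\<bar>" 2] by simp
      then have d: "\<delta> > 0" using w0sq par unfolding \<delta>_def by (metis diff_gt_0_iff_gt divide_strict_right_mono zero_less_mult_iff zero_less_numeral zero_less_power)
      let ?p = "\<lambda>L. tail_weight \<alpha> L w"
      have "((\<lambda>L. \<bar>w\<bar> powr (1 + \<alpha>) / (N * r) * (L powr ((1 + \<alpha>) / 2) * exp (- (\<delta> * L)))) \<longlongrightarrow> 0) at_top"
        by (rule tendsto_mult_right_zero) (use d in real_asymp)
      then have g0: "((\<lambda>L. normal_density 0 \<sigma> (sqrt L * w) * ?p L / s L) \<longlongrightarrow> 0) at_top"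
      proof (rule Lim_transform_eventually)
        show "\<forall>\<^sub>F L in at_top. \<bar>w\<bar> powr (1 + \<alpha>) / (N * r) * (L powr ((1 + \<alpha>) / 2) * exp (- (\<delta> * L)))
            = normal_density 0 \<sigma> (sqrt L * w) * ?p L / s L"
          using eventually_gt_at_top[of 0]
        proof eventually_elim
          fix L :: real assume L: "L > 0"
          have "exp (- (\<delta> * L)) = exp (- (w^2 / (2 * \<sigma>^2) * L)) / exp (- ((1 - \<alpha> / 2) * L))"
            by (simp add: exp_diff[symmetric] \<delta>_def left_diff_distrib)
          then show "\<bar>w\<bar> powr (1 + \<alpha>) / (N * r) * (L powr ((1 + \<alpha>) / 2) * exp (- (\<delta> * L)))
            = normal_density 0 \<sigma> (sqrt L * w) * ?p L / s L"
            using L par by (simp only: phi[OF less_imp_le[OF L]] pL[OF L] s_def) (simp add: mult_ac)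
        qed
      qed
      have ql: "((\<lambda>L. q L (sqrt L * w) * ?p L / s L) \<longlongrightarrow> \<alpha>) at_top"
        using tendsto_add[OF q3[OF w(1)] g0] by (simp add: diff_divide_distrib left_diff_distrib)
      have Al: "((\<lambda>L. A L (sqrt L * w) * ?p L) \<longlongrightarrow> a) at_top" and Bl: "((\<lambda>L. B L (sqrt L * w) * ?p L) \<longlongrightarrow> b) at_top"
        using A B w(1) by (auto simp: score_profile_def)
      have "((\<lambda>L. (A L (sqrt L * w) * ?p L) * (B L (sqrt L * w) * ?p L) / (q L (sqrt L * w) * ?p L / s L) * \<bar>w\<bar> powr (- 1 - \<alpha>))
          \<longlongrightarrow> a * b / \<alpha> * \<bar>w\<bar> powr (- 1 - \<alpha>)) at_top"
        using par by (intro tendsto_intros Al Bl ql) auto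
      then have "((\<lambda>L. G L w) \<longlongrightarrow> a * b / \<alpha> * \<bar>w\<bar> powr (- 1 - \<alpha>)) at_top"
      proof (rule Lim_transform_eventually)
        show "\<forall>\<^sub>F L in at_top. (A L (sqrt L * w) * ?p L) * (B L (sqrt L * w) * ?p L) / (q L (sqrt L * w) * ?p L / s L) * \<bar>w\<bar> powr (- 1 - \<alpha>)
            = G L w"
          using eventually_gt_at_top[of 0]
        proof eventually_elim
          fix L :: real assume L: "L > 0"
          \<comment> \<open>The weight P occurs twice above and once below, so one copy survives; it
            splits into the power of L contained in \<open>G\<close> and a power of |w| that v
            cancels.\<close>
          have e: "x * P * (y * P) / (z * P / t) * v = l * (t * x * y / z)" if "P = l * u" "u * v = 1" "P \<noteq> 0" for x y z t v P l u :: real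
            using that by (cases "z = 0"; cases "t = 0") (simp_all add: field_simps)
          have "\<bar>w\<bar> powr (1 + \<alpha>) * \<bar>w\<bar> powr (- 1 - \<alpha>) = 1"
            using w(1) by (simp flip: powr_add)
          from e[OF pL[OF L] this] show "(A L (sqrt L * w) * ?p L) * (B L (sqrt L * w) * ?p L) / (q L (sqrt L * w) * ?p L / s L) * \<bar>w\<bar> powr (- 1 - \<alpha>)
            = G L w"
            using L w(1) by (simp add: G_def)
        qed
      qed
      then show ?thesis using 2 by (simp add: f_def)
    qed
  qed

  have C2: "C2 \<ge> 0" using CA CB par by (simp add: C2_def)
  \<comment> \<open>For |w| < w1 = w0/2 the Gaussian rate is at most a quarter of 1 - \<alpha>/2, so
    three quarters of the decay remain and the integrand is eventually below 1.\<close>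
  have "((\<lambda>L. 2 * N * r * CA * CB * (L powr ((1 + \<alpha>) / 2) * exp (- (3 / 4 * (1 - \<alpha> / 2) * L)))) \<longlongrightarrow> 0) at_top"
    by (rule tendsto_mult_right_zero) (use par in real_asymp)
  then have inner: "\<forall>\<^sub>F L in at_top. 2 * N * r * CA * CB * (L powr ((1 + \<alpha>) / 2) * exp (- (3 / 4 * (1 - \<alpha> / 2) * L))) < 1"
    by (rule order_tendstoD) simp
  \<comment> \<open>From such L on, every |w| >= w1 lies beyond all three thresholds, so the tail
    bounds apply on the whole complement of the core.\<close>
  have sq: "\<forall>\<^sub>F L in at_top. sqrt L * w1 \<ge> Max {R, RA, RB}"
  proof -
    have "filterlim (\<lambda>L. sqrt L * w1) at_top at_top" using w01 by real_asymp
    then show ?thesis by (simp only: filterlim_at_top)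
  qed
  have bound: "\<forall>\<^sub>F L in at_top. AE w in lborel. norm (G L w) \<le> W w"
    using q1 q2 CA(2,3) CB(2,3) inner sq eventually_gt_at_top[of 0]
  proof eventually_elim
    fix L assume L: "\<forall>y. normal_density 0 \<sigma> y / 2 \<le> q L y" "\<forall>y. R \<le> \<bar>y\<bar> \<longrightarrow> \<kappa> * s L \<le> q L y * \<bar>y\<bar> powr (1 + \<alpha>)"
      "\<forall>y. \<bar>A L y\<bar> \<le> CA" "\<forall>w. RA \<le> sqrt L * \<bar>w\<bar> \<longrightarrow> \<bar>A L (sqrt L * w)\<bar> * tail_weight \<alpha> L w \<le> CA * (1 + \<bar>w\<bar> powr \<eta>)"
      "\<forall>y. \<bar>B L y\<bar> \<le> CB" "\<forall>w. RB \<le> sqrt L * \<bar>w\<bar> \<longrightarrow> \<bar>B L (sqrt L * w)\<bar> * tail_weight \<alpha> L w \<le> CB * (1 + \<bar>w\<bar> powr \<eta>)"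
      "2 * N * r * CA * CB * (L powr ((1 + \<alpha>) / 2) * exp (- (3 / 4 * (1 - \<alpha> / 2) * L))) < 1"
      "sqrt L * w1 \<ge> Max {R, RA, RB}" "L > 0"
    show "AE w in lborel. norm (G L w) \<le> W w"
    proof (rule AE_I2)
      fix w
      show "norm (G L w) \<le> W w"
      proof (cases "\<bar>w\<bar> < w1")
        case True
        have "w^2 / (2 * \<sigma>^2) \<le> w1^2 / (2 * \<sigma>^2)"
          using True power_mono[of "\<bar>w\<bar>" w1 2] by (intro divide_right_mono) auto
        also have "\<dots> = 1 / 4 * (1 - \<alpha> / 2)" unfolding w0sq[symmetric] by (simp add: w1_def power_divide)
        finally have "3 / 4 * (1 - \<alpha> / 2) * L \<le> (1 - \<alpha> / 2 - w^2 / (2 * \<sigma>^2)) * L"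
          using L(9) by (intro mult_right_mono) auto
        then have "2 * N * r * CA * CB * (L powr ((1 + \<alpha>) / 2) * exp (- ((1 - \<alpha> / 2 - w^2 / (2 * \<sigma>^2)) * L)))
            \<le> 2 * N * r * CA * CB * (L powr ((1 + \<alpha>) / 2) * exp (- (3 / 4 * (1 - \<alpha> / 2) * L)))"
          using N par CA(1) CB(1) by (intro mult_left_mono) auto
        then have "\<bar>G L w\<bar> \<le> 1" using small[OF less_imp_le[OF L(9)] L(1) L(3) L(5), of w] L(7) by linarith
        moreover have "W w = 1" using True by (auto simp: W_def indicator_def)
        ultimately show ?thesis by simp
      next
        case False
        let ?y = "sqrt L * w" and ?P = "tail_weight \<alpha> L w"
        have w: "w1 \<le> \<bar>w\<bar>" "w \<noteq> 0" using False w01 by auto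
        have "sqrt L * w1 \<le> sqrt L * \<bar>w\<bar>" using w L(9) by (intro mult_left_mono) auto
        then have Rs: "R \<le> sqrt L * \<bar>w\<bar>" "RA \<le> sqrt L * \<bar>w\<bar>" "RB \<le> sqrt L * \<bar>w\<bar>" using L(8) by auto
        have ay: "\<bar>?y\<bar> = sqrt L * \<bar>w\<bar>" using L(9) by (simp add: abs_mult)
        have P: "?P > 0" using w L(9) by simp
        have qb: "\<kappa> * s L \<le> q L ?y * ?P" using L(2)[rule_format, of ?y] Rs(1) unfolding ay by simp
        have qp: "q L ?y > 0" using L(1)[rule_format, of ?y] normal_density_pos[OF par(1), of 0 ?y] by linarith
        have "\<bar>G L w\<bar> = L powr ((1 + \<alpha>) / 2) * (s L * \<bar>A L ?y\<bar> * \<bar>B L ?y\<bar> / q L ?y)"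
          using s_pos[of L] qp by (simp add: G_def abs_mult)
        also have "\<dots> = L powr ((1 + \<alpha>) / 2) / ?P * (s L * ((\<bar>A L ?y\<bar> * ?P) * (\<bar>B L ?y\<bar> * ?P)) / (q L ?y * ?P))"
          using P qp by (simp add: field_simps)
        also have "L powr ((1 + \<alpha>) / 2) / ?P = \<bar>w\<bar> powr (- 1 - \<alpha>)"
          using L(9) w powr_minus_divide[of "\<bar>w\<bar>" "1 + \<alpha>"] by (simp add: pL)
        also have "s L * ((\<bar>A L ?y\<bar> * ?P) * (\<bar>B L ?y\<bar> * ?P)) / (q L ?y * ?P)
            \<le> s L * ((CA * (1 + \<bar>w\<bar> powr \<eta>)) * (CB * (1 + \<bar>w\<bar> powr \<eta>))) / (\<kappa> * s L)"
        proof (rule frac_le)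
          have ab: "\<bar>A L ?y\<bar> * ?P \<le> CA * (1 + \<bar>w\<bar> powr \<eta>)" "\<bar>B L ?y\<bar> * ?P \<le> CB * (1 + \<bar>w\<bar> powr \<eta>)"
            using L(4,6) Rs by auto
          have "(\<bar>A L ?y\<bar> * ?P) * (\<bar>B L ?y\<bar> * ?P) \<le> (CA * (1 + \<bar>w\<bar> powr \<eta>)) * (CB * (1 + \<bar>w\<bar> powr \<eta>))"
            using CA(1) by (intro mult_mono[OF ab]) (auto intro!: mult_nonneg_nonneg)
          then show "s L * ((\<bar>A L ?y\<bar> * ?P) * (\<bar>B L ?y\<bar> * ?P)) \<le> s L * ((CA * (1 + \<bar>w\<bar> powr \<eta>)) * (CB * (1 + \<bar>w\<bar> powr \<eta>)))"
            using s_pos[of L] by (intro mult_left_mono) auto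
          show "0 < \<kappa> * s L" using s_pos[of L] par by simp
        qed (use qb CA(1) CB(1) s_pos[of L] in \<open>auto intro!: mult_nonneg_nonneg\<close>)
        also have "\<dots> = CA * CB / \<kappa> * (1 + \<bar>w\<bar> powr \<eta>)^2"
          using s_pos[of L] par by (simp add: field_simps power2_eq_square)
        also have "\<dots> \<le> CA * CB / \<kappa> * ((w1 powr - \<eta> + 1) * \<bar>w\<bar> powr \<eta>)^2"
        proof (intro mult_left_mono power_mono)
          have "1 = w1 powr - \<eta> * w1 powr \<eta>" using w01 by (simp flip: powr_add)
          also have "\<dots> \<le> w1 powr - \<eta> * \<bar>w\<bar> powr \<eta>" using w w01 par by (intro mult_left_mono powr_mono2) auto
          finally show "1 + \<bar>w\<bar> powr \<eta> \<le> (w1 powr - \<eta> + 1) * \<bar>w\<bar> powr \<eta>" by (simp add: ring_distribs)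
        qed (use par CA(1) CB(1) in auto)
        also have "\<dots> = C2 * \<bar>w\<bar> powr (2 * \<eta>)"
        proof -
          have "(\<bar>w\<bar> powr \<eta>)^2 = \<bar>w\<bar> powr (2 * \<eta>)" by (simp add: power2_eq_square flip: powr_add)
          then show ?thesis by (simp add: C2_def power_mult_distrib)
        qed
        finally have "\<bar>G L w\<bar> \<le> \<bar>w\<bar> powr (- 1 - \<alpha>) * (C2 * \<bar>w\<bar> powr (2 * \<eta>))"
          by (simp add: mult_left_mono)
        also have "\<dots> = C2 * \<bar>w\<bar> powr (2 * \<eta> - 1 - \<alpha>)"
          by (simp add: mult.left_commute powr_add[symmetric] algebra_simps)
        also have "\<dots> \<le> W w" using w by (simp add: W_def)
        finally show ?thesis by simp
      qed
    qed
  qed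

  have f: "has_bochner_integral lborel f (a * b / \<alpha> * (- 2 * w0 powr (- 1 - \<alpha> + 1) / (- 1 - \<alpha> + 1)))"
    unfolding f_def using par w01 by (intro has_bochner_integral_mult_right powr_tail_integral) auto
  have Wi: "integrable lborel W"
    unfolding W_def using par w01 powr_tail_integral[of "2 * \<eta> - 1 - \<alpha>" w1]
    by (intro Bochner_Integration.integrable_add integrable_mult_right) (auto simp: has_bochner_integral_iff)
  have main: "((\<lambda>L. integral\<^sup>L lborel (G L)) \<longlongrightarrow> integral\<^sup>L lborel f) at_top"
  proof (rule integral_dominated_convergence_at_top[OF _ _ Wi lim bound])
    show "f \<in> borel_measurable lborel" using f by (blast dest: has_bochner_integral_integrable borel_measurable_has_bochner_integral)
    show "G L \<in> borel_measurable lborel" for L unfolding G_def by measurable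
  qed
  have "integral\<^sup>L lborel f = 2 * a * b / (\<alpha>^2 * w0 powr \<alpha>)"
    using f par w01 by (simp add: has_bochner_integral_iff powr_minus power2_eq_square field_simps)
  with main have "((\<lambda>L. integral\<^sup>L lborel (G L)) \<longlongrightarrow> 2 * a * b / (\<alpha>^2 * w0 powr \<alpha>)) at_top" by simp
  then show ?thesis unfolding w0_def
  proof (rule Lim_transform_eventually)
    show "\<forall>\<^sub>F L in at_top. integral\<^sup>L lborel (G L) = L powr (\<alpha> / 2) * (\<integral>y. s L * A L y * B L y / q L y \<partial>lborel)"
      using eventually_gt_at_top[of 0]
    proof eventually_elim
      fix L :: real assume L: "L > 0"
      have "(\<integral>y. s L * A L y * B L y / q L y \<partial>lborel)
          = \<bar>sqrt L\<bar> *\<^sub>R (\<integral>w. s L * A L (0 + sqrt L * w) * B L (0 + sqrt L * w) / q L (0 + sqrt L * w) \<partial>lborel)"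
        using L by (intro lborel_integral_real_affine) auto
      moreover have "L powr ((1 + \<alpha>) / 2) = L powr (\<alpha> / 2) * sqrt L"
        using L by (simp add: powr_half_sqrt[symmetric] add_divide_distrib add.commute flip: powr_add)
      ultimately show "integral\<^sup>L lborel (G L) = L powr (\<alpha> / 2) * (\<integral>y. s L * A L y * B L y / q L y \<partial>lborel)"
        unfolding G_def using L by (simp only: integral_mult_right_zero) simp
    qed
  qed
qed

section \<open>Density and scores at small times\<close>

text \<open>The intermediate point depends on y, which is why the tail of the derivative has to be
  uniform in \<mu>.\<close>

lemma osc_integral_mean_value:
  assumes "\<sigma> > 0" "\<alpha> > 0" "\<mu> > 0"
  shows "\<exists>\<xi>\<in>{0<..<\<mu>}. osc_integral (\<lambda>_. 1) \<sigma> \<alpha> \<mu> y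
    = pi * normal_density 0 \<sigma> y - \<mu> * osc_integral (\<lambda>v. v powr \<alpha>) \<sigma> \<alpha> \<xi> y"
proof -
  have "\<exists>\<xi>\<in>{0<..<\<mu>}. osc_integral (\<lambda>_. 1) \<sigma> \<alpha> \<mu> y - osc_integral (\<lambda>_. 1) \<sigma> \<alpha> 0 y
      = (\<mu> - 0) * - osc_integral (\<lambda>v. v powr \<alpha>) \<sigma> \<alpha> \<xi> y"
  proof -
    have "\<exists>\<xi>\<in>{0<..<\<mu>}. osc_integral (\<lambda>_. 1) \<sigma> \<alpha> \<mu> y - osc_integral (\<lambda>_. 1) \<sigma> \<alpha> 0 y
      = (\<lambda>d. - osc_integral (\<lambda>v. v powr \<alpha>) \<sigma> \<alpha> \<xi> y * d) (\<mu> - 0)"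
    proof (rule mvt_simple[OF assms(3)])
      fix \<xi> assume "0 \<le> \<xi>" "\<xi> \<le> \<mu>"
      then have "((\<lambda>\<mu>. osc_integral (\<lambda>_. 1) \<sigma> \<alpha> \<mu> y) has_real_derivative
          - osc_integral (\<lambda>v. v powr \<alpha>) \<sigma> \<alpha> \<xi> y) (at \<xi> within {0..\<mu>})"
        using assms by (intro DERIV_subset[OF osc_integral_deriv_scale]) auto
      then show "((\<lambda>\<mu>. osc_integral (\<lambda>_. 1) \<sigma> \<alpha> \<mu> y) has_derivative
          (\<lambda>d. - osc_integral (\<lambda>v. v powr \<alpha>) \<sigma> \<alpha> \<xi> y * d)) (at \<xi> within {0..\<mu>})"
        by (rule has_field_derivative_imp_has_derivative)
    qed
    then show ?thesis by (simp only: mult.commute)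
  qed
  then show ?thesis using osc_integral_gaussian[OF assms(1), of \<alpha> y] by (auto simp: algebra_simps)
qed

locale stable_perturbation =
  fixes \<sigma> r \<alpha> :: real
  assumes par: "\<sigma> > 0" "r > 0" "0 < \<alpha>" "\<alpha> < 2"
begin

abbreviation \<phi> :: "real \<Rightarrow> real" where
  "\<phi> \<equiv> normal_density 0 \<sigma>"

abbreviation powr_osc :: "real \<Rightarrow> real \<Rightarrow> real" where
  "powr_osc \<equiv> osc_integral (\<lambda>v. v powr \<alpha>) \<sigma> \<alpha>"

abbreviation log_osc :: "real \<Rightarrow> real \<Rightarrow> real" where
  "log_osc \<equiv> osc_integral (\<lambda>v. v powr \<alpha> * ln v) \<sigma> \<alpha>"

text \<open>With \<open>L = ln (1/h)\<close> this is \<open>r h^(1-\<alpha>/2)\<close>.\<close>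

definition scale :: "real \<Rightarrow> real" where
  "scale L = r * exp (- ((1 - \<alpha> / 2) * L))"

abbreviation intensity :: "real \<Rightarrow> real" where
  "intensity L \<equiv> stable_const \<alpha> * scale L"

text \<open>The density of the observation divided by sqrt h, at h = exp (-L); compare
  \<open>model_eq_dens\<close>.\<close>

definition dens :: "real \<Rightarrow> real \<Rightarrow> real" where
  "dens L y = osc_integral (\<lambda>_. 1) \<sigma> \<alpha> (intensity L) y / pi"

definition kernel :: "real \<Rightarrow> real \<Rightarrow> real" where
  "kernel L y = powr_osc (intensity L) y"

definition log_kernel :: "real \<Rightarrow> real \<Rightarrow> real" where
  "log_kernel L y = log_osc (intensity L) y"

lemma scale_pos: "scale L > 0"
  using par by (simp add: scale_def)

lemma constant_pos: "stable_const \<alpha> > 0"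
  using par by (intro stable_const_pos) auto

lemma intensity_pos: "intensity L > 0"
  using scale_pos constant_pos by simp

lemma measurable_kernels [measurable]:
  "dens L \<in> borel_measurable borel" "kernel L \<in> borel_measurable borel" "log_kernel L \<in> borel_measurable borel"
  unfolding dens_def[abs_def] kernel_def[abs_def] log_kernel_def[abs_def] by measurable

text \<open>Minus the coefficient of |y|^(-1-\<alpha>) in the tail of
  \<open>powr_osc\<close>.\<close>

definition tail :: real where
  "tail = sin (pi * \<alpha> / 2) * Gamma (1 + \<alpha>)"

text \<open>Gamma and sine cancel. Hence -(\<open>stable_const\<close>/pi) times
  \<open>powr_osc\<close>, the slope of the density in the scale, has exactly the tail \<alpha>
  |y|^(-1-\<alpha>) of the Levy density with r = 1.\<close>

lemma constant_tail: "stable_const \<alpha> * tail = \<alpha> * pi"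
proof -
  have "sin (pi * \<alpha> / 2) > 0" using par by (intro sin_gt_zero) (auto simp: field_simps)
  moreover have "Gamma (1 + \<alpha>) > 0" using par by (intro Gamma_real_pos) auto
  ultimately show ?thesis by (simp add: stable_const_def tail_def)
qed

lemma scale_tendsto: "(scale \<longlongrightarrow> 0) at_top"
proof -
  have "1 - \<alpha> / 2 > 0" using par by simp
  then show ?thesis unfolding scale_def[abs_def] by real_asymp
qed

lemma intensity_small: "\<epsilon> > 0 \<Longrightarrow> \<forall>\<^sub>F L in at_top. intensity L < \<epsilon>"
  by (rule order_tendstoD[OF tendsto_mult_right_zero[OF scale_tendsto]])

section \<open>Uniform tails of the kernels and of the density\<close>

lemma kernel_bounded: "\<exists>C\<ge>0. \<forall>\<mu>\<ge>0. \<forall>y. \<bar>powr_osc \<mu> y\<bar> \<le> C"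
  by (rule osc_integral_bounded[where K=1 and a=\<alpha> and b=\<alpha>]) (use par in auto)

lemma log_kernel_bounded: "\<exists>C\<ge>0. \<forall>\<mu>\<ge>0. \<forall>y. \<bar>log_osc \<mu> y\<bar> \<le> C"
proof (rule osc_integral_bounded[where K="1 / (\<alpha> / 4)" and a="\<alpha> - \<alpha> / 4" and b="\<alpha> + \<alpha> / 4"])
  show "\<bar>v powr \<alpha> * ln v\<bar> \<le> 1 / (\<alpha> / 4) * (v powr (\<alpha> - \<alpha> / 4) + v powr (\<alpha> + \<alpha> / 4))" if "v > 0" for v
    using powr_abs_ln_le[OF that, of "\<alpha> / 4" \<alpha>] par by (simp only: abs_mult abs_of_nonneg[OF powr_ge_zero])
qed (use par in auto)

lemma kernel_asymp:
  obtains C where "C \<ge> 0"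
    "\<And>\<mu> y. 0 \<le> \<mu> \<Longrightarrow> \<mu> \<le> 1 \<Longrightarrow> 1 \<le> \<bar>y\<bar> \<Longrightarrow>
      \<bar>powr_osc \<mu> y * \<bar>y\<bar> powr (1 + \<alpha>) + tail\<bar> \<le> C * \<bar>y\<bar> powr - \<alpha>"
proof -
  obtain C where C: "C \<ge> 0" "\<And>\<mu> y. \<mu> \<in> {0..1} \<Longrightarrow> 1 \<le> y \<Longrightarrow>
    \<bar>powr_osc \<mu> y + tail * y powr (- 1 - \<alpha>)\<bar> \<le> C * y powr (- 1 - 2 * \<alpha>)"
    using osc_integral_powr_asymp[OF par(1,3,4)] unfolding tail_def by blast
  show ?thesis
  proof (rule that[OF C(1)])
    fix \<mu> y :: real assume "0 \<le> \<mu>" "\<mu> \<le> 1" and y: "1 \<le> \<bar>y\<bar>"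
    then have le: "\<bar>powr_osc \<mu> y + tail * \<bar>y\<bar> powr (- 1 - \<alpha>)\<bar> \<le> C * \<bar>y\<bar> powr (- 1 - 2 * \<alpha>)"
      using C(2)[of \<mu> "\<bar>y\<bar>"] by (simp add: osc_integral_abs)
    let ?P = "\<bar>y\<bar> powr (1 + \<alpha>)"
    have one: "\<bar>y\<bar> powr (- 1 - \<alpha>) * ?P = 1" using y by (simp flip: powr_add)
    have "powr_osc \<mu> y * ?P + tail
        = (powr_osc \<mu> y + tail * \<bar>y\<bar> powr (- 1 - \<alpha>)) * ?P"
      using one by (simp add: distrib_right mult.assoc)
    then have "\<bar>powr_osc \<mu> y * ?P + tail\<bar> \<le> C * \<bar>y\<bar> powr (- 1 - 2 * \<alpha>) * ?P"
      using mult_right_mono[OF le, of ?P] by (simp add: abs_mult)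
    also have "\<dots> = C * \<bar>y\<bar> powr - \<alpha>" by (simp add: mult.assoc flip: powr_add)
    finally show "\<bar>powr_osc \<mu> y * ?P + tail\<bar> \<le> C * \<bar>y\<bar> powr - \<alpha>" .
  qed
qed

text \<open>When the intensity is at most 1, the intermediate point of the mean value theorem stays
  in (0,1), where \<open>kernel_asymp\<close> is uniform.\<close>

lemma dens_asymp:
  obtains C where "C \<ge> 0"
    "\<And>L y. intensity L \<le> 1 \<Longrightarrow> 1 \<le> \<bar>y\<bar> \<Longrightarrow>
      \<bar>(dens L y - \<phi> y) * \<bar>y\<bar> powr (1 + \<alpha>) / scale L - \<alpha>\<bar> \<le> C * \<bar>y\<bar> powr - \<alpha>"
proof -
  obtain C where C: "C \<ge> 0"
    "\<And>\<mu> y. 0 \<le> \<mu> \<Longrightarrow> \<mu> \<le> 1 \<Longrightarrow> 1 \<le> \<bar>y\<bar> \<Longrightarrow>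
      \<bar>powr_osc \<mu> y * \<bar>y\<bar> powr (1 + \<alpha>) + tail\<bar> \<le> C * \<bar>y\<bar> powr - \<alpha>"
    using kernel_asymp by blast
  let ?c = "stable_const \<alpha>"
  show ?thesis
  proof (rule that[of "?c / pi * C"])
    show "0 \<le> ?c / pi * C" using C(1) constant_pos by simp
    fix L y :: real assume L: "?c * scale L \<le> 1" and y: "1 \<le> \<bar>y\<bar>"
    obtain \<xi> where \<xi>: "\<xi> \<in> {0<..<?c * scale L}"
      "osc_integral (\<lambda>_. 1) \<sigma> \<alpha> (?c * scale L) y = pi * \<phi> y
         - ?c * scale L * powr_osc \<xi> y"
      using osc_integral_mean_value[OF par(1,3) intensity_pos] by blast
    let ?k = "powr_osc \<xi> y" and ?P = "\<bar>y\<bar> powr (1 + \<alpha>)"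
    have "(dens L y - \<phi> y) * ?P / scale L = - (?c / pi * (?k * ?P))"
      unfolding dens_def \<xi>(2) using scale_pos[of L] by (simp add: field_simps)
    moreover have "\<alpha> = ?c / pi * tail" using constant_tail by (simp add: field_simps)
    ultimately have "(dens L y - \<phi> y) * ?P / scale L - \<alpha> = - (?c / pi * (?k * ?P + tail))"
      by (simp add: ring_distribs)
    then have "\<bar>(dens L y - \<phi> y) * ?P / scale L - \<alpha>\<bar> = ?c / pi * \<bar>?k * ?P + tail\<bar>"
      using constant_pos by (simp add: abs_mult)
    also have "\<dots> \<le> ?c / pi * (C * \<bar>y\<bar> powr - \<alpha>)"
      using C(2)[of \<xi> y] \<xi>(1) L y constant_pos by (intro mult_left_mono) auto
    finally show "\<bar>(dens L y - \<phi> y) * ?P / scale L - \<alpha>\<bar> \<le> ?c / pi * C * \<bar>y\<bar> powr - \<alpha>"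
      by (simp only: mult.assoc)
  qed
qed

lemma sqrt_scaled_at_top: "w \<noteq> 0 \<Longrightarrow> filterlim (\<lambda>L. sqrt L * \<bar>w\<bar>) at_top at_top"
  by (intro filterlim_at_top_mult_tendsto_pos[OF tendsto_const] sqrt_at_top) auto

lemma sqrt_scaled_powr_tendsto:
  assumes "w \<noteq> 0"
  shows "((\<lambda>L. C * (sqrt L * \<bar>w\<bar>) powr - \<alpha>) \<longlongrightarrow> 0) at_top"
  by (rule tendsto_mult_right_zero[OF tendsto_neg_powr[OF _ sqrt_scaled_at_top[OF assms]]]) (use par in simp)

lemma dens_limit:
  assumes "w \<noteq> 0"
  shows "((\<lambda>L. (dens L (sqrt L * w) - \<phi> (sqrt L * w)) * tail_weight \<alpha> L w / scale L) \<longlongrightarrow> \<alpha>) at_top"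
proof -
  obtain C where C: "\<And>L y. intensity L \<le> 1 \<Longrightarrow> 1 \<le> \<bar>y\<bar> \<Longrightarrow>
      \<bar>(dens L y - \<phi> y) * \<bar>y\<bar> powr (1 + \<alpha>) / scale L - \<alpha>\<bar> \<le> C * \<bar>y\<bar> powr - \<alpha>"
    using dens_asymp by blast
  have big: "\<forall>\<^sub>F L in at_top. 1 \<le> sqrt L * \<bar>w\<bar>"
    using sqrt_scaled_at_top[OF assms] unfolding filterlim_at_top by blast
  show ?thesis
  proof (rule LIM_zero_cancel, rule Lim_null_comparison[OF _ sqrt_scaled_powr_tendsto[OF assms, of C]])
    show "\<forall>\<^sub>F L in at_top. norm ((dens L (sqrt L * w) - \<phi> (sqrt L * w)) * tail_weight \<alpha> L w / scale L - \<alpha>)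
        \<le> C * (sqrt L * \<bar>w\<bar>) powr - \<alpha>"
      using big intensity_small[OF zero_less_one] eventually_ge_at_top[of 0]
    proof eventually_elim
      fix L :: real assume L: "1 \<le> sqrt L * \<bar>w\<bar>" "intensity L < 1" "0 \<le> L"
      have "\<bar>sqrt L * w\<bar> = sqrt L * \<bar>w\<bar>" using L by (simp add: abs_mult)
      then show "norm ((dens L (sqrt L * w) - \<phi> (sqrt L * w)) * tail_weight \<alpha> L w / scale L - \<alpha>)
        \<le> C * (sqrt L * \<bar>w\<bar>) powr - \<alpha>"
        using C[of L "sqrt L * w"] L by simp
    qed
  qed
qed

text \<open>Beyond R the perturbation itself is positive and at least half its leading term. On |y|
  < R the Gaussian density is at least its value at R, while the perturbation is bounded uniformly
  by a multiple of the intensity, which tends to 0.\<close>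

lemma dens_lower:
  obtains R where "\<forall>\<^sub>F L in at_top. \<forall>y. \<phi> y / 2 \<le> dens L y"
    "\<forall>\<^sub>F L in at_top. \<forall>y. R \<le> \<bar>y\<bar> \<longrightarrow> \<alpha> / 2 * scale L \<le> dens L y * \<bar>y\<bar> powr (1 + \<alpha>)"
proof -
  let ?c = "stable_const \<alpha>"
  obtain C where C: "C \<ge> 0" "\<And>L y. ?c * scale L \<le> 1 \<Longrightarrow> 1 \<le> \<bar>y\<bar> \<Longrightarrow>
      \<bar>(dens L y - \<phi> y) * \<bar>y\<bar> powr (1 + \<alpha>) / scale L - \<alpha>\<bar> \<le> C * \<bar>y\<bar> powr - \<alpha>"
    using dens_asymp by blast
  have "((\<lambda>y. C * y powr - \<alpha>) \<longlongrightarrow> 0) at_top"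
    using par by (intro tendsto_mult_right_zero tendsto_neg_powr filterlim_ident) auto
  then have "\<forall>\<^sub>F y in at_top. C * y powr - \<alpha> < \<alpha> / 2"
    by (rule order_tendstoD(2)) (use par in simp)
  then obtain R0 where R0: "\<And>y. y \<ge> R0 \<Longrightarrow> C * y powr - \<alpha> < \<alpha> / 2"
    unfolding eventually_at_top_linorder by blast
  define R where "R = max 1 R0"
  obtain K where K: "K \<ge> 0" "\<And>\<mu> y. \<mu> \<ge> 0 \<Longrightarrow> \<bar>powr_osc \<mu> y\<bar> \<le> K"
    using kernel_bounded by blast
  have far: "\<alpha> / 2 * scale L \<le> (dens L y - \<phi> y) * \<bar>y\<bar> powr (1 + \<alpha>)"
    if "?c * scale L \<le> 1" "R \<le> \<bar>y\<bar>" for L y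
  proof -
    have "\<bar>(dens L y - \<phi> y) * \<bar>y\<bar> powr (1 + \<alpha>) / scale L - \<alpha>\<bar> \<le> \<alpha> / 2"
      using C(2)[of L y] R0[of "\<bar>y\<bar>"] that by (simp add: R_def)
    then have "\<alpha> / 2 \<le> (dens L y - \<phi> y) * \<bar>y\<bar> powr (1 + \<alpha>) / scale L"
      by linarith
    then show ?thesis using scale_pos[of L] by (simp only: pos_le_divide_eq)
  qed
  have phiR: "\<phi> R > 0" by (rule normal_density_pos[OF par(1)])
  have "((\<lambda>L. K / pi * (?c * scale L)) \<longlongrightarrow> 0) at_top"
    by (intro tendsto_mult_right_zero scale_tendsto)
  then have near: "\<forall>\<^sub>F L in at_top. K / pi * (?c * scale L) < \<phi> R / 2"
    by (rule order_tendstoD(2)) (use phiR in simp)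
  show ?thesis
  proof (rule that[of R])
    show "\<forall>\<^sub>F L in at_top. \<forall>y. R \<le> \<bar>y\<bar> \<longrightarrow> \<alpha> / 2 * scale L \<le> dens L y * \<bar>y\<bar> powr (1 + \<alpha>)"
      using intensity_small[OF zero_less_one]
    proof eventually_elim
      fix L assume L: "?c * scale L < 1"
      show "\<forall>y. R \<le> \<bar>y\<bar> \<longrightarrow> \<alpha> / 2 * scale L \<le> dens L y * \<bar>y\<bar> powr (1 + \<alpha>)"
      proof (intro allI impI)
        fix y assume "R \<le> \<bar>y\<bar>"
        then have "\<alpha> / 2 * scale L \<le> (dens L y - \<phi> y) * \<bar>y\<bar> powr (1 + \<alpha>)"
          using far L by simp
        also have "\<dots> \<le> dens L y * \<bar>y\<bar> powr (1 + \<alpha>)" by (intro mult_right_mono) auto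
        finally show "\<alpha> / 2 * scale L \<le> dens L y * \<bar>y\<bar> powr (1 + \<alpha>)" .
      qed
    qed
    show "\<forall>\<^sub>F L in at_top. \<forall>y. \<phi> y / 2 \<le> dens L y"
      using intensity_small[OF zero_less_one] near
    proof eventually_elim
      fix L assume L: "?c * scale L < 1" "K / pi * (?c * scale L) < \<phi> R / 2"
      show "\<forall>y. \<phi> y / 2 \<le> dens L y"
      proof
        fix y
        have n: "0 \<le> \<phi> y" by simp
        show "\<phi> y / 2 \<le> dens L y"
        proof (cases "R \<le> \<bar>y\<bar>")
          case True
          have "0 < \<alpha> / 2 * scale L" using par scale_pos[of L] by simp
          also have "\<dots> \<le> (dens L y - \<phi> y) * \<bar>y\<bar> powr (1 + \<alpha>)" using far L True by simp
          finally have "0 < dens L y - \<phi> y"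
            by (rule zero_less_mult_pos2) (use True in \<open>auto simp: R_def\<close>)
          then show ?thesis using n by linarith
        next
          case False
          then have "y^2 \<le> R^2" using power_mono[of "\<bar>y\<bar>" R 2] by simp
          then have mono: "\<phi> R \<le> \<phi> y"
            using par by (simp add: normal_density_def divide_right_mono)
          obtain \<xi> where \<xi>: "\<xi> \<in> {0<..<?c * scale L}"
            "osc_integral (\<lambda>_. 1) \<sigma> \<alpha> (?c * scale L) y = pi * \<phi> y
               - ?c * scale L * powr_osc \<xi> y"
            using osc_integral_mean_value[OF par(1,3) intensity_pos] by blast
          have "?c * scale L * powr_osc \<xi> y \<le> ?c * scale L * K"
            using K(2)[of \<xi> y] \<xi>(1) intensity_pos[of L] by (intro mult_left_mono) auto
          then have "?c * scale L * powr_osc \<xi> y / pi \<le> K / pi * (?c * scale L)"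
            by (simp add: divide_right_mono mult.commute)
          moreover have "dens L y = \<phi> y - ?c * scale L * powr_osc \<xi> y / pi"
            unfolding dens_def \<xi>(2) by (simp add: diff_divide_distrib)
          ultimately show ?thesis using mono L(2) by linarith
        qed
      qed
    qed
  qed
qed

end

section \<open>Normalised scores\<close>

context stable_perturbation
begin

text \<open>The derivative of the density itself, not of its logarithm, with respect to
  \<open>scale L\<close>; the derivative in r carries the further factor
  \<open>scale L / r\<close>.\<close>

definition score_r :: "real \<Rightarrow> real \<Rightarrow> real" where
  "score_r L y = - (stable_const \<alpha> / pi) * kernel L y"

text \<open>The derivative of the density in \<alpha>, divided by \<open>L * scale L\<close>. Here
  \<open>c'\<close> stands for the derivative of \<open>stable_const\<close>, and the term
  \<open>stable_const \<alpha> / 2\<close> comes from differentiating h^(-\<alpha>/2).\<close>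

definition score_\<alpha> :: "real \<Rightarrow> real \<Rightarrow> real \<Rightarrow> real" where
  "score_\<alpha> c' L y =
     - (1 / pi) * ((c' / L + stable_const \<alpha> / 2) * kernel L y + stable_const \<alpha> / L * log_kernel L y)"

lemma kernel_limit:
  assumes "w \<noteq> 0"
  shows "((\<lambda>L. kernel L (sqrt L * w) * tail_weight \<alpha> L w) \<longlongrightarrow> - tail) at_top"
proof -
  obtain C where C: "C \<ge> 0" "\<And>\<mu> y. 0 \<le> \<mu> \<Longrightarrow> \<mu> \<le> 1 \<Longrightarrow> 1 \<le> \<bar>y\<bar> \<Longrightarrow>
      \<bar>powr_osc \<mu> y * \<bar>y\<bar> powr (1 + \<alpha>) + tail\<bar> \<le> C * \<bar>y\<bar> powr - \<alpha>"
    using kernel_asymp by blast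
  have big: "\<forall>\<^sub>F L in at_top. 1 \<le> sqrt L * \<bar>w\<bar>"
    using sqrt_scaled_at_top[OF assms] unfolding filterlim_at_top by blast
  show ?thesis
  proof (rule LIM_zero_cancel, rule Lim_null_comparison[OF _ sqrt_scaled_powr_tendsto[OF assms, of C]])
    show "\<forall>\<^sub>F L in at_top. norm (kernel L (sqrt L * w) * tail_weight \<alpha> L w - - tail) \<le> C * (sqrt L * \<bar>w\<bar>) powr - \<alpha>"
      using big intensity_small[OF zero_less_one] eventually_ge_at_top[of 0]
    proof eventually_elim
      fix L :: real assume L: "1 \<le> sqrt L * \<bar>w\<bar>" "intensity L < 1" "0 \<le> L"
      have "\<bar>sqrt L * w\<bar> = sqrt L * \<bar>w\<bar>" using L by (simp add: abs_mult)
      then show "norm (kernel L (sqrt L * w) * tail_weight \<alpha> L w - - tail) \<le> C * (sqrt L * \<bar>w\<bar>) powr - \<alpha>"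
        using C(2)[of "intensity L" "sqrt L * w"] L intensity_pos[of L] by (simp add: kernel_def)
    qed
  qed
qed

lemma kernel_decay:
  obtains C where "C \<ge> 0"
    "\<And>L y. intensity L \<le> 1 \<Longrightarrow> 1 \<le> \<bar>y\<bar> \<Longrightarrow> \<bar>kernel L y\<bar> * \<bar>y\<bar> powr (1 + \<alpha>) \<le> C"
proof -
  obtain C where C: "C \<ge> 0" "\<And>\<mu> y. 0 \<le> \<mu> \<Longrightarrow> \<mu> \<le> 1 \<Longrightarrow> 1 \<le> \<bar>y\<bar> \<Longrightarrow>
      \<bar>powr_osc \<mu> y * \<bar>y\<bar> powr (1 + \<alpha>) + tail\<bar> \<le> C * \<bar>y\<bar> powr - \<alpha>"
    using kernel_asymp by blast
  show ?thesis
  proof (rule that[of "C + \<bar>tail\<bar>"])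
    fix L y :: real assume L: "intensity L \<le> 1" and y: "1 \<le> \<bar>y\<bar>"
    have "\<bar>y\<bar> powr - \<alpha> \<le> \<bar>y\<bar> powr 0" using y par by (intro powr_mono) auto
    then have "C * \<bar>y\<bar> powr - \<alpha> \<le> C * 1" using C(1) y by (intro mult_left_mono) (auto split: if_splits)
    then have "\<bar>kernel L y * \<bar>y\<bar> powr (1 + \<alpha>) + tail\<bar> \<le> C"
      using C(2)[of "intensity L" y] L y intensity_pos[of L] unfolding kernel_def by linarith
    then have "\<bar>kernel L y * \<bar>y\<bar> powr (1 + \<alpha>)\<bar> \<le> C + \<bar>tail\<bar>" by linarith
    then show "\<bar>kernel L y\<bar> * \<bar>y\<bar> powr (1 + \<alpha>) \<le> C + \<bar>tail\<bar>" by (simp add: abs_mult)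
  qed (use C in simp)
qed

text \<open>The logarithm in the amplitude costs a small power of |y|. The loss \<alpha>/4 is
  admissible, since \<open>information_integral_limit\<close> asks for twice the loss to be below
  \<alpha>.\<close>

lemma log_kernel_decay:
  obtains C where "C \<ge> 0"
    "\<And>L y. 1 \<le> \<bar>y\<bar> \<Longrightarrow> \<bar>log_kernel L y\<bar> * \<bar>y\<bar> powr (1 + \<alpha>) \<le> C * \<bar>y\<bar> powr (\<alpha> / 4)"
proof -
  interpret sector_amplitude "\<lambda>z. z powr of_real \<alpha> * Ln z" "1 / (\<alpha> / 4) + pi" "\<alpha> - \<alpha> / 4" "\<alpha> + \<alpha> / 4"
    using par by (intro sector_amplitude_powr_Ln) auto
  have "\<exists>C\<ge>0. \<forall>\<mu>\<ge>0. \<forall>y\<ge>1. \<bar>log_osc \<mu> y\<bar> \<le> C * y powr (- 1 - (\<alpha> - \<alpha> / 4))"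
  proof (rule osc_integral_decay[OF _ par(1,3,4)])
    show "complex_of_real v powr complex_of_real \<alpha> * Ln (complex_of_real v) = complex_of_real (v powr \<alpha> * ln v)" if "v > 0" for v
      using that by (simp add: powr_of_real Ln_of_real)
  qed (use par in simp)
  then obtain C where C: "C \<ge> 0" "\<And>\<mu> y. \<mu> \<ge> 0 \<Longrightarrow> y \<ge> 1 \<Longrightarrow>
      \<bar>log_osc \<mu> y\<bar> \<le> C * y powr (- 1 - (\<alpha> - \<alpha> / 4))"
    by blast
  show ?thesis
  proof (rule that[OF C(1)])
    fix L y :: real assume y: "1 \<le> \<bar>y\<bar>"
    have "\<bar>log_kernel L y\<bar> \<le> C * \<bar>y\<bar> powr (- 1 - (\<alpha> - \<alpha> / 4))"
      using C(2)[OF less_imp_le[OF intensity_pos[of L]] y] unfolding osc_integral_abs log_kernel_def .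
    then have "\<bar>log_kernel L y\<bar> * \<bar>y\<bar> powr (1 + \<alpha>) \<le> C * \<bar>y\<bar> powr (- 1 - (\<alpha> - \<alpha> / 4)) * \<bar>y\<bar> powr (1 + \<alpha>)"
      by (rule mult_right_mono) simp
    also have "\<dots> = C * \<bar>y\<bar> powr (\<alpha> / 4)" by (simp add: mult.assoc flip: powr_add)
    finally show "\<bar>log_kernel L y\<bar> * \<bar>y\<bar> powr (1 + \<alpha>) \<le> C * \<bar>y\<bar> powr (\<alpha> / 4)" .
  qed
qed

lemma log_kernel_scaled_decay:
  obtains C where "C \<ge> 0"
    "\<And>L w. 1 \<le> L \<Longrightarrow> 1 \<le> sqrt L * \<bar>w\<bar> \<Longrightarrow>
      \<bar>log_kernel L (sqrt L * w)\<bar> * tail_weight \<alpha> L w \<le> C * \<bar>w\<bar> powr (\<alpha> / 4) * L powr (\<alpha> / 8)"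
proof -
  obtain C where C: "C \<ge> 0" "\<And>L y. 1 \<le> \<bar>y\<bar> \<Longrightarrow> \<bar>log_kernel L y\<bar> * \<bar>y\<bar> powr (1 + \<alpha>) \<le> C * \<bar>y\<bar> powr (\<alpha> / 4)"
    using log_kernel_decay by blast
  show ?thesis
  proof (rule that[OF C(1)])
    fix L w :: real assume L: "1 \<le> L" "1 \<le> sqrt L * \<bar>w\<bar>"
    have a: "\<bar>sqrt L * w\<bar> = sqrt L * \<bar>w\<bar>" using L by (simp add: abs_mult)
    have "(sqrt L * \<bar>w\<bar>) powr (\<alpha> / 4) = \<bar>w\<bar> powr (\<alpha> / 4) * L powr (\<alpha> / 8)"
      using L by (simp add: powr_mult powr_half_sqrt[symmetric] powr_powr)
    then show "\<bar>log_kernel L (sqrt L * w)\<bar> * tail_weight \<alpha> L w \<le> C * \<bar>w\<bar> powr (\<alpha> / 4) * L powr (\<alpha> / 8)"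
      using C(2)[of "sqrt L * w" L] L unfolding a by (simp add: mult.assoc)
  qed
qed

text \<open>At y = sqrt L * w the loss |y|^(\<alpha>/4) becomes |w|^(\<alpha>/4) L^(\<alpha>/8). The
  factor 1/L beats this power of L, so the logarithmic kernel affects the bounds but not the
  limit.\<close>

lemma score_profile_combination:
  assumes a: "(a \<longlongrightarrow> a0) at_top"
  shows "score_profile \<alpha> (\<alpha> / 4) (\<lambda>L y. a L * kernel L y + b / L * log_kernel L y) (- (a0 * tail))"
proof -
  obtain K where K: "K \<ge> 0" "\<And>\<mu> y. \<mu> \<ge> 0 \<Longrightarrow> \<bar>powr_osc \<mu> y\<bar> \<le> K"
    using kernel_bounded by blast
  obtain K' where K': "K' \<ge> 0" "\<And>\<mu> y. \<mu> \<ge> 0 \<Longrightarrow> \<bar>log_osc \<mu> y\<bar> \<le> K'"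
    using log_kernel_bounded by blast
  obtain D where D: "D \<ge> 0"
    "\<And>L y. intensity L \<le> 1 \<Longrightarrow> 1 \<le> \<bar>y\<bar> \<Longrightarrow> \<bar>kernel L y\<bar> * \<bar>y\<bar> powr (1 + \<alpha>) \<le> D"
    using kernel_decay by blast
  obtain D' where D': "D' \<ge> 0"
    "\<And>L w. 1 \<le> L \<Longrightarrow> 1 \<le> sqrt L * \<bar>w\<bar> \<Longrightarrow>
      \<bar>log_kernel L (sqrt L * w)\<bar> * tail_weight \<alpha> L w \<le> D' * \<bar>w\<bar> powr (\<alpha> / 4) * L powr (\<alpha> / 8)"
    using log_kernel_scaled_decay by blast
  define m where "m = \<bar>a0\<bar> + 1"
  have "((\<lambda>L. \<bar>a L\<bar>) \<longlongrightarrow> \<bar>a0\<bar>) at_top" using a by (rule tendsto_rabs)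
  then have "\<forall>\<^sub>F L in at_top. \<bar>a L\<bar> < m" by (rule order_tendstoD(2)) (simp add: m_def)
  then have am: "\<forall>\<^sub>F L in at_top. \<bar>a L\<bar> \<le> m" by eventually_elim simp
  have m: "m \<ge> 0" by (simp add: m_def)
  define C where "C = m * K + \<bar>b\<bar> * K' + m * D + \<bar>b\<bar> * D'"
  have C: "m * K + \<bar>b\<bar> * K' \<le> C" "m * D + \<bar>b\<bar> * D' \<le> C" "0 \<le> C"
    using K D K' D' m by (simp_all add: C_def)
  have bounded: "\<forall>\<^sub>F L in at_top. \<forall>y. \<bar>a L * kernel L y + b / L * log_kernel L y\<bar> \<le> C"
      using am eventually_ge_at_top[of 1]
    proof eventually_elim
      fix L :: real assume L: "\<bar>a L\<bar> \<le> m" "1 \<le> L"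
      have "\<bar>b\<bar> / L \<le> \<bar>b\<bar> / 1" using L by (intro divide_left_mono) auto
      then have bL: "\<bar>b / L\<bar> \<le> \<bar>b\<bar>" using L by (simp add: abs_divide)
      show "\<forall>y. \<bar>a L * kernel L y + b / L * log_kernel L y\<bar> \<le> C"
      proof
        fix y
        have "\<bar>a L * kernel L y + b / L * log_kernel L y\<bar> \<le> \<bar>a L\<bar> * \<bar>kernel L y\<bar> + \<bar>b / L\<bar> * \<bar>log_kernel L y\<bar>"
          unfolding abs_mult[symmetric] by (rule abs_triangle_ineq)
        also have "\<dots> \<le> m * K + \<bar>b\<bar> * K'"
        proof (rule add_mono)
          show "\<bar>a L\<bar> * \<bar>kernel L y\<bar> \<le> m * K"
            using L(1) K(2)[OF less_imp_le[OF intensity_pos[of L]], of y] m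
            unfolding kernel_def by (rule mult_mono) simp
          show "\<bar>b / L\<bar> * \<bar>log_kernel L y\<bar> \<le> \<bar>b\<bar> * K'"
            using bL K'(2)[OF less_imp_le[OF intensity_pos[of L]], of y] abs_ge_zero
            unfolding log_kernel_def by (rule mult_mono) simp
        qed
        also have "\<dots> \<le> C" by (rule C)
        finally show "\<bar>a L * kernel L y + b / L * log_kernel L y\<bar> \<le> C" .
      qed
    qed
  have decay: "\<forall>\<^sub>F L in at_top. \<forall>w. 1 \<le> sqrt L * \<bar>w\<bar> \<longrightarrow>
        \<bar>a L * kernel L (sqrt L * w) + b / L * log_kernel L (sqrt L * w)\<bar> * tail_weight \<alpha> L w \<le> C * (1 + \<bar>w\<bar> powr (\<alpha> / 4))"
      using am eventually_ge_at_top[of 1] intensity_small[OF zero_less_one]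
    proof eventually_elim
      fix L :: real assume L: "\<bar>a L\<bar> \<le> m" "1 \<le> L" "intensity L < 1"
      show "\<forall>w. 1 \<le> sqrt L * \<bar>w\<bar> \<longrightarrow>
        \<bar>a L * kernel L (sqrt L * w) + b / L * log_kernel L (sqrt L * w)\<bar> * tail_weight \<alpha> L w \<le> C * (1 + \<bar>w\<bar> powr (\<alpha> / 4))"
      proof (intro allI impI)
        fix w assume w: "1 \<le> sqrt L * \<bar>w\<bar>"
        let ?P = "tail_weight \<alpha> L w" and ?k = "kernel L (sqrt L * w)" and ?l = "log_kernel L (sqrt L * w)"
        have ay: "\<bar>sqrt L * w\<bar> = sqrt L * \<bar>w\<bar>" using L by (simp add: abs_mult)
        have kP: "\<bar>?k\<bar> * ?P \<le> D" using D(2)[of L "sqrt L * w"] L w unfolding ay by simp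
        have Lp: "L powr (\<alpha> / 8) \<le> L"
          using powr_mono[of "\<alpha> / 8" 1 L] L par by simp
        have lP: "\<bar>?l\<bar> * ?P \<le> D' * \<bar>w\<bar> powr (\<alpha> / 4) * L"
          by (rule order_trans[OF D'(2)[OF L(2) w]], rule mult_left_mono[OF Lp]) (use D' in simp)
        have "\<bar>a L * ?k + b / L * ?l\<bar> * ?P \<le> (\<bar>a L\<bar> * \<bar>?k\<bar> + \<bar>b / L\<bar> * \<bar>?l\<bar>) * ?P"
          unfolding abs_mult[symmetric] by (intro mult_right_mono abs_triangle_ineq) simp
        also have "\<dots> = \<bar>a L\<bar> * (\<bar>?k\<bar> * ?P) + \<bar>b / L\<bar> * (\<bar>?l\<bar> * ?P)"
          by (simp only: ring_distribs mult.assoc)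
        also have "\<dots> \<le> m * D + \<bar>b / L\<bar> * (D' * \<bar>w\<bar> powr (\<alpha> / 4) * L)"
          by (rule add_mono[OF mult_mono[OF L(1) kP m] mult_left_mono[OF lP]]) simp_all
        also have "\<bar>b / L\<bar> * (D' * \<bar>w\<bar> powr (\<alpha> / 4) * L) = \<bar>b\<bar> * D' * \<bar>w\<bar> powr (\<alpha> / 4)"
          using L(2) by (simp add: abs_divide)
        also have "m * D + \<bar>b\<bar> * D' * \<bar>w\<bar> powr (\<alpha> / 4) \<le> C * 1 + C * \<bar>w\<bar> powr (\<alpha> / 4)"
        proof (rule add_mono)
          show "m * D \<le> C * 1" using C(2) D' by (simp add: C_def K K' m)
          have "\<bar>b\<bar> * D' \<le> C" using K D K' D' m by (simp add: C_def)
          then show "\<bar>b\<bar> * D' * \<bar>w\<bar> powr (\<alpha> / 4) \<le> C * \<bar>w\<bar> powr (\<alpha> / 4)" by (rule mult_right_mono) simp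
        qed
        finally show "\<bar>a L * ?k + b / L * ?l\<bar> * ?P \<le> C * (1 + \<bar>w\<bar> powr (\<alpha> / 4))"
          by (simp only: distrib_left)
      qed
    qed
  have limit: "((\<lambda>L. (a L * kernel L (sqrt L * w) + b / L * log_kernel L (sqrt L * w)) * tail_weight \<alpha> L w) \<longlongrightarrow> - (a0 * tail)) at_top"
    if w: "w \<noteq> 0" for w
  proof -
    let ?P = "\<lambda>L. tail_weight \<alpha> L w"
    have big: "\<forall>\<^sub>F L in at_top. 1 \<le> sqrt L * \<bar>w\<bar>"
      using sqrt_scaled_at_top[OF w] unfolding filterlim_at_top by blast
    have "((\<lambda>L. b / L * log_kernel L (sqrt L * w) * ?P L) \<longlongrightarrow> 0) at_top"
    proof (rule Lim_null_comparison)
      show "\<forall>\<^sub>F L in at_top. norm (b / L * log_kernel L (sqrt L * w) * ?P L) \<le> \<bar>b\<bar> * D' * \<bar>w\<bar> powr (\<alpha> / 4) * L powr (\<alpha> / 8 - 1)"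
        using big eventually_ge_at_top[of 1]
      proof eventually_elim
        fix L :: real assume L: "1 \<le> sqrt L * \<bar>w\<bar>" "1 \<le> L"
        have "norm (b / L * log_kernel L (sqrt L * w) * ?P L) = \<bar>b\<bar> / L * (\<bar>log_kernel L (sqrt L * w)\<bar> * ?P L)"
          using L by (simp add: abs_mult)
        also have "\<dots> \<le> \<bar>b\<bar> / L * (D' * \<bar>w\<bar> powr (\<alpha> / 4) * L powr (\<alpha> / 8))"
          using L by (intro mult_left_mono D') auto
        also have "\<dots> = \<bar>b\<bar> * D' * \<bar>w\<bar> powr (\<alpha> / 4) * L powr (\<alpha> / 8 - 1)"
          using L by (simp add: powr_diff)
        finally show "norm (b / L * log_kernel L (sqrt L * w) * ?P L) \<le> \<bar>b\<bar> * D' * \<bar>w\<bar> powr (\<alpha> / 4) * L powr (\<alpha> / 8 - 1)" .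
      qed
      have "((\<lambda>L. L powr (\<alpha> / 8 - 1)) \<longlongrightarrow> 0) at_top"
        using par by (intro tendsto_neg_powr filterlim_ident) auto
      then show "((\<lambda>L. \<bar>b\<bar> * D' * \<bar>w\<bar> powr (\<alpha> / 4) * L powr (\<alpha> / 8 - 1)) \<longlongrightarrow> 0) at_top"
        by (rule tendsto_mult_right_zero)
    qed
    from tendsto_add[OF tendsto_mult[OF a kernel_limit[OF w]] this]
    show ?thesis by (simp add: distrib_right mult.assoc)
  qed
  show ?thesis unfolding score_profile_def
  proof (intro conjI allI impI)
    show "(\<lambda>y. a L * kernel L y + b / L * log_kernel L y) \<in> borel_measurable borel" for L
      by measurable
  qed (rule exI[where x=C], rule exI[where x=1], intro conjI C(3) bounded decay, erule limit)
qed

lemma score_profile_r: "score_profile \<alpha> (\<alpha> / 4) score_r \<alpha>"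
proof -
  have e: "(\<lambda>L y. - (stable_const \<alpha> / pi) * kernel L y + 0 / L * log_kernel L y) = score_r"
    by (simp add: score_r_def fun_eq_iff)
  have "- (- (stable_const \<alpha> / pi) * tail) = \<alpha>"
    using constant_tail by (simp add: field_simps)
  then show ?thesis
    using score_profile_combination[OF tendsto_const, of "- (stable_const \<alpha> / pi)" 0] unfolding e by simp
qed

lemma score_profile_\<alpha>: "score_profile \<alpha> (\<alpha> / 4) (score_\<alpha> c') (\<alpha> / 2)"
proof -
  let ?c = "stable_const \<alpha>"
  have e: "(\<lambda>L y. - (1 / pi) * (c' / L + ?c / 2) * kernel L y + (- (?c / pi)) / L * log_kernel L y) = score_\<alpha> c'"
    by (simp add: score_\<alpha>_def fun_eq_iff algebra_simps)
  have "((\<lambda>L. c' / L) \<longlongrightarrow> 0) at_top"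
    by (rule tendsto_divide_0[OF tendsto_const filterlim_at_top_imp_at_infinity[OF filterlim_ident]])
  from tendsto_mult[OF tendsto_const[of "- (1 / pi)"] tendsto_add[OF this tendsto_const[of "?c / 2"]]]
  have "((\<lambda>L. - (1 / pi) * (c' / L + ?c / 2)) \<longlongrightarrow> - (?c / (2 * pi))) at_top"
    by (simp add: mult.commute)
  from score_profile_combination[OF this, of "- (?c / pi)"]
  have "score_profile \<alpha> (\<alpha> / 4) (score_\<alpha> c') (?c * tail / (2 * pi))" unfolding e by simp
  then show ?thesis unfolding constant_tail by simp
qed

lemma information_limit:
  assumes "score_profile \<alpha> (\<alpha> / 4) A a" "score_profile \<alpha> (\<alpha> / 4) B b"
  shows "((\<lambda>L. L powr (\<alpha> / 2) * (\<integral>y. scale L * A L y * B L y / dens L y \<partial>lborel)) \<longlongrightarrow>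
           2 * a * b / (\<alpha>^2 * (\<sigma> * sqrt (2 - \<alpha>)) powr \<alpha>)) at_top"
proof -
  obtain R where "\<forall>\<^sub>F L in at_top. \<forall>y. \<phi> y / 2 \<le> dens L y"
    "\<forall>\<^sub>F L in at_top. \<forall>y. R \<le> \<bar>y\<bar> \<longrightarrow> \<alpha> / 2 * scale L \<le> dens L y * \<bar>y\<bar> powr (1 + \<alpha>)"
    using dens_lower by blast
  with assms show ?thesis
    using information_integral_limit[where \<sigma>=\<sigma> and r=r and \<alpha>=\<alpha> and \<eta>="\<alpha> / 4" and \<kappa>="\<alpha> / 2" and R=R and A=A and B=B and q=dens and a=a and b=b]
      par dens_limit
    unfolding scale_def by simp
qed

end

section \<open>The statistical model\<close>

text \<open>The stable exponent at time h carries a factor h and the rescaling by sqrt h a factor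
  h^(-\<alpha>/2), together h^(1-\<alpha>/2).\<close>

lemma gaussian_stable_density:
  assumes B: "standard_brownian_motion M B" and S: "symmetric_stable_process M r \<alpha> S"
    and ind: "independent_processes M B S"
    and par: "\<sigma> > 0" "0 < \<alpha>" "\<alpha> < 2" "h > 0"
  shows "lebesgue_density M (\<lambda>\<omega>. \<sigma> * B h \<omega> + S h \<omega>) =
    (\<lambda>x. osc_integral (\<lambda>_. 1) \<sigma> \<alpha> (stable_const \<alpha> * (r * h powr (1 - \<alpha> / 2))) (x / sqrt h) / pi / sqrt h)"
proof -
  interpret prob_space M using B by (simp add: standard_brownian_motion_def levy_process_def)
  have Sm: "S h \<in> borel_measurable M" using S par by (simp add: symmetric_stable_process_def levy_process_def)
  interpret \<nu>: real_distribution "distr M borel (S h)" using Sm by (rule real_distribution_distr)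
  have s: "\<sigma> * sqrt h > 0" using par by simp
  have "distributed M lborel (B h) (\<lambda>x. ennreal (normal_density 0 (sqrt h) x))"
    using B par by (simp add: standard_brownian_motion_def)
  then have "distributed M lborel (\<lambda>\<omega>. 0 + \<sigma> * B h \<omega>) (\<lambda>x. ennreal (normal_density (0 + \<sigma> * 0) (\<bar>\<sigma>\<bar> * sqrt h) x))"
    by (rule normal_density_affine) (use par in auto)
  then have X: "distributed M lborel (\<lambda>\<omega>. \<sigma> * B h \<omega>) (\<lambda>x. ennreal (normal_density 0 (\<sigma> * sqrt h) x))"
    using par by simp
  \<comment> \<open>Independence of the processes passes to time h by evaluating paths at a
    coordinate of the index set, which is measurable on the product space.\<close>
  have "indep_var borel ((\<lambda>f. \<sigma> * f h) \<circ> (\<lambda>\<omega>. \<lambda>t\<in>{0..}. B t \<omega>)) borel ((\<lambda>f. f h) \<circ> (\<lambda>\<omega>. \<lambda>t\<in>{0..}. S t \<omega>))"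
  proof (rule indep_var_compose)
    show "indep_var (\<Pi>\<^sub>M t\<in>{0..}. borel) (\<lambda>\<omega>. \<lambda>t\<in>{0..}. B t \<omega>) (\<Pi>\<^sub>M t\<in>{0..}. borel) (\<lambda>\<omega>. \<lambda>t\<in>{0..}. S t \<omega>)"
      using ind by (simp add: independent_processes_def)
    have "(\<lambda>f. f h) \<in> measurable (\<Pi>\<^sub>M t\<in>{0..}. borel) (borel :: real measure)"
      using par by (intro measurable_component_singleton) auto
    then show "(\<lambda>f. \<sigma> * f h) \<in> measurable (\<Pi>\<^sub>M t\<in>{0..}. borel) (borel :: real measure)"
      "(\<lambda>f. f h) \<in> measurable (\<Pi>\<^sub>M t\<in>{0..}. borel) (borel :: real measure)"
      by (auto intro: borel_measurable_times)
  qed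
  then have i: "indep_var borel (\<lambda>\<omega>. \<sigma> * B h \<omega>) borel (S h)"
    using par by (simp add: comp_def)
  have char: "char (distr M borel (S h)) u = of_real (exp (- (h * (r * stable_const \<alpha>)) * \<bar>u\<bar> powr \<alpha>))" for u
  proof -
    have "char (distr M borel (S h)) u = exp (complex_of_real
        (h * (\<integral>z. (cos (u * z) - 1) * (r * \<alpha> * \<bar>z\<bar> powr (- 1 - \<alpha>)) \<partial>lborel)))"
      using S par by (simp add: symmetric_stable_process_def)
    then show ?thesis unfolding levy_exponent[OF par(2,3)] exp_of_real by (simp add: mult.assoc)
  qed
  have "lebesgue_density M (\<lambda>\<omega>. \<sigma> * B h \<omega> + S h \<omega>) = (\<lambda>x. \<integral>z. normal_density 0 (\<sigma> * sqrt h) (x - z) \<partial>distr M borel (S h))"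
    by (rule lebesgue_density_eqI[OF prob_space_axioms continuous_normal_mixture[OF \<nu>.real_distribution_axioms s]
        _ distributed_normal_mixture[OF X Sm i s]]) simp
  also have "\<dots> = (\<lambda>x. osc_integral (\<lambda>_. 1) (\<sigma> * sqrt h) \<alpha> (h * (r * stable_const \<alpha>)) x / pi)"
    by (simp only: normal_mixture_fourier[OF \<nu>.real_distribution_axioms s char])
  also have "\<dots> = (\<lambda>x. osc_integral (\<lambda>_. 1) \<sigma> \<alpha> (stable_const \<alpha> * (r * h powr (1 - \<alpha> / 2))) (x / sqrt h) / pi / sqrt h)"
  proof -
    have "h powr (1 - \<alpha> / 2) = h * h powr (- \<alpha> / 2)"
      using par powr_add[of h 1 "- \<alpha> / 2"] by simp
    then have "h * (r * stable_const \<alpha>) * h powr (- \<alpha> / 2) = stable_const \<alpha> * (r * h powr (1 - \<alpha> / 2))"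
      by (simp only: mult_ac)
    then show ?thesis by (simp only: osc_integral_rescale[OF par(4)]) (simp add: field_simps)
  qed
  finally show ?thesis .
qed

text \<open>Existence is all that matters: the value c' enters \<open>score_\<alpha>\<close> divided
  by L and disappears in the limit.\<close>

lemma stable_const_differentiable:
  assumes "0 < \<alpha>" "\<alpha> < 2"
  obtains c' where "(stable_const has_real_derivative c') (at \<alpha>)"
proof -
  have "sin (pi * \<alpha> / 2) > 0" using assms by (intro sin_gt_zero) (auto simp: field_simps)
  moreover have "Gamma (1 + \<alpha>) > 0" using assms by (intro Gamma_real_pos) auto
  moreover have "1 + \<alpha> \<notin> \<int>\<^sub>\<le>\<^sub>0" using assms by (auto elim!: nonpos_Ints_cases)
  ultimately have "stable_const field_differentiable (at \<alpha>)"
    unfolding stable_const_def[abs_def]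
    by (intro field_differentiable_divide field_differentiable_mult derivative_intros)
       (auto simp: field_differentiable_def intro!: derivative_eq_intros)
  then show ?thesis using that by (auto simp: field_differentiable_def)
qed

lemma osc_integral_lincomb:
  assumes "set_integrable lborel {0<..} (\<lambda>v. cos (v * y) * f v * exp (- (\<sigma>^2 * v^2 / 2) - \<mu> * v powr \<alpha>))"
    and "set_integrable lborel {0<..} (\<lambda>v. cos (v * y) * g v * exp (- (\<sigma>^2 * v^2 / 2) - \<mu> * v powr \<alpha>))"
  shows "osc_integral (\<lambda>v. a * f v + b * g v) \<sigma> \<alpha> \<mu> y =
    a * osc_integral f \<sigma> \<alpha> \<mu> y + b * osc_integral g \<sigma> \<alpha> \<mu> y"
proof -
  have e: "cos (v * y) * (a * f v + b * g v) * exp (- (\<sigma>^2 * v^2 / 2) - \<mu> * v powr \<alpha>)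
    = a * (cos (v * y) * f v * exp (- (\<sigma>^2 * v^2 / 2) - \<mu> * v powr \<alpha>))
      + b * (cos (v * y) * g v * exp (- (\<sigma>^2 * v^2 / 2) - \<mu> * v powr \<alpha>))" for v
    by (simp add: algebra_simps)
  show ?thesis
    unfolding osc_integral_def e
    by (subst set_integral_add(2)[OF set_integrable_mult_right[OF assms(1)] set_integrable_mult_right[OF assms(2)]])
       (simp only: set_integral_mult_right)
qed

section \<open>The density as a family in both parameters\<close>

context stable_perturbation
begin

text \<open>The locale fixes r and \<alpha>, but differentiation needs the density at neighbouring
  parameters; only \<sigma> is shared.\<close>

definition model :: "real \<Rightarrow> real \<Rightarrow> real \<Rightarrow> real \<Rightarrow> real" where
  "model h r' \<alpha>' x =
     osc_integral (\<lambda>_. 1) \<sigma> \<alpha>' (stable_const \<alpha>' * (r' * h powr (1 - \<alpha>' / 2))) (x / sqrt h) / pi / sqrt h"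

lemma scale_ln:
  assumes "h > 0"
  shows "scale (ln (1 / h)) = r * h powr (1 - \<alpha> / 2)"
  using assms by (simp add: scale_def powr_def ln_div)

lemma model_eq_dens:
  assumes "h > 0"
  shows "model h r \<alpha> x = dens (ln (1 / h)) (x / sqrt h) / sqrt h"
  by (simp add: model_def dens_def scale_ln[OF assms])

lemma model_deriv_r:
  assumes "h > 0"
  shows "((\<lambda>r'. model h r' \<alpha> x) has_real_derivative
    1 / r * (scale (ln (1 / h)) * score_r (ln (1 / h)) (x / sqrt h)) / sqrt h) (at r)"
proof -
  let ?c = "stable_const \<alpha>" and ?k = "h powr (1 - \<alpha> / 2)" and ?y = "x / sqrt h"
  let ?O = "\<lambda>\<mu>. osc_integral (\<lambda>_. 1) \<sigma> \<alpha> \<mu> ?y"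
  have pos: "?c * (r * ?k) > 0" using constant_pos par assms by simp
  \<comment> \<open>The intensity is an interior point of [0, infinity), so the one-sided derivative
    is two-sided here.\<close>
  then have "at (?c * (r * ?k)) within {0..} = at (?c * (r * ?k))"
    by (intro at_within_interior) (simp only: interior_real_atLeast greaterThan_iff)
  then have O: "(?O has_real_derivative - powr_osc (?c * (r * ?k)) ?y) (at (?c * (r * ?k)))"
    using osc_integral_deriv_scale[OF par(1,3) less_imp_le[OF pos], of ?y] by (simp only:)
  have "((\<lambda>r'. ?c * (r' * ?k)) has_real_derivative ?c * ?k) (at r)"
    by (auto intro!: derivative_eq_intros)
  from DERIV_cdivide[OF DERIV_cdivide[OF DERIV_chain2[OF O this]], of pi "sqrt h"]
  have "((\<lambda>r'. model h r' \<alpha> x) has_real_derivative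
     - powr_osc (?c * (r * ?k)) ?y * (?c * ?k) / pi / sqrt h) (at r)"
    unfolding model_def .
  moreover have "- powr_osc (?c * (r * ?k)) ?y * (?c * ?k) / pi / sqrt h
      = 1 / r * (scale (ln (1 / h)) * score_r (ln (1 / h)) ?y) / sqrt h"
    unfolding score_r_def kernel_def scale_ln[OF assms] using par by simp
  ultimately show ?thesis by (simp only:)
qed

lemma model_deriv_\<alpha>:
  assumes h: "0 < h" "h < 1" and c': "(stable_const has_real_derivative c') (at \<alpha>)"
  shows "((\<lambda>\<alpha>'. model h r \<alpha>' x) has_real_derivative
    ln (1 / h) * (scale (ln (1 / h)) * score_\<alpha> c' (ln (1 / h)) (x / sqrt h)) / sqrt h) (at \<alpha>)"
proof -
  let ?c = "stable_const \<alpha>" and ?k = "h powr (1 - \<alpha> / 2)" and ?y = "x / sqrt h"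
  define L where "L = ln (1 / h)"
  have L: "L > 0" "ln h = - L" using h by (simp_all add: L_def ln_div)
  define s where "s = scale L"
  have s: "s = r * ?k" using scale_ln[OF h(1)] by (simp add: s_def L_def)
  let ?m = "\<lambda>\<theta>. stable_const \<theta> * (r * h powr (1 - \<theta> / 2))"
  \<comment> \<open>Differentiating h^(1-\<theta>/2) brings the factor -ln h / 2 = L/2, the leading
    part of the derivative of the intensity; the derivative c' comes without L.\<close>
  have "((\<lambda>\<theta>. h powr (1 - \<theta> / 2)) has_real_derivative (?k * ln h) * (0 - 1 / 2)) (at \<alpha>)"
    by (rule DERIV_chain2[OF has_real_derivative_powr_exponent[OF h(1)]]) (auto intro!: derivative_eq_intros)
  from DERIV_mult[OF c' DERIV_cmult[OF this, of r]]
  have "(?m has_real_derivative c' * (r * ?k) + r * ((?k * ln h) * (0 - 1 / 2)) * ?c) (at \<alpha>)" .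
  moreover have "c' * (r * ?k) + r * ((?k * ln h) * (0 - 1 / 2)) * ?c = s * (c' + ?c * L / 2)"
    unfolding s L(2) by (simp add: algebra_simps)
  ultimately have m: "(?m has_real_derivative s * (c' + ?c * L / 2)) (at \<alpha>)" by (simp only:)
  have ms: "?m \<alpha> = ?c * s" unfolding s by simp
  have pos: "?m \<alpha> > 0" using constant_pos par h by simp
  note D = osc_integral_deriv_index[OF par(1,3,4) m pos, of ?y]
  have i1: "set_integrable lborel {0<..} (\<lambda>v. cos (v * ?y) * v powr \<alpha> * exp (- (\<sigma>^2 * v^2 / 2) - ?m \<alpha> * v powr \<alpha>))"
    by (rule osc_integrable[where K=1 and a=\<alpha> and b=\<alpha>]) (use par pos in auto)
  have i2: "set_integrable lborel {0<..} (\<lambda>v. cos (v * ?y) * (v powr \<alpha> * ln v) * exp (- (\<sigma>^2 * v^2 / 2) - ?m \<alpha> * v powr \<alpha>))"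
  proof (rule osc_integrable[where K="1 / (\<alpha> / 4)" and a="\<alpha> - \<alpha> / 4" and b="\<alpha> + \<alpha> / 4"])
    show "\<bar>v powr \<alpha> * ln v\<bar> \<le> 1 / (\<alpha> / 4) * (v powr (\<alpha> - \<alpha> / 4) + v powr (\<alpha> + \<alpha> / 4))" if "v > 0" for v
      using powr_abs_ln_le[OF that, of "\<alpha> / 4" \<alpha>] par by (simp only: abs_mult abs_of_nonneg[OF powr_ge_zero])
  qed (use par pos in auto)
  from DERIV_cdivide[OF DERIV_cdivide[OF D], of pi "sqrt h"]
  have "((\<lambda>\<alpha>'. model h r \<alpha>' x) has_real_derivative
     - (s * (c' + ?c * L / 2) * kernel L ?y + ?c * s * log_kernel L ?y) / pi / sqrt h) (at \<alpha>)"
    unfolding model_def osc_integral_lincomb[OF i1 i2]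
    unfolding ms kernel_def log_kernel_def s_def .
  moreover have "- (s * (c' + ?c * L / 2) * kernel L ?y + ?c * s * log_kernel L ?y) / pi / sqrt h
      = L * (s * score_\<alpha> c' L ?y) / sqrt h"
  proof -
    have e: "L * (- (1 / pi) * (X * k + Y * l)) = - (1 / pi) * ((L * X) * k + (L * Y) * l)" for X Y k l :: real
      by (simp add: algebra_simps)
    have "L * (c' / L + ?c / 2) = c' + ?c * L / 2" "L * (?c / L) = ?c"
      using L(1) by (simp_all add: distrib_left)
    then have sc: "L * score_\<alpha> c' L ?y = - (1 / pi) * ((c' + ?c * L / 2) * kernel L ?y + ?c * log_kernel L ?y)"
      unfolding score_\<alpha>_def e by (simp only:)
    have "L * (s * score_\<alpha> c' L ?y) / sqrt h = s * (L * score_\<alpha> c' L ?y) / sqrt h" by (simp only: mult.left_commute)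
    also have "\<dots> = - (s * (c' + ?c * L / 2) * kernel L ?y + ?c * s * log_kernel L ?y) / pi / sqrt h"
    proof -
      have "s * (- (1 / pi) * (X * k + Y * l)) = - (s * X * k + Y * s * l) / pi" for X Y k l :: real
        by (simp add: field_simps)
      then show ?thesis unfolding sc by (simp only:)
    qed
    finally show ?thesis by (rule sym)
  qed
  ultimately show ?thesis unfolding L_def s_def by (simp only:)
qed

text \<open>Substitution x = sqrt h * y: two derivatives over one density leave 1 / sqrt h, which
  the Jacobian cancels. One factor \<open>scale L\<close> is kept inside the integral to fit
  \<open>information_limit\<close>, the other is moved out.\<close>

lemma information_entry:
  assumes h: "h > 0"
  shows "(\<integral>x. (k * (scale L * A (x / sqrt h)) / sqrt h) * (l * (scale L * B (x / sqrt h)) / sqrt h)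
      / (dens L (x / sqrt h) / sqrt h) \<partial>lborel)
    = k * l * scale L * (\<integral>y. scale L * A y * B y / dens L y \<partial>lborel)"
proof -
  let ?f = "\<lambda>x. (k * (scale L * A (x / sqrt h)) / sqrt h) * (l * (scale L * B (x / sqrt h)) / sqrt h)
      / (dens L (x / sqrt h) / sqrt h)"
  have "(\<integral>x. ?f x \<partial>lborel) = \<bar>sqrt h\<bar> *\<^sub>R (\<integral>y. ?f (0 + sqrt h * y) \<partial>lborel)"
    using h by (intro lborel_integral_real_affine) auto
  also have "(\<lambda>y. ?f (0 + sqrt h * y)) = (\<lambda>y. (k * l * scale L / sqrt h) * (scale L * A y * B y / dens L y))"
  proof
    fix y
    have e: "(k * (S * u) / Q) * (l * (S * v) / Q) / (d / Q) = (k * l * S / Q) * (S * u * v / d)"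
      if "Q \<noteq> 0" for u v d S Q :: real
      using that by (cases "d = 0") (simp_all add: field_simps)
    have "(0 + sqrt h * y) / sqrt h = y" using h by simp
    then show "?f (0 + sqrt h * y) = (k * l * scale L / sqrt h) * (scale L * A y * B y / dens L y)"
      using e[OF less_imp_neq[OF real_sqrt_gt_zero[OF h], symmetric]] by (simp only:)
  qed
  also have "\<bar>sqrt h\<bar> *\<^sub>R (\<integral>y. (k * l * scale L / sqrt h) * (scale L * A y * B y / dens L y) \<partial>lborel)
     = k * l * scale L * (\<integral>y. scale L * A y * B y / dens L y \<partial>lborel)"
    using h by (simp only: integral_mult_right_zero) simp
  finally show ?thesis .
qed

text \<open>Equality of \<open>p\<close> with the model is assumed on the whole parameter range,
  because equality at one parameter point would not determine the derivatives.\<close>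

lemma fisher_information_model:
  assumes h: "0 < h" "h < 1" and c': "(stable_const has_real_derivative c') (at \<alpha>)"
    and p: "\<And>r' \<alpha>' x. r' > 0 \<Longrightarrow> 0 < \<alpha>' \<Longrightarrow> \<alpha>' < 2 \<Longrightarrow> p r' \<alpha>' x = model h r' \<alpha>' x"
  defines "L \<equiv> ln (1 / h)"
  defines "I \<equiv> \<lambda>A B. \<integral>y. scale L * A L y * B L y / dens L y \<partial>lborel"
  shows "fisher_information p r \<alpha> = vector [
      vector [1 / r * (1 / r) * scale L * I score_r score_r, 1 / r * L * scale L * I score_r (score_\<alpha> c')],
      vector [L * (1 / r) * scale L * I (score_\<alpha> c') score_r, L * L * scale L * I (score_\<alpha> c') (score_\<alpha> c')]]"
proof -
  have d1: "((\<lambda>r'. p r' \<alpha> x) has_real_derivative 1 / r * (scale L * score_r L (x / sqrt h)) / sqrt h) (at r)" for x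
    using model_deriv_r[OF h(1), of x] unfolding L_def
    by (rule has_field_derivative_transform_within_open[where S="{0<..}"]) (use par p in auto)
  have d2: "((\<lambda>\<alpha>'. p r \<alpha>' x) has_real_derivative L * (scale L * score_\<alpha> c' L (x / sqrt h)) / sqrt h) (at \<alpha>)" for x
    using model_deriv_\<alpha>[OF h c', of x] unfolding L_def
    by (rule has_field_derivative_transform_within_open[where S="{0<..<2}"]) (use par p in auto)
  have g: "density_gradient p r \<alpha> x = vector [1 / r * (scale L * score_r L (x / sqrt h)) / sqrt h,
      L * (scale L * score_\<alpha> c' L (x / sqrt h)) / sqrt h]" for x
    unfolding density_gradient_def by (simp only: DERIV_imp_deriv[OF d1] DERIV_imp_deriv[OF d2])
  have d: "p r \<alpha> x = dens L (x / sqrt h) / sqrt h" for x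
    using p[OF par(2-4)] model_eq_dens[OF h(1)] by (simp add: L_def)
  show ?thesis
    unfolding fisher_information_def g d I_def vec_eq_iff forall_2
    by (simp only: vec_lambda_beta vector_2 information_entry[OF h(1)])
qed

end

lemma tendsto_matrix_2:
  fixes f :: "'a \<Rightarrow> real ^ 2 ^ 2"
  assumes "\<And>i j. ((\<lambda>x. f x $ i $ j) \<longlongrightarrow> l $ i $ j) F"
  shows "(f \<longlongrightarrow> l) F"
  by (intro vec_tendstoI assms)

theorem proposition3p1:
  fixes M :: "real \<Rightarrow> real \<Rightarrow> 'w measure"
    and B S Z :: "real \<Rightarrow> real \<Rightarrow> real \<Rightarrow> 'w \<Rightarrow> real"
    and \<sigma> r \<alpha> :: real
  assumes "\<sigma> > 0" and "r > 0" and "0 < \<alpha>" and "\<alpha> < 2"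
    and "\<And>r' \<alpha>'. r' > 0 \<Longrightarrow> 0 < \<alpha>' \<Longrightarrow> \<alpha>' < 2 \<Longrightarrow>
           standard_brownian_motion (M r' \<alpha>') (B r' \<alpha>')"
    and "\<And>r' \<alpha>'. r' > 0 \<Longrightarrow> 0 < \<alpha>' \<Longrightarrow> \<alpha>' < 2 \<Longrightarrow>
           symmetric_stable_process (M r' \<alpha>') r' \<alpha>' (S r' \<alpha>')"
    and "\<And>r' \<alpha>'. r' > 0 \<Longrightarrow> 0 < \<alpha>' \<Longrightarrow> \<alpha>' < 2 \<Longrightarrow>
           independent_processes (M r' \<alpha>') (B r' \<alpha>') (S r' \<alpha>')"
    and "\<And>r' \<alpha>' h \<omega>. Z r' \<alpha>' h \<omega> = \<sigma> * B r' \<alpha>' h \<omega> + S r' \<alpha>' h \<omega>"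
  shows
    "let p = (\<lambda>h r' \<alpha>'. lebesgue_density (M r' \<alpha>') (Z r' \<alpha>' h));
         D = (\<lambda>h. vector [vector [1, 0], vector [0, 1 / ln (1 / h)]] :: real ^ 2 ^ 2);
         L = (2 * r / (\<sigma> powr \<alpha> * (2 - \<alpha>) powr (\<alpha> / 2))) *\<^sub>R
               (vector [vector [1 / r\<^sup>2, 1 / (2 * r)], vector [1 / (2 * r), 1 / 4]] :: real ^ 2 ^ 2)
     in ((\<lambda>h. ((h * ln (1 / h)) powr (\<alpha> / 2) / h) *\<^sub>R
               (D h ** fisher_information (p h) r \<alpha> ** D h)) \<longlongrightarrow> L) (at_right 0)
        \<and> \<not> invertible L"
proof -
  interpret stable_perturbation \<sigma> r \<alpha> using assms by unfold_locales auto
  obtain c' where c': "(stable_const has_real_derivative c') (at \<alpha>)"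
    using stable_const_differentiable[OF assms(3,4)] .
  define p where "p = (\<lambda>h r' \<alpha>'. lebesgue_density (M r' \<alpha>') (Z r' \<alpha>' h))"
  define D where "D = (\<lambda>h. vector [vector [1, 0], vector [0, 1 / ln (1 / h)]] :: real ^ 2 ^ 2)"
  define T where "T = (2 * r / (\<sigma> powr \<alpha> * (2 - \<alpha>) powr (\<alpha> / 2))) *\<^sub>R
               (vector [vector [1 / r\<^sup>2, 1 / (2 * r)], vector [1 / (2 * r), 1 / 4]] :: real ^ 2 ^ 2)"
  define W where "W = \<sigma> powr \<alpha> * (2 - \<alpha>) powr (\<alpha> / 2)"
  have W: "(\<sigma> * sqrt (2 - \<alpha>)) powr \<alpha> = W" "W > 0"
    using assms by (simp_all add: W_def powr_mult powr_half_sqrt[symmetric] powr_powr)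
  define I where "I = (\<lambda>A B L. \<integral>y. scale L * A L y * B L y / dens L y \<partial>lborel)"
  define J where "J = (\<lambda>A B L. L powr (\<alpha> / 2) * I A B L)"

  have to_top: "filterlim (\<lambda>h. ln (1 / h) :: real) at_top (at_right 0)" by real_asymp
  have J_lim: "((\<lambda>h. J A B (ln (1 / h))) \<longlongrightarrow> 2 * a * b / (\<alpha>\<^sup>2 * W)) (at_right 0)"
    if "score_profile \<alpha> (\<alpha> / 4) A a" "score_profile \<alpha> (\<alpha> / 4) B b" for A B a b
    using filterlim_compose[OF information_limit[OF that] to_top] unfolding J_def I_def W .
  have p_model: "p h r' \<alpha>' x = model h r' \<alpha>' x"
    if "h > 0" "r' > 0" "0 < \<alpha>'" "\<alpha>' < 2" for h r' \<alpha>' x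
  proof -
    have "Z r' \<alpha>' h = (\<lambda>\<omega>. \<sigma> * B r' \<alpha>' h \<omega> + S r' \<alpha>' h \<omega>)" using assms(8) by (simp add: fun_eq_iff)
    then show ?thesis
      unfolding p_def model_def
      using gaussian_stable_density[OF assms(5-7)[OF that(2-4)] assms(1) that(3,4,1)] by simp
  qed

  have entries: "((h * ln (1 / h)) powr (\<alpha> / 2) / h) *\<^sub>R (D h ** fisher_information (p h) r \<alpha> ** D h)
      = vector [vector [1 / r * J score_r score_r (ln (1 / h)), J score_r (score_\<alpha> c') (ln (1 / h))],
                vector [J (score_\<alpha> c') score_r (ln (1 / h)), r * J (score_\<alpha> c') (score_\<alpha> c') (ln (1 / h))]]"
    if h: "0 < h" "h < 1" for h
  proof -
    define L where "L = ln (1 / h)"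
    have L: "L > 0" using h by (simp add: L_def)
    have s: "scale L = r * h powr (1 - \<alpha> / 2)" using scale_ln[OF h(1)] by (simp add: L_def)
    have "(h * L) powr (\<alpha> / 2) / h = L powr (\<alpha> / 2) * (h powr (\<alpha> / 2) / h)"
      using h by (simp add: powr_mult mult.commute)
    \<comment> \<open>This factor r / \<open>scale L\<close> cancels the \<open>scale L\<close> that
      stands in front of every entry of the information matrix.\<close>
    also have "h powr (\<alpha> / 2) / h = r / scale L"
    proof -
      have "h powr (\<alpha> / 2) * h powr (1 - \<alpha> / 2) = h" using h by (simp flip: powr_add)
      then show ?thesis unfolding s using h par by (simp add: field_simps)
    qed
    finally have N: "(h * L) powr (\<alpha> / 2) / h = L powr (\<alpha> / 2) * (r / scale L)" .
    have F: "fisher_information (p h) r \<alpha> = vector [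
      vector [1 / r * (1 / r) * scale L * I score_r score_r L, 1 / r * L * scale L * I score_r (score_\<alpha> c') L],
      vector [L * (1 / r) * scale L * I (score_\<alpha> c') score_r L, L * L * scale L * I (score_\<alpha> c') (score_\<alpha> c') L]]"
      using fisher_information_model[OF h c', of "p h"] p_model[OF h(1)] unfolding I_def L_def by simp
    show ?thesis
      unfolding L_def[symmetric] N F
      using L scale_pos[of L] par
      by (simp add: vec_eq_iff forall_2 D_def L_def[symmetric] matrix_matrix_mult_def sum_2 J_def power2_eq_square field_simps)
  qed

  have lim: "((\<lambda>h. vector [vector [1 / r * J score_r score_r (ln (1 / h)), J score_r (score_\<alpha> c') (ln (1 / h))],
                vector [J (score_\<alpha> c') score_r (ln (1 / h)), r * J (score_\<alpha> c') (score_\<alpha> c') (ln (1 / h))]] :: real ^ 2 ^ 2)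
     \<longlongrightarrow> T) (at_right 0)"
  proof (rule tendsto_matrix_2)
    \<comment> \<open>The entries of the target in the form delivered by
      \<open>information_limit\<close>, with profile constants \<alpha> for the score in r and
      \<alpha>/2 for the score in \<alpha>.\<close>
    have T: "T $ 1 $ 1 = 1 / r * (2 * \<alpha> * \<alpha> / (\<alpha>\<^sup>2 * W))" "T $ 1 $ 2 = 2 * \<alpha> * (\<alpha> / 2) / (\<alpha>\<^sup>2 * W)"
      "T $ 2 $ 1 = 2 * (\<alpha> / 2) * \<alpha> / (\<alpha>\<^sup>2 * W)" "T $ 2 $ 2 = r * (2 * (\<alpha> / 2) * (\<alpha> / 2) / (\<alpha>\<^sup>2 * W))"
      unfolding T_def W_def[symmetric] using par W(2) by (simp_all add: power2_eq_square field_simps)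
    note P = score_profile_r score_profile_\<alpha>[of c']
    fix i j :: 2
    have "((\<lambda>h. 1 / r * J score_r score_r (ln (1 / h))) \<longlongrightarrow> T $ 1 $ 1) (at_right 0)"
      "((\<lambda>h. J score_r (score_\<alpha> c') (ln (1 / h))) \<longlongrightarrow> T $ 1 $ 2) (at_right 0)"
      "((\<lambda>h. J (score_\<alpha> c') score_r (ln (1 / h))) \<longlongrightarrow> T $ 2 $ 1) (at_right 0)"
      "((\<lambda>h. r * J (score_\<alpha> c') (score_\<alpha> c') (ln (1 / h))) \<longlongrightarrow> T $ 2 $ 2) (at_right 0)"
      unfolding T by (intro tendsto_mult_left J_lim P)+
    then show "((\<lambda>h. (vector [vector [1 / r * J score_r score_r (ln (1 / h)), J score_r (score_\<alpha> c') (ln (1 / h))],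
                vector [J (score_\<alpha> c') score_r (ln (1 / h)), r * J (score_\<alpha> c') (score_\<alpha> c') (ln (1 / h))]] :: real ^ 2 ^ 2) $ i $ j)
        \<longlongrightarrow> T $ i $ j) (at_right 0)"
      using exhaust_2[of i] exhaust_2[of j] by auto
  qed
  \<comment> \<open>The bound h < 1 makes ln (1/h) positive, so the formula for the entries holds
    only eventually.\<close>
  have "\<forall>\<^sub>F h in at_right 0. h \<in> {0<..<1 :: real}" by (rule eventually_at_right_real) simp
  then have "\<forall>\<^sub>F h in at_right 0.
      vector [vector [1 / r * J score_r score_r (ln (1 / h)), J score_r (score_\<alpha> c') (ln (1 / h))],
              vector [J (score_\<alpha> c') score_r (ln (1 / h)), r * J (score_\<alpha> c') (score_\<alpha> c') (ln (1 / h))]]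
      = ((h * ln (1 / h)) powr (\<alpha> / 2) / h) *\<^sub>R (D h ** fisher_information (p h) r \<alpha> ** D h)"
    by (rule eventually_mono) (simp only: entries greaterThanLessThan_iff)
  from Lim_transform_eventually[OF lim this]
  have "((\<lambda>h. ((h * ln (1 / h)) powr (\<alpha> / 2) / h) *\<^sub>R (D h ** fisher_information (p h) r \<alpha> ** D h)) \<longlongrightarrow> T) (at_right 0)" .
  \<comment> \<open>The determinant is a multiple of (1/r^2) (1/4) - (1/(2 r))^2 = 0.\<close>
  moreover have "\<not> invertible T"
    using par unfolding T_def by (simp add: invertible_det_nz det_2 power2_eq_square)
  ultimately show ?thesis
    unfolding p_def D_def T_def Let_def by blast
qed

end
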